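(* Let $N>0$ and $g_1,g_2\in L^\infty(0,\infty;H)$, and consider the degenerate synchronization intertwinement $$\partial_tv_j+\nu Av_j+B(v_j,v_j)=g_j+P_NB(v_j,v_j),\quad v_j(0)=v_0^j\in V,\qquad j=1,2.$$ Let $\mathfrak g:=\max\{\sup_{t\ge0}|g_1(t)|,\sup_{t\ge0}|g_2(t)|\}/\nu^2$. Suppose $N$ satisfies $$N\ge\max\Big\{\frac{9\sqrt3}{C_L},\,12\sqrt2\,C_L\Big\}\mathfrak g,\qquad N\ge 32\sqrt2\,C_L\big(24(C_L^2+C_S^2\log N)\mathfrak g^2+1\big)^{1/2}\mathfrak g.$$ Then for all $v_0^1,v_0^2\in V$: if $|g_1(t)-g_2(t)|\to0$ as $t\to\infty$, then $|v_1(t)-v_2(t)|\to0$ as $t\to\infty$.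
   Context: Let $\Omega=[0,2\pi]^2$ with periodic boundary conditions. $H$ is the space of $2\pi$-periodic, divergence-free, mean-free vector fields in $L^2(\Omega)^2$, with inner product $(u,v)=\int_\Omega u\cdot v\,dx$ and norm $|u|=(u,u)^{1/2}$; $V$ is the subspace of $H$ consisting of fields in $H^1$, with norm $\|u\|=|\nabla u|$. $\mathbb P$ is the Leray projection, $A=-\mathbb P\Delta$ is the Stokes operator with domain $D(A)$, and $B(u,v)=\mathbb P((u\cdot\nabla)v)$. For real $N>0$, $P_N$ is the orthogonal projection onto the Fourier modes with wavenumbers $k\in\mathbb Z^2\setminus\{0\}$, $|k|\le N$, and $Q_N=I-P_N$. $\nu>0$ is the viscosity. $C_L,C_A,C_S$ are absolute constants such that $\|u\|_{L^4}^2\le C_L\|u\||u|$, $\|u\|_{L^\infty}^2\le C_A|Au||u|$ and $\|P_Nu\|_{L^\infty}\le C_S(\ln N)^{1/2}\|P_Nu\|$. Solutions are the unique global strong solutions: $v_j\in C([0,T];V)\cap L^2(0,T;D(A))$ for every $T>0$. *)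

theory Defs
  imports "HOL-Analysis.Analysis"
begin

text \<open>Vector fields on the torus [0,2pi]^2 are represented by their Fourier
coefficients: a field u(x) = sum_k c k e^{i k.x}, with c k a pair of complex
numbers (the two components), indexed by k in Z^2.\<close>

type_synonym coef = "int \<times> int \<Rightarrow> complex \<times> complex"

definition cmul :: "complex \<Rightarrow> complex \<times> complex \<Rightarrow> complex \<times> complex" where
  "cmul a z = (a * fst z, a * snd z)"

definition kdot :: "int \<times> int \<Rightarrow> complex \<times> complex \<Rightarrow> complex" where
  "kdot k z = of_int (fst k) * fst z + of_int (snd k) * snd z"

definition ksq :: "int \<times> int \<Rightarrow> real" where
  "ksq k = real_of_int (fst k ^ 2 + snd k ^ 2)"

definition cn2 :: "complex \<times> complex \<Rightarrow> real" where
  "cn2 z = (cmod (fst z))^2 + (cmod (snd z))^2"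

definition kminus :: "int \<times> int \<Rightarrow> int \<times> int \<Rightarrow> int \<times> int" where
  "kminus k p = (fst k - fst p, snd k - snd p)"

text \<open>H: real-valued (reality condition), mean-free, divergence-free, L^2.\<close>
definition in_H :: "coef \<Rightarrow> bool" where
  "in_H c \<longleftrightarrow> c (0,0) = (0,0)
     \<and> (\<forall>k. c (- fst k, - snd k) = (cnj (fst (c k)), cnj (snd (c k))))
     \<and> (\<forall>k. kdot k (c k) = 0)
     \<and> (\<lambda>k. cn2 (c k)) summable_on UNIV"

text \<open>|u| = L^2 norm over [0,2pi]^2 (Parseval).\<close>
definition Hnorm :: "coef \<Rightarrow> real" where
  "Hnorm c = sqrt (4 * pi^2 * (\<Sum>\<^sub>\<infinity>k. cn2 (c k)))"

definition in_V :: "coef \<Rightarrow> bool" where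
  "in_V c \<longleftrightarrow> in_H c \<and> (\<lambda>k. ksq k * cn2 (c k)) summable_on UNIV"

definition Vnorm :: "coef \<Rightarrow> real" where
  "Vnorm c = sqrt (4 * pi^2 * (\<Sum>\<^sub>\<infinity>k. ksq k * cn2 (c k)))"

definition in_DA :: "coef \<Rightarrow> bool" where
  "in_DA c \<longleftrightarrow> in_H c \<and> (\<lambda>k. (ksq k)^2 * cn2 (c k)) summable_on UNIV"

definition Anorm :: "coef \<Rightarrow> real" where
  "Anorm c = sqrt (4 * pi^2 * (\<Sum>\<^sub>\<infinity>k. (ksq k)^2 * cn2 (c k)))"

text \<open>Stokes operator A = -P Delta.\<close>
definition Aop :: "coef \<Rightarrow> coef" where
  "Aop c = (\<lambda>k. cmul (of_real (ksq k)) (c k))"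

definition PN :: "real \<Rightarrow> coef \<Rightarrow> coef" where
  "PN N c = (\<lambda>k. if ksq k \<le> N^2 \<and> k \<noteq> (0,0) then c k else (0,0))"

text \<open>Fourier coefficients of (u.grad) v:  sum_{p+q=k} i (u_p . q) v_q.\<close>
definition conv :: "coef \<Rightarrow> coef \<Rightarrow> coef" where
  "conv u v = (\<lambda>k. \<Sum>\<^sub>\<infinity>p. cmul (\<i> * kdot (kminus k p) (u p)) (v (kminus k p)))"

definition leray :: "coef \<Rightarrow> coef" where
  "leray w = (\<lambda>k. if k = (0,0) then (0,0)
      else w k - cmul (kdot k (w k) / of_real (ksq k)) (of_int (fst k), of_int (snd k)))"

definition Bop :: "coef \<Rightarrow> coef \<Rightarrow> coef" where
  "Bop u v = leray (conv u v)"

definition physPN :: "real \<Rightarrow> coef \<Rightarrow> real \<times> real \<Rightarrow> real \<times> real" where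
  "physPN N c x =
    (Re (\<Sum>k\<in>{k. ksq k \<le> N^2 \<and> k \<noteq> (0,0)}. fst (c k) * cis (of_int (fst k) * fst x + of_int (snd k) * snd x)),
     Re (\<Sum>k\<in>{k. ksq k \<le> N^2 \<and> k \<noteq> (0,0)}. snd (c k) * cis (of_int (fst k) * fst x + of_int (snd k) * snd x)))"

text \<open>L^infinity norm of P_N u (continuous and periodic, so sup = ess sup).\<close>
definition Linf_PN :: "real \<Rightarrow> coef \<Rightarrow> real" where
  "Linf_PN N c = (SUP x. norm (physPN N c x))"

definition Sq :: "(real \<times> real) set" where
  "Sq = {0..2*pi} \<times> {0..2*pi}"

definition fcoef :: "(real \<times> real \<Rightarrow> real \<times> real) \<Rightarrow> int \<times> int \<Rightarrow> complex \<times> complex" where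
  "fcoef f k =
    ((1 / (4 * pi^2)) * (LINT x:Sq|lborel. complex_of_real (fst (f x)) * cis (- (of_int (fst k) * fst x + of_int (snd k) * snd x))),
     (1 / (4 * pi^2)) * (LINT x:Sq|lborel. complex_of_real (snd (f x)) * cis (- (of_int (fst k) * fst x + of_int (snd k) * snd x))))"

definition represents :: "(real \<times> real \<Rightarrow> real \<times> real) \<Rightarrow> coef \<Rightarrow> bool" where
  "represents f c \<longleftrightarrow> f \<in> borel_measurable lborel
     \<and> set_integrable lborel Sq (\<lambda>x. (norm (f x))^2)
     \<and> (\<forall>k. fcoef f k = c k)"

definition rhs :: "real \<Rightarrow> real \<Rightarrow> (real \<Rightarrow> coef) \<Rightarrow> (real \<Rightarrow> coef) \<Rightarrow> real \<Rightarrow> coef" where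
  "rhs \<nu> N g v s = (\<lambda>k. - cmul (of_real \<nu>) (Aop (v s) k) + g s k
       - Bop (v s) (v s) k + PN N (Bop (v s) (v s)) k)"

text \<open>Strong solution on [0,\<infinity>): v in C([0,T];V) \<inter> L^2(0,T;D(A)) for all T,
  satisfying the equation in integrated form (mode by mode).\<close>
definition is_solution :: "real \<Rightarrow> real \<Rightarrow> (real \<Rightarrow> coef) \<Rightarrow> coef \<Rightarrow> (real \<Rightarrow> coef) \<Rightarrow> bool" where
  "is_solution \<nu> N g v0 v \<longleftrightarrow>
     v 0 = v0
     \<and> (\<forall>t\<ge>0. in_V (v t))
     \<and> (\<forall>t\<ge>0. \<forall>\<epsilon>>0. \<exists>\<delta>>0. \<forall>s\<ge>0. \<bar>s - t\<bar> < \<delta> \<longrightarrow> Vnorm (\<lambda>k. v s k - v t k) < \<epsilon>)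
     \<and> (\<forall>T\<ge>0. (AE t in lborel. t \<in> {0..T} \<longrightarrow> in_DA (v t))
              \<and> set_integrable lborel {0..T} (\<lambda>t. (Anorm (v t))^2))
     \<and> (\<forall>k. \<forall>t\<ge>0. set_integrable lborel {0..t} (\<lambda>s. rhs \<nu> N g v s k)
              \<and> v t k = v0 k + (LINT s:{0..t}|lborel. rhs \<nu> N g v s k))"

definition Linf_H :: "(real \<Rightarrow> coef) \<Rightarrow> bool" where
  "Linf_H g \<longleftrightarrow> (\<forall>t\<ge>0. in_H (g t)) \<and> (\<exists>M. \<forall>t\<ge>0. Hnorm (g t) \<le> M)
     \<and> (\<forall>k. (\<lambda>t. g t k) \<in> borel_measurable (restrict_space lborel {0..}))"

definition gfrak :: "real \<Rightarrow> (real \<Rightarrow> coef) \<Rightarrow> (real \<Rightarrow> coef) \<Rightarrow> real" where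
  "gfrak \<nu> g1 g2 = max (SUP t\<in>{0..}. Hnorm (g1 t)) (SUP t\<in>{0..}. Hnorm (g2 t)) / \<nu>^2"

end

theory Submission
  imports Defs
begin

text \<open>The low modes P_N v_j solve linear equations, so they are asymptotically bounded by the forcing, and the
  low modes of w = v_1 - v_2 tend to zero. For the high modes, (B(v,v), Q_N v) only involves terms of the form
  b(u, \<cdot>, u), which Ladyzhenskaya's inequality controls; together with the gain |Q_N u| \<le> |Q_N u|_V / max(1,N)
  this bounds the time averages of the squared V-norm of v_j. In the equation for Q_N w the only dangerous term
  b(Q_N w, v_1, Q_N w) is at most C_L |Q_N w|_V |Q_N w| |v_1|_V, and by the condition on N its averaged
  contribution is dominated by the dissipation, so that Gronwall's inequality gives decay. If N < 1
  then P_N vanishes and ln N is negative; there the first condition on N takes over.\<close>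

text \<open>All estimates are made on Fourier coefficients. The equation is known only mode by mode
  and in integrated form, so the energy of the infinitely many high modes has to be differentiated
  termwise; the integrable majorant for this comes from the L^2(0,T;D(A)) regularity, since D(A)
  embeds into the absolutely convergent Fourier series. Physical space enters only once, where
  Ladyzhenskaya's inequality is applied to trigonometric polynomials to bound b(u,v,u). As the
  V-norm of a solution is controlled only on average, the Gronwall coefficient may change sign; a
  lower bound for its integrals, with a loss \<open>K\<close> that is the same for all starting
  times, replaces a pointwise bound. Both conditions on N are condensed into 100 (C G)^2 (1 + (C
  G)^2) \<le> (max 1 N)^2, with G slightly above the number \<open>gfrak\<close> so that the low
  modes enter the ball of radius \<nu> G in finite time. The averages of the squared V-norms are
  then at most 7/2 \<nu>^2 G^2 (1 + (C G)^2), and the dangerous term costs at most the fraction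
  7/200 of \<nu> (max 1 N)^2.\<close>

section \<open>Absolutely continuous functions and Gronwall's inequality\<close>

text \<open>\<open>has_prim F f\<close>: F is locally absolutely continuous on [0,\<infinity>) with almost everywhere derivative f.\<close>

definition has_prim :: "(real \<Rightarrow> 'a::{banach,second_countable_topology}) \<Rightarrow> (real \<Rightarrow> 'a) \<Rightarrow> bool" where
  "has_prim F f \<longleftrightarrow> (\<forall>t\<ge>0. set_integrable lborel {0..t} f \<and> F t = F 0 + (LINT s:{0..t}|lborel. f s))"

lemma has_prim_integrable:
  assumes "has_prim F f" "0 \<le> s"
  shows "set_integrable lborel {s..t} f"
proof (cases "s \<le> t")
  case True
  show ?thesis
    by (rule set_integrable_subset[of _ "{0..t}"]) (use assms True in \<open>auto simp: has_prim_def\<close>)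
next
  case False
  then show ?thesis by (simp add: set_integrable_def)
qed

lemma has_prim_eq:
  assumes "has_prim F f" "0 \<le> t"
  shows "F t = F 0 + (LINT s:{0..t}|lborel. f s)"
  using assms unfolding has_prim_def by blast

lemma has_prim_diff_eq:
  fixes F :: "real \<Rightarrow> 'a::{banach,second_countable_topology}"
  assumes F: "has_prim F f" and st: "0 \<le> s" "s \<le> t"
  shows "F t - F s = (LINT r:{s..t}|lborel. f r)"
proof -
  have Ft: "F t = F 0 + (LINT r:{0..t}|lborel. f r)" and Fs: "F s = F 0 + (LINT r:{0..s}|lborel. f r)"
    using has_prim_eq[OF F, of t] has_prim_eq[OF F, of s] st by simp_all
  have un: "{0..s} \<union> {s..t} = {0..t}" using st by auto
  have "(LINT r:{0..s} \<union> {s..t}|lborel. f r) = (LINT r:{0..s}|lborel. f r) + (LINT r:{s..t}|lborel. f r)"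
  proof (rule set_integral_Un_AE)
    have "AE r in lborel. r \<noteq> s"
      by (rule AE_lborel_singleton)
    then show "AE r in lborel. \<not> (r \<in> {0..s} \<and> r \<in> {s..t})"
      by eventually_elim auto
  qed (use has_prim_integrable[OF F] st in auto)
  then show ?thesis
    using Ft Fs unfolding un by simp
qed

lemma has_prim_continuous:
  fixes F :: "real \<Rightarrow> 'a::euclidean_space"
  assumes F: "has_prim F f"
  shows "continuous_on {0..} F"
proof -
  have "continuous_on {0..T} F" for T
  proof -
    have int: "f integrable_on {0..T}"
      using has_prim_integrable[OF F, of 0 T] set_borel_integral_eq_integral(1) by blast
    have "continuous_on {0..T} (\<lambda>t. F 0 + integral {0..t} f)"
      by (intro continuous_intros indefinite_integral_continuous_1 int)
    moreover have "F 0 + integral {0..t} f = F t" if "t \<in> {0..T}" for t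
      using has_prim_eq[OF F, of t] that has_prim_integrable[OF F, of 0 t] set_borel_integral_eq_integral(2)[of "{0..t}" f]
      by simp
    ultimately show ?thesis
      by (rule continuous_on_eq)
  qed
  then show ?thesis
    unfolding continuous_on_eq_continuous_within
  proof (intro ballI)
    fix x :: real assume x: "x \<in> {0..}" and *: "\<And>T. \<forall>x\<in>{0..T}. continuous (at x within {0..T}) F"
    have "at x within {0..x+1} = at x within {0..}"
      by (rule at_within_nhd[of _ "{..<x+1}"]) auto
    moreover have "continuous (at x within {0..x+1}) F"
      using *[of "x+1"] x by auto
    ultimately show "continuous (at x within {0..}) F"
      by (simp add: continuous_within)
  qed
qed

section \<open>Calculus of locally absolutely continuous functions\<close>

lemma has_prim_bounded_linear:
  fixes F :: "real \<Rightarrow> 'a::{banach,second_countable_topology}"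
    and L :: "'a \<Rightarrow> 'b::{banach,second_countable_topology}"
  assumes L: "bounded_linear L" and F: "has_prim F f"
  shows "has_prim (\<lambda>t. L (F t)) (\<lambda>t. L (f t))"
proof -
  interpret bounded_linear L by fact
  have eq: "(\<lambda>r. indicator {0..t} r *\<^sub>R L (f r)) = (\<lambda>r. L (indicator {0..t} r *\<^sub>R f r))" for t :: real
    by (simp add: scaleR)
  have "set_integrable lborel {0..t} (\<lambda>t. L (f t)) \<and> L (F t) = L (F 0) + (LINT s:{0..t}|lborel. L (f s))"
    if "t \<ge> 0" for t
  proof -
    have int: "integrable lborel (\<lambda>r. indicator {0..t} r *\<^sub>R f r)"
      and Ft: "F t = F 0 + (LINT s:{0..t}|lborel. f s)"
      using has_prim_integrable[OF F, of 0 t] has_prim_eq[OF F that] by (simp_all add: set_integrable_def)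
    show ?thesis
      unfolding set_integrable_def set_lebesgue_integral_def eq
      using integrable_bounded_linear[OF L int] integral_bounded_linear[OF L int] Ft
      by (simp add: add set_lebesgue_integral_def)
  qed
  then show ?thesis unfolding has_prim_def by blast
qed

lemma has_prim_add:
  assumes F: "has_prim F f" and G: "has_prim G g"
  shows "has_prim (\<lambda>t. F t + G t) (\<lambda>t. f t + g t)"
  unfolding has_prim_def
proof (intro allI impI)
  fix t :: real assume t: "t \<ge> 0"
  note int = has_prim_integrable[OF F order_refl] has_prim_integrable[OF G order_refl]
  show "set_integrable lborel {0..t} (\<lambda>t. f t + g t) \<and>
    F t + G t = F 0 + G 0 + (LINT s:{0..t}|lborel. f s + g s)"
    using set_integral_add[OF int[of t]] has_prim_eq[OF F t] has_prim_eq[OF G t] by simp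
qed

lemma has_prim_diff:
  assumes "has_prim F f" "has_prim G g"
  shows "has_prim (\<lambda>t. F t - G t) (\<lambda>t. f t - g t)"
  using has_prim_add[OF assms(1) has_prim_bounded_linear[OF bounded_linear_minus[OF bounded_linear_ident] assms(2)]] by simp

lemma has_prim_const: "has_prim (\<lambda>_. c) (\<lambda>_. 0)"
  by (simp add: has_prim_def set_integrable_def)

lemma has_prim_sum:
  assumes "\<And>i. i \<in> I \<Longrightarrow> has_prim (F i) (f i)"
  shows "has_prim (\<lambda>t. \<Sum>i\<in>I. F i t) (\<lambda>t. \<Sum>i\<in>I. f i t)"
  using assms
proof (induction I rule: infinite_finite_induct)
  case (insert x A)
  have "has_prim (\<lambda>t. F x t + (\<Sum>i\<in>A. F i t)) (\<lambda>t. f x t + (\<Sum>i\<in>A. f i t))"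
    by (intro has_prim_add insert) (use insert.prems in auto)
  then show ?case using insert.hyps by simp
qed (simp_all add: has_prim_const)

text \<open>Integration by parts by Fubini: the integral of f(s) g(r) over the square [0,t]^2 is the
  product of the two increments, and cutting the square along the diagonal turns it into the
  integrals of f (G - G 0) and (F - F 0) g.\<close>

lemma has_prim_mult:
  fixes F G :: "real \<Rightarrow> 'a::{real_normed_field,banach,second_countable_topology}"
  assumes F: "has_prim F f" and G: "has_prim G g"
  shows "has_prim (\<lambda>t. F t * G t) (\<lambda>t. f t * G t + F t * g t)"
proof -
  have "set_integrable lborel {0..t} (\<lambda>t. f t * G t + F t * g t) \<and>
        F t * G t = F 0 * G 0 + (LINT s:{0..t}|lborel. f s * G s + F s * g s)"
    if t: "t \<ge> 0" for t
  proof -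
    define f' where "f' = (\<lambda>s. indicator {0..t} s *\<^sub>R f s)"
    define g' where "g' = (\<lambda>s. indicator {0..t} s *\<^sub>R g s)"
    have intf: "integrable lborel f'" and intg: "integrable lborel g'"
      using has_prim_integrable[OF F, of 0 t] has_prim_integrable[OF G, of 0 t]
      by (simp_all add: set_integrable_def f'_def g'_def)
    have [measurable]: "f' \<in> borel_measurable borel" "g' \<in> borel_measurable borel"
      using intf intg by (auto dest: borel_measurable_integrable)
    have J: "integrable (lborel \<Otimes>\<^sub>M lborel) (\<lambda>(s,r). f' s * g' r)"
    proof (rule lborel_pair.Fubini_integrable)
      show "integrable lborel (\<lambda>x. LINT y|lborel. norm (case (x, y) of (s, r) \<Rightarrow> f' s * g' r))"
        using intf by (simp add: norm_mult)
    qed (use intg in auto)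
    \<comment> \<open>The diagonal belongs to \<open>J1\<close>, so its section at s is g on the
      closed interval [0,s]. The section of \<open>J2\<close> misses one endpoint, which is repaired
      almost everywhere.\<close>
    define J1 where "J1 = (\<lambda>s r. if r \<le> s then f' s * g' r else 0)"
    define J2 where "J2 = (\<lambda>s r. if s < r then f' s * g' r else 0)"
    have J1: "integrable (lborel \<Otimes>\<^sub>M lborel) (case_prod J1)"
      by (rule Bochner_Integration.integrable_bound[OF J]) (auto simp: J1_def split_beta)
    have J2: "integrable (lborel \<Otimes>\<^sub>M lborel) (case_prod J2)"
      by (rule Bochner_Integration.integrable_bound[OF J]) (auto simp: J2_def split_beta)
    have G': "(LINT r|lborel. J1 s r) = f' s * (G s - G 0)" for s
    proof (cases "s \<in> {0..t}")
      case True
      have "J1 s = (\<lambda>r. f' s * (indicator {0..s} r *\<^sub>R g r))"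
        using True by (auto simp: J1_def g'_def indicator_def fun_eq_iff)
      moreover have "G s - G 0 = (LINT r|lborel. indicator {0..s} r *\<^sub>R g r)"
        using has_prim_eq[OF G, of s] True by (simp add: set_lebesgue_integral_def)
      ultimately show ?thesis by (simp del: mult_scaleR_right)
    next
      case False
      then have "f' s = 0" by (auto simp: f'_def indicator_def)
      then show ?thesis by (simp add: J1_def cong: if_cong)
    qed
    have F': "(LINT s|lborel. J2 s r) = (F r - F 0) * g' r" for r
    proof (cases "r \<in> {0..t}")
      case True
      have [measurable]: "(\<lambda>s. indicator {0..r} s *\<^sub>R f s) \<in> borel_measurable borel"
        using has_prim_integrable[OF F, of 0 r] by (auto simp: set_integrable_def dest!: borel_measurable_integrable)
      have "(LINT s|lborel. J2 s r) = (LINT s|lborel. (indicator {0..r} s *\<^sub>R f s) * g' r)"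
      proof (rule integral_cong_AE)
        have "AE s in lborel. s \<noteq> r"
          by (rule AE_lborel_singleton)
        then show "AE s in lborel. J2 s r = (indicator {0..r} s *\<^sub>R f s) * g' r"
          by eventually_elim (use True in \<open>auto simp: J2_def f'_def indicator_def\<close>)
      qed (auto simp: J2_def simp del: mult_scaleR_left)
      moreover have "F r - F 0 = (LINT s|lborel. indicator {0..r} s *\<^sub>R f s)"
        using has_prim_eq[OF F, of r] True by (simp add: set_lebesgue_integral_def)
      ultimately show ?thesis by (simp del: mult_scaleR_left)
    next
      case False
      then have "g' r = 0" by (auto simp: g'_def indicator_def)
      then show ?thesis by (simp add: J2_def cong: if_cong)
    qed
    have i1: "integrable lborel (\<lambda>s. f' s * (G s - G 0))"
      using lborel_pair.integrable_fst[OF J1] by (simp add: G')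
    have i2: "integrable lborel (\<lambda>r. (F r - F 0) * g' r)"
      using lborel_pair.integrable_snd[OF J2] by (simp add: F')
    have "(LINT s|lborel. f' s * (G s - G 0)) + (LINT r|lborel. (F r - F 0) * g' r)
        = integral\<^sup>L (lborel \<Otimes>\<^sub>M lborel) (case_prod J1) + integral\<^sup>L (lborel \<Otimes>\<^sub>M lborel) (case_prod J2)"
      using lborel_pair.integral_fst[OF J1] lborel_pair.integral_snd[OF J2] by (simp add: G' F')
    also have "\<dots> = integral\<^sup>L (lborel \<Otimes>\<^sub>M lborel) (\<lambda>x. case_prod J1 x + case_prod J2 x)"
      using J1 J2 by simp
    also have "(\<lambda>x. case_prod J1 x + case_prod J2 x) = (\<lambda>(s,r). f' s * g' r)"
      by (auto simp: J1_def J2_def fun_eq_iff)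
    also have "integral\<^sup>L (lborel \<Otimes>\<^sub>M lborel) \<dots> = (LINT s|lborel. (LINT r|lborel. f' s * g' r))"
      using lborel_pair.integral_fst[OF J] by simp
    also have "\<dots> = integral\<^sup>L lborel f' * integral\<^sup>L lborel g'"
      by simp
    finally have eq: "(LINT s|lborel. f' s * (G s - G 0)) + (LINT r|lborel. (F r - F 0) * g' r)
       = integral\<^sup>L lborel f' * integral\<^sup>L lborel g'" .
    \<comment> \<open>Writing G as (G - G 0) + G 0, and F likewise, isolates the two triangle
      integrals computed above.\<close>
    have tot: "(\<lambda>s. indicator {0..t} s *\<^sub>R (f s * G s + F s * g s))
       = (\<lambda>s. (f' s * (G s - G 0) + (F s - F 0) * g' s) + (f' s * G 0 + F 0 * g' s))"
      by (auto simp: f'_def g'_def indicator_def algebra_simps)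
    have int: "integrable lborel (\<lambda>s. indicator {0..t} s *\<^sub>R (f s * G s + F s * g s))"
      unfolding tot using i1 i2 intf intg by simp
    have "(LINT s|lborel. indicator {0..t} s *\<^sub>R (f s * G s + F s * g s)) =
       integral\<^sup>L lborel f' * integral\<^sup>L lborel g' + (integral\<^sup>L lborel f' * G 0 + F 0 * integral\<^sup>L lborel g')"
      unfolding tot using i1 i2 intf intg by (simp add: eq)
    moreover have "F t = F 0 + integral\<^sup>L lborel f'" "G t = G 0 + integral\<^sup>L lborel g'"
      using has_prim_eq[OF F t] has_prim_eq[OF G t] by (simp_all add: set_lebesgue_integral_def f'_def g'_def)
    ultimately show ?thesis
      using int by (simp add: set_integrable_def set_lebesgue_integral_def algebra_simps)
  qed
  then show ?thesis unfolding has_prim_def by blast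
qed

lemma has_prim_C1:
  fixes F :: "real \<Rightarrow> 'a::euclidean_space"
  assumes "\<And>t. t \<ge> 0 \<Longrightarrow> (F has_vector_derivative f t) (at t within {0..})"
    and f: "continuous_on {0..} f"
  shows "has_prim F f"
proof -
  have "set_integrable lborel {0..t} f \<and> F t = F 0 + (LINT s:{0..t}|lborel. f s)" if "t \<ge> 0" for t
  proof -
    have c: "continuous_on {0..t} f"
      using f by (rule continuous_on_subset) auto
    have "(LINT s:{0..t}|lborel. f s) = F t - F 0"
      unfolding set_lebesgue_integral_def
      by (rule integral_FTC_atLeastAtMost[OF that _ c])
         (rule has_vector_derivative_within_subset[OF assms(1)], auto)
    then show ?thesis
      using borel_integrable_atLeastAtMost'[OF c] by simp
  qed
  then show ?thesis unfolding has_prim_def by blast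
qed

lemma continuous_has_antiderivative:
  fixes a :: "real \<Rightarrow> real"
  assumes a: "continuous_on {0..} a"
  obtains A where "A 0 = 0" "\<And>t. t \<ge> 0 \<Longrightarrow> (A has_vector_derivative a t) (at t within {0..})"
proof (rule that[of "\<lambda>u. integral {0..u} a"])
  show "integral {0..0} a = 0" by simp
  fix t :: real assume t: "t \<ge> 0"
  have "((\<lambda>u. integral {0..u} a) has_vector_derivative a t) (at t within {0..t+1})"
    by (rule integral_has_vector_derivative) (use a t in \<open>auto intro: continuous_on_subset\<close>)
  moreover have "at t within {0..t+1} = at t within {0..}"
    by (rule at_within_nhd[of _ "{..<t+1}"]) auto
  ultimately show "((\<lambda>u. integral {0..u} a) has_vector_derivative a t) (at t within {0..})"
    by simp
qed

section \<open>Comparison of increments and Gronwall's inequality\<close>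

lemma has_prim_mono:
  fixes F G :: "real \<Rightarrow> real"
  assumes F: "has_prim F f" and G: "has_prim G g" and st: "0 \<le> s" "s \<le> t"
    and le: "AE r in lborel. s \<le> r \<longrightarrow> r \<le> t \<longrightarrow> f r \<le> g r"
  shows "F t - F s \<le> G t - G s"
  unfolding has_prim_diff_eq[OF F st] has_prim_diff_eq[OF G st]
  by (rule set_integral_mono_AE)
     (use le has_prim_integrable[OF F st(1)] has_prim_integrable[OF G st(1)] in auto)

text \<open>The integrating factor is the exponential of an antiderivative of \<open>a\<close>. The
  coefficient \<open>a\<close> may be negative at times; only its integrals up to t are bounded
  below, and the loss \<open>K\<close> there costs a factor exp K in both terms.\<close>

lemma gronwall_average:
  fixes Y h a :: "real \<Rightarrow> real"
  assumes Y: "has_prim Y h" and a: "continuous_on {0..} a" and A: "has_prim A a"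
    and s: "0 \<le> s" and st: "s \<le> t" and \<alpha>: "\<alpha> > 0" and \<beta>: "\<beta> \<ge> 0" and Ys: "Y s \<ge> 0"
    and h: "AE r in lborel. s \<le> r \<longrightarrow> r \<le> t \<longrightarrow> h r \<le> - a r * Y r + \<beta>"
    and avg: "\<And>r. s \<le> r \<Longrightarrow> r \<le> t \<Longrightarrow> A t - A r \<ge> \<alpha> * (t - r) - K"
  shows "Y t \<le> exp (K - \<alpha> * (t - s)) * Y s + \<beta> * exp K / \<alpha>"
proof -
  \<comment> \<open>\<open>A\<close> is a primitive in the almost-everywhere sense only. Continuity
    of \<open>a\<close> yields an antiderivative that is differentiable at every point and has the
    same increments, so the chain rule applies to its exponential.\<close>
  obtain A' where A': "A' 0 = 0" "\<And>t. t \<ge> 0 \<Longrightarrow> (A' has_vector_derivative a t) (at t within {0..})"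
    using continuous_has_antiderivative[OF a] by blast
  have pA': "has_prim A' a"
    by (rule has_prim_C1[OF A'(2) a])
  have cA': "continuous_on {0..} A'"
    using has_prim_continuous[OF pA'] .
  have diffA: "A' t - A' r = A t - A r" if "s \<le> r" "r \<le> t" for r
    using has_prim_diff_eq[OF A, of r t] has_prim_diff_eq[OF pA', of r t] s that by simp
  define E where "E = (\<lambda>t. exp (A' t))"
  have pE: "has_prim E (\<lambda>t. a t * E t)"
  proof (rule has_prim_C1)
    fix t :: real assume "t \<ge> 0"
    show "(E has_vector_derivative a t * E t) (at t within {0..})"
      using A'(2)[OF \<open>t \<ge> 0\<close>] unfolding E_def has_real_derivative_iff_has_vector_derivative[symmetric]
      by (auto intro!: derivative_eq_intros)
  qed (auto simp: E_def intro!: continuous_intros a cA')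
  \<comment> \<open>Here t is fixed. The averaged bound gives E r \<le> E t exp (K - \<alpha> (t -
    r)), so \<open>g\<close> majorizes \<beta> E r, and \<open>G\<close> is an explicit primitive of
    \<open>g\<close>.\<close>
  define G where "G = (\<lambda>r. \<beta> * E t * exp K / \<alpha> * exp (- \<alpha> * (t - r)))"
  define g where "g = (\<lambda>r. \<beta> * E t * exp K * exp (- \<alpha> * (t - r)))"
  have pG: "has_prim G g"
  proof (rule has_prim_C1)
    fix r :: real assume "r \<ge> 0"
    show "(G has_vector_derivative g r) (at r within {0..})"
      unfolding G_def g_def has_real_derivative_iff_has_vector_derivative[symmetric]
      using \<alpha> by (auto intro!: derivative_eq_intros)
  qed (auto simp: g_def intro!: continuous_intros)
  have "E t * Y t - E s * Y s \<le> G t - G s"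
  proof (rule has_prim_mono[OF has_prim_mult[OF pE Y] pG s st])
    show "AE r in lborel. s \<le> r \<longrightarrow> r \<le> t \<longrightarrow> a r * E r * Y r + E r * h r \<le> g r"
      using h
    proof eventually_elim
      case (elim r)
      show ?case
      proof (intro impI)
        assume r: "s \<le> r" "r \<le> t"
        have "E r * h r \<le> E r * (- a r * Y r + \<beta>)"
          using elim r by (intro mult_left_mono) (auto simp: E_def)
        then have "a r * E r * Y r + E r * h r \<le> \<beta> * E r"
          by (simp add: algebra_simps)
        also have "E r \<le> E t * exp K * exp (- \<alpha> * (t - r))"
          using avg[OF r] diffA[OF r] by (simp add: E_def flip: exp_add)
        then have "\<beta> * E r \<le> g r"
          using \<beta> by (simp add: g_def mult.assoc mult_left_mono)
        finally show "a r * E r * Y r + E r * h r \<le> g r" .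
      qed
    qed
  qed
  moreover have "G s \<ge> 0" "G t = E t * (\<beta> * exp K / \<alpha>)"
    using \<alpha> \<beta> by (auto simp: G_def E_def)
  moreover have "E s * Y s \<le> E t * (exp (K - \<alpha> * (t - s)) * Y s)"
  proof -
    have "E s \<le> E t * exp (K - \<alpha> * (t - s))"
      using avg[of s] diffA[of s] st by (simp add: E_def flip: exp_add)
    then show ?thesis using Ys by (simp add: mult_right_mono flip: mult.assoc)
  qed
  ultimately have "E t * Y t \<le> E t * (exp (K - \<alpha> * (t - s)) * Y s + \<beta> * exp K / \<alpha>)"
    by (simp add: distrib_left)
  then show ?thesis
    by (simp add: E_def)
qed

text \<open>\<open>has_sum\<close> is convergence along the filter of finite sets, whereas dominated
  convergence is about sequences. The initial segments of the enumeration \<open>to_nat\<close> are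
  a cofinal sequence of finite sets.\<close>

lemma has_sum_imp_tendsto_to_nat:
  fixes f :: "'i::countable \<Rightarrow> 'a::{comm_monoid_add,topological_space}"
  assumes "(f has_sum S) X"
  shows "(\<lambda>n. \<Sum>i\<in>{i\<in>X. to_nat i < n}. f i) \<longlonglongrightarrow> S"
proof -
  have fin: "finite {i::'i. i \<in> X \<and> to_nat i < n}" for n
    by (rule finite_subset[of _ "to_nat -` {..<n}"]) (auto intro!: finite_vimageI)
  have "filterlim (\<lambda>n. {i\<in>X. to_nat i < n}) (finite_subsets_at_top X) sequentially"
    unfolding filterlim_finite_subsets_at_top
  proof (intro allI impI)
    fix F assume F: "finite F \<and> F \<subseteq> X"
    have "\<exists>N. \<forall>i\<in>F. to_nat i < N"
      using F finite_nat_set_iff_bounded[of "to_nat ` F"] by auto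
    then obtain N where N: "\<forall>i\<in>F. to_nat i < N" by blast
    show "\<forall>\<^sub>F n in sequentially. finite {i\<in>X. to_nat i < n} \<and> F \<subseteq> {i\<in>X. to_nat i < n} \<and> {i\<in>X. to_nat i < n} \<subseteq> X"
      using eventually_ge_at_top[of N]
      by eventually_elim (use F N fin in fastforce)
  qed
  then show ?thesis
    using assms unfolding has_sum_def by (rule filterlim_compose[rotated])
qed

text \<open>Dominated convergence for the partial sums along an enumeration. What has to be supplied
  is one integrable bound, almost everywhere in time, for all finite sums of the absolute
  derivatives.\<close>

lemma has_prim_infsum:
  fixes F f :: "'i::countable \<Rightarrow> real \<Rightarrow> real"
  assumes F: "\<And>i. i \<in> X \<Longrightarrow> has_prim (F i) (f i)"
    and sum: "\<And>t. t \<ge> 0 \<Longrightarrow> ((\<lambda>i. F i t) has_sum Y t) X"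
    and D: "\<And>t. t \<ge> 0 \<Longrightarrow> set_integrable lborel {0..t} D"
    and dom: "AE t in lborel. t \<ge> 0 \<longrightarrow> (\<forall>I. finite I \<longrightarrow> I \<subseteq> X \<longrightarrow> (\<Sum>i\<in>I. \<bar>f i t\<bar>) \<le> D t)"
  obtains h where "has_prim Y h" "AE t in lborel. t \<ge> 0 \<longrightarrow> ((\<lambda>i. f i t) has_sum h t) X"
proof -
  define I where "I n = {i\<in>X. to_nat i < n}" for n
  have fin: "finite (I n)" for n
    unfolding I_def by (rule finite_subset[of _ "to_nat -` {..<n}"]) (auto intro!: finite_vimageI)
  have sub: "I n \<subseteq> X" for n by (auto simp: I_def)
  \<comment> \<open>The total operator \<open>lim\<close> keeps the limit measurable without
    treating separately the null set where the partial sums may diverge; off that set it is the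
    sum.\<close>
  define h where "h t = lim (\<lambda>n. \<Sum>i\<in>I n. f i t)" for t
  have hs: "AE t in lborel. t \<ge> 0 \<longrightarrow> ((\<lambda>i. f i t) has_sum h t) X"
    using dom
  proof eventually_elim
    case (elim t)
    show ?case
    proof
      assume "t \<ge> 0"
      have "(\<lambda>i. norm (f i t)) summable_on X"
        by (rule nonneg_bdd_above_summable_on)
           (use elim \<open>t \<ge> 0\<close> in \<open>auto intro!: bdd_aboveI2[of _ _ "D t"]\<close>)
      then have "(\<lambda>i. f i t) summable_on X" by (rule abs_summable_summable)
      then obtain S where S: "((\<lambda>i. f i t) has_sum S) X" by (auto simp: summable_on_def)
      then have "h t = S"
        unfolding h_def I_def by (intro limI has_sum_imp_tendsto_to_nat)
      then show "((\<lambda>i. f i t) has_sum h t) X" using S by simp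
    qed
  qed
  have "set_integrable lborel {0..t} h \<and> Y t = Y 0 + (LINT s:{0..t}|lborel. h s)" if t: "t \<ge> 0" for t
  proof -
    define s where "s n r = indicator {0..t} r *\<^sub>R (\<Sum>i\<in>I n. f i r)" for n r
    define h' where "h' r = indicator {0..t} r *\<^sub>R h r" for r
    have h'_lim: "h' r = lim (\<lambda>n. s n r)" for r
      by (cases "r \<in> {0..t}") (auto simp: h'_def h_def s_def)
    have prim: "has_prim (\<lambda>t. \<Sum>i\<in>I n. F i t) (\<lambda>t. \<Sum>i\<in>I n. f i t)" for n
      by (rule has_prim_sum) (use F sub in auto)
    have sint: "integrable lborel (s n)" for n
      using has_prim_integrable[OF prim order_refl, where t=t] by (simp add: set_integrable_def s_def[abs_def])
    then have [measurable]: "s n \<in> borel_measurable borel" for n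
      by (auto dest: borel_measurable_integrable)
    have [measurable]: "h' \<in> borel_measurable borel"
      unfolding h'_lim[abs_def] by measurable
    have slim: "AE r in lborel. (\<lambda>n. s n r) \<longlonglongrightarrow> h' r"
      using hs
    proof eventually_elim
      case (elim r)
      show ?case
      proof (cases "r \<in> {0..t}")
        case True
        then show ?thesis
          using elim has_sum_imp_tendsto_to_nat[of "\<lambda>i. f i r" X "h r"]
          by (simp add: s_def I_def h'_def)
      qed (simp add: s_def h'_def)
    qed
    have bound: "AE r in lborel. norm (s n r) \<le> indicator {0..t} r *\<^sub>R D r" for n
      using dom
    proof eventually_elim
      case (elim r)
      have "\<bar>\<Sum>i\<in>I n. f i r\<bar> \<le> (\<Sum>i\<in>I n. \<bar>f i r\<bar>)" by (rule sum_abs)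
      moreover have "r \<ge> 0 \<Longrightarrow> (\<Sum>i\<in>I n. \<bar>f i r\<bar>) \<le> D r"
        using elim fin[of n] sub[of n] by blast
      ultimately show ?case
        by (cases "r \<in> {0..t}") (auto simp: s_def intro: order_trans)
    qed
    have Dint: "integrable lborel (\<lambda>r. indicator {0..t} r *\<^sub>R D r)"
      using D[OF t] by (simp add: set_integrable_def)
    note dc = integral_dominated_convergence[OF _ _ Dint slim bound]
      integrable_dominated_convergence[OF _ _ Dint slim bound]
    have h'int: "integrable lborel h'" by (rule dc) auto
    have lim: "(\<lambda>n. integral\<^sup>L lborel (s n)) \<longlonglongrightarrow> integral\<^sup>L lborel h'" by (rule dc) auto
    have "(\<lambda>n. (\<Sum>i\<in>I n. F i t) - (\<Sum>i\<in>I n. F i 0)) \<longlonglongrightarrow> Y t - Y 0"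
      unfolding I_def by (intro tendsto_diff has_sum_imp_tendsto_to_nat sum t order_refl)
    moreover have "(\<Sum>i\<in>I n. F i t) - (\<Sum>i\<in>I n. F i 0) = integral\<^sup>L lborel (s n)" for n
      unfolding has_prim_eq[OF prim t, of n] by (simp add: set_lebesgue_integral_def s_def[abs_def])
    ultimately have Yt: "Y t - Y 0 = integral\<^sup>L lborel h'"
      using lim LIMSEQ_unique by auto
    show ?thesis
      using h'int Yt by (simp add: set_integrable_def set_lebesgue_integral_def h'_def[abs_def])
  qed
  then have "has_prim Y h" unfolding has_prim_def by blast
  then show ?thesis using that hs by blast
qed

section \<open>Square-summable Fourier coefficients\<close>

definition cdot :: "complex \<times> complex \<Rightarrow> complex \<times> complex \<Rightarrow> complex" where
  "cdot z w = fst z * cnj (fst w) + snd z * cnj (snd w)"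

definition QN :: "real \<Rightarrow> coef \<Rightarrow> coef" where
  "QN N c = (\<lambda>k. c k - PN N c k)"

text \<open>The norms of H, V and D(A) are 2 pi times this one with the weights 1, |k| and |k|^2.
  For sequences that are not square-summable \<open>infsum\<close> makes it 0, so its uses come with
  summability premises.\<close>

definition l2n :: "('i \<Rightarrow> real) \<Rightarrow> real" where
  "l2n a = sqrt (\<Sum>\<^sub>\<infinity>k. (a k)\<^sup>2)"

abbreviation kabs :: "int \<times> int \<Rightarrow> real" where
  "kabs k \<equiv> sqrt (ksq k)"

section \<open>Algebra of single modes\<close>

lemma ksq_nonneg [simp]: "ksq k \<ge> 0"
  by (simp add: ksq_def)

lemma ksq_0 [simp]: "ksq 0 = 0"
  by (simp add: ksq_def)

lemma ksq_uminus [simp]: "ksq (- k) = ksq k"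
  by (simp add: ksq_def)

lemma ksq_ge_1: "k \<noteq> 0 \<Longrightarrow> ksq k \<ge> 1"
proof -
  assume "k \<noteq> 0"
  then have "fst k ^ 2 + snd k ^ 2 \<noteq> 0"
    by (simp add: sum_power2_eq_zero_iff prod_eq_iff)
  then have "fst k ^ 2 + snd k ^ 2 \<ge> 1"
    by (smt (verit) zero_le_power2)
  then show ?thesis unfolding ksq_def by linarith
qed

lemma ksq_le_ksq_sq: "ksq k \<le> (ksq k)\<^sup>2"
proof (cases "k = 0")
  case False
  then show ?thesis using ksq_ge_1[of k] by (simp add: power2_eq_square)
qed simp

lemma cn2_eq_norm: "cn2 z = (norm z)\<^sup>2"
  by (simp add: cn2_def norm_prod_def)

lemma cn2_nonneg [simp]: "cn2 z \<ge> 0"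
  by (simp add: cn2_def)

lemma norm_cmul: "norm (cmul a z) = cmod a * norm z"
proof -
  have "(norm (cmul a z))\<^sup>2 = (cmod a * norm z)\<^sup>2"
    unfolding cn2_eq_norm[symmetric] power_mult_distrib
    by (simp add: cn2_def cmul_def norm_mult power_mult_distrib distrib_left)
  then show ?thesis by (simp add: power2_eq_iff_nonneg)
qed

lemma cauchy_schwarz_2:
  fixes a b c d :: real
  shows "a * b + c * d \<le> sqrt (a\<^sup>2 + c\<^sup>2) * sqrt (b\<^sup>2 + d\<^sup>2)"
  unfolding real_sqrt_mult[symmetric]
proof (rule real_le_rsqrt)
  have "0 \<le> (a * d - b * c)\<^sup>2" by simp
  then show "(a * b + c * d)\<^sup>2 \<le> (a\<^sup>2 + c\<^sup>2) * (b\<^sup>2 + d\<^sup>2)"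
    by (simp add: power2_eq_square algebra_simps)
qed

lemma cmod_cdot_le: "cmod (cdot z w) \<le> norm z * norm w"
proof -
  have "cmod (cdot z w) \<le> cmod (fst z) * cmod (fst w) + cmod (snd z) * cmod (snd w)"
    unfolding cdot_def by (rule norm_triangle_le) (simp add: norm_mult)
  also have "\<dots> \<le> norm z * norm w"
    unfolding norm_prod_def by (rule cauchy_schwarz_2)
  finally show ?thesis .
qed

lemma cmod_kdot_le: "cmod (kdot k z) \<le> kabs k * norm z"
proof -
  have "cmod (kdot k z) \<le> \<bar>real_of_int (fst k)\<bar> * cmod (fst z) + \<bar>real_of_int (snd k)\<bar> * cmod (snd z)"
    unfolding kdot_def by (rule norm_triangle_le) (simp add: norm_mult)
  also have "\<dots> \<le> sqrt (\<bar>real_of_int (fst k)\<bar>\<^sup>2 + \<bar>real_of_int (snd k)\<bar>\<^sup>2) * norm z"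
    unfolding norm_prod_def by (rule cauchy_schwarz_2)
  finally show ?thesis by (simp add: ksq_def)
qed

lemma cdot_self: "cdot z z = of_real (cn2 z)"
  by (simp add: cdot_def cn2_def complex_norm_square[symmetric] del: of_real_power)

lemma cnj_cdot: "cnj (cdot z w) = cdot w z"
  by (simp add: cdot_def mult.commute)

lemma cdot_simps [simp]:
  "cdot (x + y) w = cdot x w + cdot y w" "cdot (x - y) w = cdot x w - cdot y w"
  "cdot w (x + y) = cdot w x + cdot w y" "cdot w (x - y) = cdot w x - cdot w y"
  "cdot (- x) w = - cdot x w" "cdot 0 w = 0" "cdot w 0 = 0" "cdot (0,0) w = 0" "cdot w (0,0) = 0"
  "cdot (cmul a x) w = a * cdot x w"
  by (simp_all add: cdot_def cmul_def algebra_simps)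

lemma kdot_simps [simp]:
  "kdot k (x + y) = kdot k x + kdot k y" "kdot k (x - y) = kdot k x - kdot k y"
  "kdot k 0 = 0" "kdot k (0,0) = 0"
  by (simp_all add: kdot_def algebra_simps)

lemma kdot_diff_left: "kdot (k - p) z = kdot k z - kdot p z"
  by (simp add: kdot_def algebra_simps)

lemma kminus_eq: "kminus k p = k - p"
  by (simp add: kminus_def prod_eq_iff)

section \<open>Inequalities for square-summable sequences\<close>

lemma l2n_nonneg [simp]: "l2n a \<ge> 0"
  by (simp add: l2n_def infsum_nonneg)

lemma l2n_sq: "(l2n a)\<^sup>2 = (\<Sum>\<^sub>\<infinity>k. (a k)\<^sup>2)"
  by (simp add: l2n_def infsum_nonneg)

lemma L2_set_le_l2n:
  fixes a :: "'i \<Rightarrow> real"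
  assumes "(\<lambda>k. (a k)\<^sup>2) summable_on UNIV"
  shows "L2_set a F \<le> l2n a"
proof (cases "finite F")
  case True
  then show ?thesis
    unfolding L2_set_def l2n_def
    by (intro real_sqrt_le_mono finite_sum_le_infsum assms) auto
qed simp

lemma l2_cauchy_schwarz:
  fixes a b :: "'i \<Rightarrow> real"
  assumes a: "(\<lambda>k. (a k)\<^sup>2) summable_on UNIV" and b: "(\<lambda>k. (b k)\<^sup>2) summable_on UNIV"
  shows "(\<lambda>k. \<bar>a k * b k\<bar>) summable_on UNIV" "(\<Sum>\<^sub>\<infinity>k. \<bar>a k * b k\<bar>) \<le> l2n a * l2n b"
proof -
  have le: "(\<Sum>k\<in>F. \<bar>a k * b k\<bar>) \<le> l2n a * l2n b" for F
  proof -
    have "(\<Sum>k\<in>F. \<bar>a k * b k\<bar>) = (\<Sum>k\<in>F. \<bar>a k\<bar> * \<bar>b k\<bar>)" by (simp add: abs_mult)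
    also have "\<dots> \<le> L2_set a F * L2_set b F" by (rule L2_set_mult_ineq)
    also have "\<dots> \<le> l2n a * l2n b"
      by (intro mult_mono L2_set_le_l2n a b L2_set_nonneg) auto
    finally show ?thesis .
  qed
  show 1: "(\<lambda>k. \<bar>a k * b k\<bar>) summable_on UNIV"
    by (rule nonneg_bdd_above_summable_on) (auto intro!: bdd_aboveI2[of _ _ "l2n a * l2n b"] le)
  show "(\<Sum>\<^sub>\<infinity>k. \<bar>a k * b k\<bar>) \<le> l2n a * l2n b"
    by (rule infsum_le_finite_sums[OF 1]) (rule le)
qed

lemma l2n_mono:
  assumes "(\<lambda>k. (b k)\<^sup>2) summable_on UNIV" "\<And>k. \<bar>a k\<bar> \<le> \<bar>b k\<bar>"
  shows "l2n a \<le> l2n b" "(\<lambda>k. (a k)\<^sup>2) summable_on UNIV"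
proof -
  have le: "(a k)\<^sup>2 \<le> (b k)\<^sup>2" for k
    using assms(2)[of k] by (simp add: abs_le_square_iff)
  show *: "(\<lambda>k. (a k)\<^sup>2) summable_on UNIV"
    by (rule summable_on_comparison_test[OF assms(1)]) (use le in auto)
  show "l2n a \<le> l2n b"
    unfolding l2n_def by (intro real_sqrt_le_mono infsum_mono * assms(1) le)
qed

lemma l2n_triangle:
  fixes a b :: "'i \<Rightarrow> real"
  assumes a: "(\<lambda>k. (a k)\<^sup>2) summable_on UNIV" and b: "(\<lambda>k. (b k)\<^sup>2) summable_on UNIV"
  shows "(\<lambda>k. (a k + b k)\<^sup>2) summable_on UNIV" "l2n (\<lambda>k. a k + b k) \<le> l2n a + l2n b"
proof -
  have le: "(\<Sum>k\<in>F. (a k + b k)\<^sup>2) \<le> (l2n a + l2n b)\<^sup>2" for F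
  proof -
    have "L2_set (\<lambda>k. a k + b k) F \<le> L2_set a F + L2_set b F" by (rule L2_set_triangle_ineq)
    also have "\<dots> \<le> l2n a + l2n b" by (intro add_mono L2_set_le_l2n a b)
    finally have "(L2_set (\<lambda>k. a k + b k) F)\<^sup>2 \<le> (l2n a + l2n b)\<^sup>2"
      by (intro power_mono) (auto simp: L2_set_nonneg)
    then show ?thesis by (simp add: L2_set_def sum_nonneg)
  qed
  show 1: "(\<lambda>k. (a k + b k)\<^sup>2) summable_on UNIV"
    by (rule nonneg_bdd_above_summable_on) (auto intro!: bdd_aboveI2[of _ _ "(l2n a + l2n b)\<^sup>2"] le)
  have "(l2n (\<lambda>k. a k + b k))\<^sup>2 \<le> (l2n a + l2n b)\<^sup>2"
    unfolding l2n_sq[of "\<lambda>k. a k + b k"] by (rule infsum_le_finite_sums[OF 1]) (rule le)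
  then show "l2n (\<lambda>k. a k + b k) \<le> l2n a + l2n b"
    by (rule power2_le_imp_le) (simp add: add_nonneg_nonneg)
qed

text \<open>Young's inequality for an l^1 sequence convolved with an l^2 sequence and paired with
  l^2. For fixed p, Cauchy-Schwarz in k is uniform in p by translation invariance, and then \<alpha>
  is summed. A finite index set is first enlarged to a rectangle, which only adds nonnegative
  terms.\<close>

lemma young_l1_l2_l2:
  fixes \<alpha> a b :: "'i::ab_group_add \<Rightarrow> real"
  assumes \<alpha>: "\<alpha> summable_on UNIV" "\<And>k. \<alpha> k \<ge> 0"
    and a: "(\<lambda>k. (a k)\<^sup>2) summable_on UNIV" "\<And>k. a k \<ge> 0"
    and b: "(\<lambda>k. (b k)\<^sup>2) summable_on UNIV" "\<And>k. b k \<ge> 0"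
  shows "(\<lambda>(p,k). \<alpha> p * a (k - p) * b k) summable_on UNIV"
    and "(\<Sum>\<^sub>\<infinity>(p,k). \<alpha> p * a (k - p) * b k) \<le> infsum \<alpha> UNIV * (l2n a * l2n b)"
proof -
  let ?B = "infsum \<alpha> UNIV * (l2n a * l2n b)"
  have le: "(\<Sum>(p,k)\<in>F. \<alpha> p * a (k - p) * b k) \<le> ?B" if "finite F" for F
  proof -
    have fin: "finite (fst ` F)" "finite (snd ` F)" using that by auto
    have sub: "F \<subseteq> fst ` F \<times> snd ` F" by force
    have inner: "(\<Sum>k\<in>K. a (k - p) * b k) \<le> l2n a * l2n b" for p K
    proof -
      have "(\<Sum>k\<in>K. a (k - p) * b k) = (\<Sum>k\<in>K. \<bar>a (k - p)\<bar> * \<bar>b k\<bar>)"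
        using a(2) b(2) by simp
      also have "\<dots> \<le> L2_set (\<lambda>k. a (k - p)) K * L2_set b K" by (rule L2_set_mult_ineq)
      also have "L2_set (\<lambda>k. a (k - p)) K = L2_set a ((\<lambda>k. k - p) ` K)"
        unfolding L2_set_def by (subst sum.reindex) (auto simp: inj_on_def)
      also have "L2_set a ((\<lambda>k. k - p) ` K) * L2_set b K \<le> l2n a * l2n b"
        by (intro mult_mono L2_set_le_l2n a b L2_set_nonneg) auto
      finally show ?thesis .
    qed
    have "(\<Sum>(p,k)\<in>F. \<alpha> p * a (k - p) * b k) \<le> (\<Sum>(p,k)\<in>fst ` F \<times> snd ` F. \<alpha> p * a (k - p) * b k)"
      by (rule sum_mono2) (use fin sub \<alpha> a b in auto)
    also have "\<dots> = (\<Sum>p\<in>fst ` F. \<alpha> p * (\<Sum>k\<in>snd ` F. a (k - p) * b k))"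
      by (simp add: sum.cartesian_product[symmetric] sum_distrib_left mult.assoc)
    also have "\<dots> \<le> (\<Sum>p\<in>fst ` F. \<alpha> p * (l2n a * l2n b))"
      by (intro sum_mono mult_left_mono inner \<alpha>)
    also have "\<dots> = (\<Sum>p\<in>fst ` F. \<alpha> p) * (l2n a * l2n b)" by (simp add: sum_distrib_right)
    also have "\<dots> \<le> ?B"
      by (intro mult_right_mono finite_sum_le_infsum \<alpha> fin) (auto simp: \<alpha>)
    finally show ?thesis .
  qed
  show 1: "(\<lambda>(p,k). \<alpha> p * a (k - p) * b k) summable_on UNIV"
    by (rule nonneg_bdd_above_summable_on)
       (use \<alpha> a b in \<open>auto intro!: bdd_aboveI2[of _ _ ?B] le\<close>)
  show "(\<Sum>\<^sub>\<infinity>(p,k). \<alpha> p * a (k - p) * b k) \<le> ?B"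
    by (rule infsum_le_finite_sums[OF 1]) (rule le)
qed

lemma summable_inverse_1_plus_sq_int: "(\<lambda>m::int. 1 / (1 + (real_of_int m)\<^sup>2)) summable_on UNIV"
proof -
  have nat: "(\<lambda>n::nat. 1 / (1 + (real n)\<^sup>2)) summable_on UNIV"
  proof (rule summable_nonneg_imp_summable_on)
    have "summable (\<lambda>n. inverse (real (Suc n) ^ 2))"
      using inverse_power_summable[of 2, where 'a=real] by (subst summable_Suc_iff) auto
    then have "summable (\<lambda>n. 2 * inverse (real (Suc n) ^ 2))" by (rule summable_mult)
    then show "summable (\<lambda>n. 1 / (1 + (real n)\<^sup>2))"
    proof (rule summable_comparison_test[rotated], intro exI[of _ 0] allI impI)
      fix n :: nat
      have "(1 + real n)\<^sup>2 \<le> 2 * (1 + (real n)\<^sup>2)"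
        using sum_squares_bound[of 1 "real n"] by (simp add: power2_sum)
      then show "norm (1 / (1 + (real n)\<^sup>2)) \<le> 2 * inverse ((real (Suc n))\<^sup>2)"
        by (simp add: field_simps add_pos_nonneg)
    qed
  qed simp
  have "(\<lambda>m::int. 1 / (1 + (real_of_int m)\<^sup>2)) summable_on (range int \<union> range (\<lambda>n. - int n))"
  proof (rule summable_on_union)
    show "(\<lambda>m::int. 1 / (1 + (real_of_int m)\<^sup>2)) summable_on range int"
      by (subst summable_on_reindex) (use nat in \<open>auto simp: o_def inj_on_def\<close>)
    show "(\<lambda>m::int. 1 / (1 + (real_of_int m)\<^sup>2)) summable_on range (\<lambda>n. - int n)"
      by (subst summable_on_reindex) (use nat in \<open>auto simp: o_def inj_on_def\<close>)
  qed
  moreover have "m \<in> range int \<union> range (\<lambda>n. - int n)" for m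
    by (cases m rule: int_cases2) auto
  then have "range int \<union> range (\<lambda>n. - int n) = UNIV" by blast
  ultimately show ?thesis by simp
qed

text \<open>Comparison with a product of two one-dimensional series avoids counting lattice points
  in annuli.\<close>

lemma summable_inverse_ksq_sq: "(\<lambda>k. (1 / ksq k)\<^sup>2) summable_on UNIV"
proof -
  let ?f = "\<lambda>m::int. 1 / (1 + (real_of_int m)\<^sup>2)"
  have "(\<lambda>(m,n). f m * f n) summable_on UNIV \<times> UNIV"
    if "f summable_on UNIV" "\<And>m. f m \<ge> 0" for f :: "int \<Rightarrow> real"
    by (rule summable_on_SigmaI[where g="\<lambda>m. f m * infsum f UNIV"])
       (auto intro!: has_sum_cmult_right[OF has_sum_infsum] summable_on_cmult_left that mult_nonneg_nonneg)
  from this[OF summable_inverse_1_plus_sq_int]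
  have "(\<lambda>(m,n). ?f m * ?f n) summable_on UNIV \<times> UNIV" by simp
  \<comment> \<open>The factor 3: with x = m^2, y = n^2 and x + y \<ge> 1, each of 1, x + y and x y
    is at most (x + y)^2, so (1 + x) (1 + y) \<le> 3 (x + y)^2. At k = 0 the term to be bounded is 0
    by the convention 1 / 0 = 0.\<close>
  then have "(\<lambda>k. 3 * (case k of (m,n) \<Rightarrow> ?f m * ?f n)) summable_on UNIV"
    by (intro summable_on_cmult_right) simp
  then show ?thesis
  proof (rule summable_on_comparison_test)
    fix k :: "int \<times> int"
    show "(1 / ksq k)\<^sup>2 \<le> 3 * (case k of (m,n) \<Rightarrow> ?f m * ?f n)"
    proof (cases "k = 0")
      case False
      obtain m n where k: "k = (m,n)" by fastforce
      have s: "ksq k \<ge> 1" using False by (rule ksq_ge_1)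
      define x where "x = (real_of_int m)\<^sup>2"
      define y where "y = (real_of_int n)\<^sup>2"
      have xy: "x \<ge> 0" "y \<ge> 0" by (auto simp: x_def y_def)
      have ks: "ksq k = x + y" by (simp add: k ksq_def x_def y_def)
      have 1: "x + y \<le> (x + y)\<^sup>2" "1 \<le> (x + y)\<^sup>2" using s ks ksq_le_ksq_sq[of k] by (auto simp: one_le_power)
      have 2: "x * y \<le> (x + y)\<^sup>2"
        using mult_nonneg_nonneg[OF xy] zero_le_power2[of x] zero_le_power2[of y] unfolding power2_sum by linarith
      have "(1 + x) * (1 + y) = 1 + (x + y) + x * y"
        by (simp add: algebra_simps)
      also have "\<dots> \<le> 3 * (x + y)\<^sup>2" using 1 2 by linarith
      finally have le: "(1 + x) * (1 + y) \<le> 3 * (x + y)\<^sup>2" .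
      have pos: "0 < (1 + x) * (1 + y)" "0 < (x + y)\<^sup>2"
        using xy 1(2) by (auto intro!: mult_pos_pos add_pos_nonneg)
      have "1 / (x + y)\<^sup>2 \<le> 3 / ((1 + x) * (1 + y))"
        using le pos by (simp only: divide_le_eq le_divide_eq pos_le_divide_eq pos_divide_le_eq) (simp add: field_simps)
      then show ?thesis
        unfolding ks by (simp add: k x_def[symmetric] y_def[symmetric] power_divide)
    qed (simp add: case_prod_unfold)
  qed auto
qed

section \<open>The spaces H, V, D(A) as weighted sequence spaces\<close>

lemma Hnorm_l2n: "Hnorm c = 2 * pi * l2n (\<lambda>k. norm (c k))"
  by (simp add: Hnorm_def l2n_def cn2_eq_norm real_sqrt_mult)

lemma Vnorm_l2n: "Vnorm c = 2 * pi * l2n (\<lambda>k. kabs k * norm (c k))"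
  by (simp add: Vnorm_def l2n_def cn2_eq_norm real_sqrt_mult power_mult_distrib)

lemma Anorm_l2n: "Anorm c = 2 * pi * l2n (\<lambda>k. ksq k * norm (c k))"
  by (simp add: Anorm_def l2n_def cn2_eq_norm real_sqrt_mult power_mult_distrib)

lemma Hnorm_nonneg [simp]: "Hnorm c \<ge> 0" and Vnorm_nonneg [simp]: "Vnorm c \<ge> 0"
  and Anorm_nonneg [simp]: "Anorm c \<ge> 0"
  by (simp_all add: Hnorm_l2n Vnorm_l2n Anorm_l2n)

lemma in_H_l2: "in_H c \<Longrightarrow> (\<lambda>k. (norm (c k))\<^sup>2) summable_on UNIV"
  by (simp add: in_H_def cn2_eq_norm)

lemma in_V_l2: "in_V c \<Longrightarrow> (\<lambda>k. (kabs k * norm (c k))\<^sup>2) summable_on UNIV"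
  by (simp add: in_V_def cn2_eq_norm power_mult_distrib)

lemma in_DA_l2: "in_DA c \<Longrightarrow> (\<lambda>k. (ksq k * norm (c k))\<^sup>2) summable_on UNIV"
  by (simp add: in_DA_def cn2_eq_norm power_mult_distrib)

lemma in_V_imp_in_H: "in_V c \<Longrightarrow> in_H c"
  by (simp add: in_V_def)

lemma in_DA_imp_in_H: "in_DA c \<Longrightarrow> in_H c"
  by (simp add: in_DA_def)

lemma in_DA_imp_in_V: "in_DA c \<Longrightarrow> in_V c"
  unfolding in_DA_def in_V_def
  by (auto elim!: summable_on_comparison_test intro!: mult_right_mono ksq_le_ksq_sq)

lemma in_H_0: "in_H c \<Longrightarrow> c 0 = 0"
  by (simp add: in_H_def zero_prod_def)

lemma in_H_uminus: "in_H c \<Longrightarrow> c (- k) = (cnj (fst (c k)), cnj (snd (c k)))"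
  by (simp add: in_H_def prod_eq_iff uminus_prod_def)

lemma in_H_div: "in_H c \<Longrightarrow> kdot k (c k) = 0"
  unfolding in_H_def by blast

text \<open>From |c - d|^2 \<le> 2 (|c|^2 + |d|^2). The weights 1, \<open>ksq\<close> and its square
  give closure of all three spaces under differences.\<close>

lemma summable_weighted_cn2_diff:
  assumes "(\<lambda>k. m k * cn2 (c k)) summable_on A" "(\<lambda>k. m k * cn2 (d k)) summable_on A"
    and m: "\<And>k. m k \<ge> (0::real)"
  shows "(\<lambda>k. m k * cn2 (c k - d k)) summable_on A"
proof -
  have "(\<lambda>k. 2 * (m k * cn2 (c k) + m k * cn2 (d k))) summable_on A"
    by (intro summable_on_cmult_right summable_on_add assms)
  then show ?thesis
  proof (rule summable_on_comparison_test)
    fix k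
    have "(norm (c k - d k))\<^sup>2 \<le> (norm (c k) + norm (d k))\<^sup>2"
      by (intro power_mono norm_triangle_ineq4) auto
    also have "\<dots> \<le> 2 * ((norm (c k))\<^sup>2 + (norm (d k))\<^sup>2)"
      using sum_squares_bound[of "norm (c k)" "norm (d k)"] by (simp add: power2_sum)
    finally show "m k * cn2 (c k - d k) \<le> 2 * (m k * cn2 (c k) + m k * cn2 (d k))"
      using mult_left_mono[OF _ m[of k]] unfolding cn2_eq_norm by (fastforce simp: algebra_simps)
  qed (use m in auto)
qed

lemma in_H_diff: "in_H c \<Longrightarrow> in_H d \<Longrightarrow> in_H (\<lambda>k. c k - d k)"
  unfolding in_H_def using summable_weighted_cn2_diff[of "\<lambda>_. 1" c UNIV d]
  by (auto simp: prod_eq_iff)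

lemma in_V_diff: "in_V c \<Longrightarrow> in_V d \<Longrightarrow> in_V (\<lambda>k. c k - d k)"
  unfolding in_V_def by (auto intro!: in_H_diff summable_weighted_cn2_diff)

lemma in_DA_diff: "in_DA c \<Longrightarrow> in_DA d \<Longrightarrow> in_DA (\<lambda>k. c k - d k)"
  unfolding in_DA_def by (auto intro!: in_H_diff summable_weighted_cn2_diff)

text \<open>Common form of both projections and of truncations to finite sets. Mean and divergence
  are treated mode by mode and survive any cutoff; the reality condition couples k with -k, which is
  why the lemmas below assume symmetric sets.\<close>

definition mask :: "(int \<times> int) set \<Rightarrow> coef \<Rightarrow> coef" where
  "mask S c = (\<lambda>k. if k \<in> S then c k else 0)"

text \<open>The zero mode counts as high, which does no harm because fields in H vanish there. For 0
  < N < 1 the set is empty.\<close>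

definition low :: "real \<Rightarrow> (int \<times> int) set" where
  "low N = {k. ksq k \<le> N\<^sup>2 \<and> k \<noteq> 0}"

lemma PN_mask: "PN N c = mask (low N) c"
  by (auto simp: PN_def mask_def low_def zero_prod_def)

lemma QN_mask: "QN N c = mask (- low N) c"
  by (auto simp: QN_def PN_mask mask_def)

lemma cn2_mask: "cn2 (mask S c k) = (if k \<in> S then cn2 (c k) else 0)"
  by (simp add: mask_def cn2_def)

lemma summable_weighted_cn2_mask:
  assumes "(\<lambda>k. m k * cn2 (c k)) summable_on UNIV" "\<And>k. m k \<ge> (0::real)"
  shows "(\<lambda>k. m k * cn2 (mask S c k)) summable_on UNIV"
  by (rule summable_on_comparison_test[OF assms(1)]) (use assms(2) in \<open>auto simp: cn2_mask\<close>)

lemma in_H_mask: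
  assumes "in_H c" "\<And>k. - k \<in> S \<longleftrightarrow> k \<in> S"
  shows "in_H (mask S c)"
proof -
  have s: "(- a, - b) \<in> S \<longleftrightarrow> (a, b) \<in> S" for a b using assms(2)[of "(a,b)"] by simp
  show ?thesis
    using assms(1) summable_weighted_cn2_mask[of "\<lambda>_. 1" c S]
    unfolding in_H_def by (auto simp: mask_def s zero_prod_def)
qed

lemma in_V_mask: "in_V c \<Longrightarrow> (\<And>k. - k \<in> S \<longleftrightarrow> k \<in> S) \<Longrightarrow> in_V (mask S c)"
  unfolding in_V_def by (auto intro!: in_H_mask summable_weighted_cn2_mask)

lemma in_DA_mask: "in_DA c \<Longrightarrow> (\<And>k. - k \<in> S \<longleftrightarrow> k \<in> S) \<Longrightarrow> in_DA (mask S c)"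
  unfolding in_DA_def by (auto intro!: in_H_mask summable_weighted_cn2_mask)

lemma low_uminus: "- k \<in> low N \<longleftrightarrow> k \<in> low N"
  by (auto simp: low_def)

lemma in_H_QN: "in_H c \<Longrightarrow> in_H (QN N c)"
  and in_V_PN: "in_V c \<Longrightarrow> in_V (PN N c)" and in_V_QN: "in_V c \<Longrightarrow> in_V (QN N c)"
  and in_DA_PN: "in_DA c \<Longrightarrow> in_DA (PN N c)" and in_DA_QN: "in_DA c \<Longrightarrow> in_DA (QN N c)"
  unfolding PN_mask QN_mask
  by (simp_all add: in_H_mask in_V_mask in_DA_mask low_uminus del: split_paired_All)

lemma finite_ksq_le: "finite {k. ksq k \<le> R}"
proof (rule finite_subset)
  show "{k. ksq k \<le> R} \<subseteq> {-\<lceil>R\<rceil>..\<lceil>R\<rceil>} \<times> {-\<lceil>R\<rceil>..\<lceil>R\<rceil>}"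
  proof
    fix k assume "k \<in> {k. ksq k \<le> R}"
    then have k: "real_of_int (fst k ^ 2 + snd k ^ 2) \<le> R" by (simp add: ksq_def)
    have le: "\<bar>x\<bar> \<le> x ^ 2" for x :: int
      by (cases "x = 0") (auto simp: power2_eq_square abs_mult[symmetric] intro: self_le_power[of "\<bar>x\<bar>" 2, simplified power2_eq_square, simplified])
    have "fst k ^ 2 + snd k ^ 2 \<le> \<lceil>R\<rceil>" using k by linarith
    then have "\<bar>fst k\<bar> \<le> \<lceil>R\<rceil>" "\<bar>snd k\<bar> \<le> \<lceil>R\<rceil>"
      using le[of "fst k"] le[of "snd k"] zero_le_power2[of "fst k"] zero_le_power2[of "snd k"] by linarith+
    then show "k \<in> {-\<lceil>R\<rceil>..\<lceil>R\<rceil>} \<times> {-\<lceil>R\<rceil>..\<lceil>R\<rceil>}"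
      by (cases k) (auto simp: abs_le_iff)
  qed
qed simp

lemma finite_low: "finite (low N)"
  by (rule finite_subset[OF _ finite_ksq_le[of "N\<^sup>2"]]) (auto simp: low_def)

lemma norm_mask_le: "norm (mask S c k) \<le> norm (c k)"
  by (simp add: mask_def)

lemma Hnorm_mask_le: "in_H c \<Longrightarrow> Hnorm (mask S c) \<le> Hnorm c"
  unfolding Hnorm_l2n using l2n_mono(1)[OF in_H_l2] by (simp add: norm_mask_le)

lemma Vnorm_mask_le: "in_V c \<Longrightarrow> Vnorm (mask S c) \<le> Vnorm c"
  unfolding Vnorm_l2n using l2n_mono(1)[OF in_V_l2] by (simp add: norm_mask_le mult_left_mono abs_mult)

lemma Hnorm_le_Vnorm:
  assumes "in_V c"
  shows "Hnorm c \<le> Vnorm c"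
proof -
  have "l2n (\<lambda>k. norm (c k)) \<le> l2n (\<lambda>k. kabs k * norm (c k))"
  proof (rule l2n_mono(1)[OF in_V_l2[OF assms]])
    fix k
    show "\<bar>norm (c k)\<bar> \<le> \<bar>kabs k * norm (c k)\<bar>"
    proof (cases "k = 0")
      case True
      then show ?thesis using in_H_0[OF in_V_imp_in_H[OF assms]] by simp
    next
      case False
      then have "1 \<le> kabs k" using ksq_ge_1[of k] by simp
      then show ?thesis using mult_right_mono[of 1 "kabs k" "norm (c k)"] by (simp add: abs_mult)
    qed
  qed
  then show ?thesis by (simp add: Hnorm_l2n Vnorm_l2n)
qed

text \<open>High modes have |k| > N and all nonzero modes have |k| \<ge> 1, so the better of the two
  constants may be taken. The maximum keeps the later estimates effective for N < 1.\<close>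

lemma Hnorm_QN_le:
  assumes c: "in_V c" and N: "N > 0"
  shows "max 1 N * Hnorm (QN N c) \<le> Vnorm (QN N c)"
proof -
  have V: "in_V (QN N c)" using c by (rule in_V_QN)
  have "N * Hnorm (QN N c) \<le> Vnorm (QN N c)"
  proof -
    have "l2n (\<lambda>k. N * norm (QN N c k)) \<le> l2n (\<lambda>k. kabs k * norm (QN N c k))"
    proof (rule l2n_mono(1)[OF in_V_l2[OF V]])
      fix k
      show "\<bar>N * norm (QN N c k)\<bar> \<le> \<bar>kabs k * norm (QN N c k)\<bar>"
      proof (cases "QN N c k = 0")
        case False
        then have "k \<noteq> 0" "\<not> ksq k \<le> N\<^sup>2"
          using in_H_0[OF in_V_imp_in_H[OF V]] by (auto simp: QN_mask mask_def low_def split: if_splits)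
        then have "N \<le> kabs k" using N by (simp add: real_le_rsqrt)
        then show ?thesis using N by (simp add: abs_mult mult_right_mono)
      qed simp
    qed
    moreover have "l2n (\<lambda>k. N * norm (QN N c k)) = N * l2n (\<lambda>k. norm (QN N c k))"
      using N by (simp add: l2n_def power_mult_distrib infsum_cmult_right' real_sqrt_mult)
    ultimately show ?thesis by (simp add: Hnorm_l2n Vnorm_l2n)
  qed
  then show ?thesis using Hnorm_le_Vnorm[OF V] by (simp add: max_def)
qed

lemma Vnorm_sq: "(Vnorm c)\<^sup>2 = 4 * pi\<^sup>2 * (\<Sum>\<^sub>\<infinity>k. ksq k * cn2 (c k))"
  by (simp add: Vnorm_def infsum_nonneg)

lemma Hnorm_sq: "(Hnorm c)\<^sup>2 = 4 * pi\<^sup>2 * (\<Sum>\<^sub>\<infinity>k. cn2 (c k))"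
  by (simp add: Hnorm_def infsum_nonneg)

lemma infsum_PN_QN:
  assumes "(\<lambda>k. m k * cn2 (c k)) summable_on UNIV" "\<And>k. m k \<ge> (0::real)"
  shows "(\<Sum>\<^sub>\<infinity>k. m k * cn2 (c k)) = (\<Sum>\<^sub>\<infinity>k. m k * cn2 (PN N c k)) + (\<Sum>\<^sub>\<infinity>k. m k * cn2 (QN N c k))"
proof -
  have "(\<Sum>\<^sub>\<infinity>k. m k * cn2 (c k)) = (\<Sum>\<^sub>\<infinity>k. m k * cn2 (PN N c k) + m k * cn2 (QN N c k))"
    by (intro infsum_cong) (simp add: PN_mask QN_mask cn2_mask)
  also have "\<dots> = (\<Sum>\<^sub>\<infinity>k. m k * cn2 (PN N c k)) + (\<Sum>\<^sub>\<infinity>k. m k * cn2 (QN N c k))"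
    unfolding PN_mask QN_mask by (intro infsum_add summable_weighted_cn2_mask assms)
  finally show ?thesis .
qed

lemma Vnorm_PN_QN: "in_V c \<Longrightarrow> (Vnorm c)\<^sup>2 = (Vnorm (PN N c))\<^sup>2 + (Vnorm (QN N c))\<^sup>2"
  unfolding Vnorm_sq in_V_def by (subst infsum_PN_QN[of _ _ N]) (auto simp: algebra_simps)

lemma Hnorm_PN_QN: "in_H c \<Longrightarrow> (Hnorm c)\<^sup>2 = (Hnorm (PN N c))\<^sup>2 + (Hnorm (QN N c))\<^sup>2"
  unfolding Hnorm_sq in_H_def using infsum_PN_QN[of "\<lambda>_. 1" c N] by (auto simp: algebra_simps)

text \<open>Turns continuity of a solution in V into continuity of its V-norm.\<close>

lemma Vnorm_triangle:
  assumes "in_V c" "in_V d"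
  shows "\<bar>Vnorm c - Vnorm d\<bar> \<le> Vnorm (\<lambda>k. c k - d k)"
proof -
  have le: "Vnorm c \<le> Vnorm (\<lambda>k. c k - d k) + Vnorm d" if "in_V c" "in_V d" for c d
  proof -
    have V: "in_V (\<lambda>k. c k - d k)" using that by (rule in_V_diff)
    have "l2n (\<lambda>k. kabs k * norm (c k)) \<le> l2n (\<lambda>k. kabs k * norm (c k - d k) + kabs k * norm (d k))"
    proof (rule l2n_mono(1)[OF l2n_triangle(1)[OF in_V_l2[OF V] in_V_l2[OF that(2)]]])
      fix k
      have "kabs k * norm (c k) \<le> kabs k * (norm (c k - d k) + norm (d k))"
        by (intro mult_left_mono) (use norm_triangle_sub[of "c k" "d k"] in auto)
      then show "\<bar>kabs k * norm (c k)\<bar> \<le> \<bar>kabs k * norm (c k - d k) + kabs k * norm (d k)\<bar>"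
        by (simp add: distrib_left)
    qed
    also have "\<dots> \<le> l2n (\<lambda>k. kabs k * norm (c k - d k)) + l2n (\<lambda>k. kabs k * norm (d k))"
      by (rule l2n_triangle(2)[OF in_V_l2[OF V] in_V_l2[OF that(2)]])
    finally show ?thesis by (simp add: Vnorm_l2n distrib_left[symmetric])
  qed
  have "Vnorm (\<lambda>k. d k - c k) = Vnorm (\<lambda>k. c k - d k)"
    by (simp add: Vnorm_l2n norm_minus_commute)
  then show ?thesis using le[OF assms] le[OF assms(2,1)] by simp
qed

text \<open>Constant of the embedding of D(A) into the absolutely convergent Fourier series, from
  Cauchy-Schwarz with the weights 1/|k|^2 and |k|^2. The entry at k = 0 is 0 since 1 / 0 = 0, and
  the division by 2 pi undoes the normalization of \<open>Anorm\<close>.\<close>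

definition cA :: real where
  "cA = l2n (\<lambda>k::int\<times>int. 1 / ksq k) / (2 * pi)"

lemma in_DA_l1:
  assumes "in_DA c"
  shows "(\<lambda>k. norm (c k)) summable_on UNIV" "(\<Sum>\<^sub>\<infinity>k. norm (c k)) \<le> cA * Anorm c"
proof -
  have eq: "\<bar>1 / ksq k * (ksq k * norm (c k))\<bar> = norm (c k)" for k
    using ksq_ge_1[of k] in_H_0[OF in_DA_imp_in_H[OF assms]] by (cases "k = 0") auto
  show "(\<lambda>k. norm (c k)) summable_on UNIV" "(\<Sum>\<^sub>\<infinity>k. norm (c k)) \<le> cA * Anorm c"
    using l2_cauchy_schwarz[OF summable_inverse_ksq_sq in_DA_l2[OF assms], unfolded eq]
    by (simp_all add: cA_def Anorm_l2n)
qed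

section \<open>The trilinear form and Ladyzhenskaya's inequality\<close>

text \<open>\<open>tri u v w\<close> is the trilinear form (B(u,v), w) up to the factor 4 pi^2; the Leray projection drops
  out because w is divergence-free.\<close>

definition tri_term :: "coef \<Rightarrow> coef \<Rightarrow> coef \<Rightarrow> (int \<times> int) \<times> (int \<times> int) \<Rightarrow> complex" where
  "tri_term u v w = (\<lambda>(p,k). \<i> * kdot (k - p) (u p) * cdot (v (k - p)) (w k))"

definition tri :: "coef \<Rightarrow> coef \<Rightarrow> coef \<Rightarrow> complex" where
  "tri u v w = infsum (tri_term u v w) UNIV"

lemma norm_tri_term_le:
  "cmod (tri_term u v w (p,k)) \<le> norm (u p) * (kabs (k - p) * norm (v (k - p))) * norm (w k)"
proof -
  have "cmod (tri_term u v w (p,k)) = cmod (kdot (k - p) (u p)) * cmod (cdot (v (k - p)) (w k))"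
    by (simp add: tri_term_def norm_mult)
  also have "\<dots> \<le> (kabs (k - p) * norm (u p)) * (norm (v (k - p)) * norm (w k))"
    by (intro mult_mono cmod_kdot_le cmod_cdot_le) auto
  finally show ?thesis by (simp add: mult_ac)
qed

lemma norm_tri_term_le':
  "cmod (tri_term u v w x) \<le> (case x of (p,k) \<Rightarrow> norm (u p) * (kabs (k - p) * norm (v (k - p))) * norm (w k))"
  by (cases x) (simp only: split norm_tri_term_le)

text \<open>\<open>u\<close> enters through the l^1 norm of its coefficients, the gradient of
  \<open>v\<close> and the field \<open>w\<close> through l^2. This is where the classes D(A), V and
  H for the three slots come from.\<close>

lemma tri_dominated:
  assumes "in_DA u" "in_V v" "in_H w"
  shows "(\<lambda>(p,k). norm (u p) * (kabs (k - p) * norm (v (k - p))) * norm (w k)) summable_on UNIV"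
    and "(\<Sum>\<^sub>\<infinity>(p,k). norm (u p) * (kabs (k - p) * norm (v (k - p))) * norm (w k))
      \<le> (\<Sum>\<^sub>\<infinity>p. norm (u p)) * (l2n (\<lambda>k. kabs k * norm (v k)) * l2n (\<lambda>k. norm (w k)))"
  using young_l1_l2_l2[OF in_DA_l1(1)[OF assms(1)] _ in_V_l2[OF assms(2)] _ in_H_l2[OF assms(3)]]
  by auto

lemma tri_abs_summable:
  assumes "in_DA u" "in_V v" "in_H w"
  shows "(\<lambda>x. norm (tri_term u v w x)) summable_on UNIV"
  by (rule summable_on_comparison_test[OF tri_dominated(1)[OF assms]]) (simp_all add: norm_tri_term_le' del: split_paired_All)

lemma tri_has_sum:
  assumes "in_DA u" "in_V v" "in_H w"
  shows "(tri_term u v w has_sum tri u v w) UNIV"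
  unfolding tri_def by (rule has_sum_infsum[OF abs_summable_summable[OF tri_abs_summable[OF assms]]])

text \<open>Fourier counterpart of bounding b(u,v,w) by the sup norm of u times the L^2 norms of
  grad v and w, with the l^1 norm of the coefficients in place of the sup norm.\<close>

lemma norm_tri_le_l1:
  assumes "in_DA u" "in_V v" "in_H w"
  shows "cmod (tri u v w) * (4 * pi\<^sup>2) \<le> (\<Sum>\<^sub>\<infinity>p. norm (u p)) * (Vnorm v * Hnorm w)"
proof -
  have "cmod (tri u v w) \<le> (\<Sum>\<^sub>\<infinity>x. norm (tri_term u v w x))"
    unfolding tri_def by (rule norm_infsum_bound[OF tri_abs_summable[OF assms]])
  also have "\<dots> \<le> (\<Sum>\<^sub>\<infinity>(p,k). norm (u p) * (kabs (k - p) * norm (v (k - p))) * norm (w k))"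
    by (intro infsum_mono tri_abs_summable tri_dominated(1) assms norm_tri_term_le')
  also note tri_dominated(2)[OF assms]
  finally show ?thesis
    using pi_gt_zero by (simp add: Vnorm_l2n Hnorm_l2n power2_eq_square mult_ac)
qed

text \<open>Now the l^1 norm falls on grad v and u is measured in H only: replacing p by k - p
  exchanges the two factors of the convolution. It is applied to v with finitely many modes.\<close>

lemma norm_tri_le_l1_grad:
  assumes "in_DA u" "in_V v" "in_H w" "(\<lambda>k. kabs k * norm (v k)) summable_on UNIV"
  shows "cmod (tri u v w) * (4 * pi\<^sup>2) \<le> (\<Sum>\<^sub>\<infinity>k. kabs k * norm (v k)) * (Hnorm u * Hnorm w)"
proof -
  let ?d = "\<lambda>(p,k). norm (u p) * (kabs (k - p) * norm (v (k - p))) * norm (w k)"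
  let ?e = "\<lambda>(p,k). (kabs p * norm (v p)) * norm (u (k - p)) * norm (w k)"
  have "cmod (tri u v w) \<le> (\<Sum>\<^sub>\<infinity>x. norm (tri_term u v w x))"
    unfolding tri_def by (rule norm_infsum_bound[OF tri_abs_summable[OF assms(1-3)]])
  also have "\<dots> \<le> infsum ?d UNIV"
    by (intro infsum_mono tri_abs_summable tri_dominated(1) assms norm_tri_term_le')
  also have "infsum ?d UNIV = infsum ?e UNIV"
    by (rule infsum_reindex_bij_witness[where i="\<lambda>(p,k). (k - p, k)" and j="\<lambda>(p,k). (k - p, k)"])
       (auto simp: mult_ac)
  also have "\<dots> \<le> (\<Sum>\<^sub>\<infinity>k. kabs k * norm (v k)) * (l2n (\<lambda>k. norm (u k)) * l2n (\<lambda>k. norm (w k)))"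
    by (rule young_l1_l2_l2(2)[OF assms(4) _ in_H_l2[OF in_DA_imp_in_H[OF assms(1)]] _ in_H_l2[OF assms(3)]])
       auto
  finally show ?thesis
    using pi_gt_zero by (simp add: Hnorm_l2n power2_eq_square mult_ac)
qed

lemma tri_diff1:
  assumes "in_DA u" "in_DA u'" "in_V v" "in_H w"
  shows "tri (\<lambda>k. u k - u' k) v w = tri u v w - tri u' v w"
proof -
  have "((\<lambda>x. tri_term u v w x + - tri_term u' v w x) has_sum tri u v w + - tri u' v w) UNIV"
    by (intro has_sum_add tri_has_sum assms) (simp add: has_sum_uminus tri_has_sum assms)
  also have "(\<lambda>x. tri_term u v w x + - tri_term u' v w x) = tri_term (\<lambda>k. u k - u' k) v w"
    by (auto simp: tri_term_def fun_eq_iff algebra_simps)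
  finally have "(tri_term (\<lambda>k. u k - u' k) v w has_sum tri u v w + - tri u' v w) UNIV" .
  then show ?thesis unfolding tri_def[of "\<lambda>k. u k - u' k"] by (simp add: infsumI)
qed

lemma tri_diff2:
  assumes "in_DA u" "in_V v" "in_V v'" "in_H w"
  shows "tri u (\<lambda>k. v k - v' k) w = tri u v w - tri u v' w"
proof -
  have "((\<lambda>x. tri_term u v w x + - tri_term u v' w x) has_sum tri u v w + - tri u v' w) UNIV"
    by (intro has_sum_add tri_has_sum assms) (simp add: has_sum_uminus tri_has_sum assms)
  also have "(\<lambda>x. tri_term u v w x + - tri_term u v' w x) = tri_term u (\<lambda>k. v k - v' k) w"
    by (auto simp: tri_term_def fun_eq_iff algebra_simps)
  finally have "(tri_term u (\<lambda>k. v k - v' k) w has_sum tri u v w + - tri u v' w) UNIV" .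
  then show ?thesis unfolding tri_def[of _ "\<lambda>k. v k - v' k"] by (simp add: infsumI)
qed

text \<open>The substitution of (-p, k - p) for (p, k) exchanges the modes of v and w. Reality of u
  identifies the conjugate of u (-p) with u p, and zero divergence lets k replace k - p in the
  factor \<open>kdot\<close>. The conjugate in the result is due to \<open>cdot\<close> being
  sesquilinear.\<close>

lemma tri_antisym:
  assumes "in_DA u" "in_V v" "in_V w"
  shows "tri u v w = - cnj (tri u w v)"
proof -
  have cu: "cnj (kdot k (u (- p))) = kdot k (u p)" for k p
    using in_H_uminus[OF in_DA_imp_in_H[OF assms(1)]] by (simp add: kdot_def)
  have eq: "- cnj (tri_term u w v (- fst x, snd x - fst x)) = tri_term u v w x" for x
    by (cases x) (simp add: tri_term_def cu cnj_cdot kdot_diff_left in_H_div[OF in_DA_imp_in_H[OF assms(1)]])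
  have "infsum (tri_term u v w) UNIV = infsum (\<lambda>x. - cnj (tri_term u w v x)) UNIV"
    by (rule infsum_reindex_bij_witness[where i="\<lambda>x. (- fst x, snd x - fst x)" and j="\<lambda>x. (- fst x, snd x - fst x)"])
       (simp_all add: eq)
  then show ?thesis by (simp add: tri_def infsum_uminus)
qed

lemma Re_tri_same: "in_DA u \<Longrightarrow> in_V v \<Longrightarrow> Re (tri u v v) = 0"
  using tri_antisym[of u v v] by (simp add: complex_eq_iff)

section \<open>The nonlinearity mode by mode\<close>

lemma conv_summable:
  assumes u: "in_DA u" and v: "in_V v"
  shows "(\<lambda>p. norm (u p) * (kabs (k - p) * norm (v (k - p)))) summable_on UNIV"
    and "(\<lambda>p. cmul (\<i> * kdot (k - p) (u p)) (v (k - p))) summable_on UNIV"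
    and "norm (conv u v k) \<le> (\<Sum>\<^sub>\<infinity>p. norm (u p) * (kabs (k - p) * norm (v (k - p))))"
proof -
  let ?a = "\<lambda>k. kabs k * norm (v k)"
  have a: "?a q \<le> l2n ?a" for q
    using L2_set_le_l2n[OF in_V_l2[OF v], of "{q}"] by (simp add: abs_mult)
  show 1: "(\<lambda>p. norm (u p) * ?a (k - p)) summable_on UNIV"
  proof (rule summable_on_comparison_test)
    show "(\<lambda>p. norm (u p) * l2n ?a) summable_on UNIV"
      by (intro summable_on_cmult_left in_DA_l1 u)
  qed (auto intro!: mult_left_mono a)
  have le: "norm (cmul (\<i> * kdot (k - p) (u p)) (v (k - p))) \<le> norm (u p) * ?a (k - p)" for p
    using mult_right_mono[OF cmod_kdot_le[of "k - p" "u p"], of "norm (v (k - p))"]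
    by (simp add: norm_cmul norm_mult mult_ac)
  have 2: "(\<lambda>p. norm (cmul (\<i> * kdot (k - p) (u p)) (v (k - p)))) summable_on UNIV"
    by (rule summable_on_comparison_test[OF 1]) (auto simp: le)
  then show "(\<lambda>p. cmul (\<i> * kdot (k - p) (u p)) (v (k - p))) summable_on UNIV"
    by (rule abs_summable_summable)
  have "norm (conv u v k) \<le> (\<Sum>\<^sub>\<infinity>p. norm (cmul (\<i> * kdot (k - p) (u p)) (v (k - p))))"
    unfolding conv_def kminus_eq by (rule norm_infsum_bound[OF 2])
  also have "\<dots> \<le> (\<Sum>\<^sub>\<infinity>p. norm (u p) * ?a (k - p))"
    by (intro infsum_mono 1 2 le)
  finally show "norm (conv u v k) \<le> (\<Sum>\<^sub>\<infinity>p. norm (u p) * ?a (k - p))" .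
qed

text \<open>The projection removes a multiple of k, and this is orthogonal to \<open>w k\<close>
  when w is divergence-free.\<close>

lemma cdot_leray:
  assumes "in_H w"
  shows "cdot (leray x k) (w k) = cdot (x k) (w k)"
proof (cases "k = 0")
  case True
  then show ?thesis using in_H_0[OF assms] by simp
next
  case False
  have "cdot (of_int (fst k), of_int (snd k)) (w k) = cnj (kdot k (w k))"
    by (simp add: cdot_def kdot_def)
  then show ?thesis
    using False in_H_div[OF assms, of k] by (simp add: leray_def zero_prod_def)
qed

text \<open>The triangle inequality is enough, because this bound feeds a majorant in which
  constants are immaterial.\<close>

lemma norm_leray_le: "norm (leray x k) \<le> 2 * norm (x k)"
proof (cases "k = 0")
  case False
  have k: "norm (of_int (fst k) :: complex, of_int (snd k) :: complex) = kabs k"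
    by (simp add: norm_prod_def ksq_def)
  have pos: "ksq k > 0" using ksq_ge_1[OF False] by simp
  have "norm (cmul (kdot k (x k) / of_real (ksq k)) (of_int (fst k), of_int (snd k)))
      = cmod (kdot k (x k)) / ksq k * kabs k"
    using pos by (simp add: norm_cmul k norm_divide)
  also have "\<dots> \<le> kabs k * norm (x k) / ksq k * kabs k"
    by (intro mult_right_mono divide_right_mono cmod_kdot_le) auto
  also have "\<dots> = norm (x k)"
    using pos by (simp add: field_simps flip: power2_eq_square)
  finally show ?thesis
    using False norm_triangle_ineq4[of "x k" "cmul (kdot k (x k) / of_real (ksq k)) (of_int (fst k), of_int (snd k))"]
    by (simp add: leray_def zero_prod_def)
qed (simp add: leray_def zero_prod_def)

lemma tri_swapped_has_sum:
  fixes f :: "(int \<times> int) \<times> (int \<times> int) \<Rightarrow> 'a::{comm_monoid_add,topological_space}"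
  assumes "(f has_sum S) UNIV"
  shows "((\<lambda>(k,p). f (p,k)) has_sum S) (UNIV \<times> UNIV)"
  using assms has_sum_swap[of "\<lambda>(k,p). f (p,k)" UNIV UNIV S] by simp

text \<open>Fubini for an absolutely convergent double sum: summing over p first produces the
  convolution at mode k.\<close>

lemma Bop_has_sum:
  assumes u: "in_DA u" and v: "in_V v" and w: "in_H w"
  shows "((\<lambda>k. cdot (Bop u v k) (w k)) has_sum tri u v w) UNIV"
proof (rule has_sum_SigmaD[OF tri_swapped_has_sum[OF tri_has_sum[OF assms]], unfolded split])
  fix k :: "int \<times> int"
  have bl: "bounded_linear (\<lambda>z. cdot z (w k))"
    unfolding cdot_def by (intro bounded_linear_add bounded_linear_mult_const bounded_linear_fst bounded_linear_snd)
  have "((\<lambda>p. cmul (\<i> * kdot (k - p) (u p)) (v (k - p))) has_sum conv u v k) UNIV"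
    unfolding conv_def kminus_eq by (intro has_sum_infsum conv_summable u v)
  from has_sum_bounded_linear[OF bl this]
  show "((\<lambda>p. tri_term u v w (p, k)) has_sum cdot (Bop u v k) (w k)) UNIV"
    by (simp add: Bop_def cdot_leray[OF w] tri_term_def)
qed

text \<open>Meant for domination in time rather than for the energy estimate: the absolute values
  stand inside the sum over k, so no cancellation is available, and \<open>Anorm\<close> appears on
  the right.\<close>

lemma Bop_sum_le:
  assumes u: "in_DA u" and v: "in_V v" and w: "in_H w" and F: "finite F"
  shows "(\<Sum>k\<in>F. norm (Bop u v k) * norm (w k)) * (4 * pi\<^sup>2) \<le> 2 * (cA * Anorm u * (Vnorm v * Hnorm w))"
proof -
  let ?d = "\<lambda>(p,k). norm (u p) * (kabs (k - p) * norm (v (k - p))) * norm (w k)"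
  let ?s = "\<lambda>k. (\<Sum>\<^sub>\<infinity>p. norm (u p) * (kabs (k - p) * norm (v (k - p)))) * norm (w k)"
  have hs: "(?s has_sum infsum ?d UNIV) UNIV"
  proof (rule has_sum_SigmaD[OF tri_swapped_has_sum[OF has_sum_infsum[OF tri_dominated(1)[OF u v w]]], unfolded split])
    fix k :: "int \<times> int"
    show "((\<lambda>p. norm (u p) * (kabs (k - p) * norm (v (k - p))) * norm (w k)) has_sum ?s k) UNIV"
      by (intro has_sum_cmult_left has_sum_infsum conv_summable u v)
  qed
  have "(\<Sum>k\<in>F. norm (Bop u v k) * norm (w k)) \<le> (\<Sum>k\<in>F. 2 * ?s k)"
  proof (rule sum_mono)
    fix k
    have "norm (Bop u v k) \<le> 2 * (\<Sum>\<^sub>\<infinity>p. norm (u p) * (kabs (k - p) * norm (v (k - p))))"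
      using norm_leray_le[of "conv u v" k] conv_summable(3)[OF u v, of k] by (simp add: Bop_def)
    then show "norm (Bop u v k) * norm (w k) \<le> 2 * ?s k"
      using mult_right_mono[OF _ norm_ge_zero[of "w k"]] by fastforce
  qed
  also have "\<dots> = 2 * (\<Sum>k\<in>F. ?s k)" by (simp add: sum_distrib_left)
  also have "(\<Sum>k\<in>F. ?s k) \<le> infsum ?d UNIV"
    by (rule finite_sum_le_has_sum[OF hs]) (use F in \<open>auto intro!: mult_nonneg_nonneg infsum_nonneg\<close>)
  also have "\<dots> \<le> (\<Sum>\<^sub>\<infinity>p. norm (u p)) * (l2n (\<lambda>k. kabs k * norm (v k)) * l2n (\<lambda>k. norm (w k)))"
    by (rule tri_dominated(2)[OF u v w])
  also have "\<dots> \<le> (cA * Anorm u) * (l2n (\<lambda>k. kabs k * norm (v k)) * l2n (\<lambda>k. norm (w k)))"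
    by (intro mult_right_mono in_DA_l1 u) auto
  finally show ?thesis
    using pi_gt_zero by (simp add: Vnorm_l2n Hnorm_l2n power2_eq_square mult_ac)
qed

section \<open>Trigonometric polynomials on the square\<close>

definition ek :: "int \<times> int \<Rightarrow> real \<times> real \<Rightarrow> complex" where
  "ek k x = cis (of_int (fst k) * fst x + of_int (snd k) * snd x)"

lemma ek_mult: "ek k x * ek l x = ek (k + l) x"
  by (simp add: ek_def cis_mult algebra_simps)

lemma cnj_ek: "cnj (ek k x) = ek (- k) x"
  by (simp add: ek_def cis_cnj)

lemma ek_0 [simp]: "ek 0 x = 1"
  by (simp add: ek_def)

lemma continuous_on_ek [continuous_intros]: "continuous_on A (ek k)"
  unfolding ek_def[abs_def] by (intro continuous_intros)

lemma compact_Sq: "compact Sq"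
  unfolding Sq_def by (intro compact_Times compact_Icc)

lemma Sq_sets [measurable]: "Sq \<in> sets borel"
  using compact_Sq by (intro borel_closed compact_imp_closed)

lemma Sq_integrable:
  fixes f :: "real \<times> real \<Rightarrow> 'a::{banach,second_countable_topology}"
  assumes "continuous_on UNIV f"
  shows "set_integrable lborel Sq f"
  unfolding set_integrable_def
  by (rule borel_integrable_compact[OF compact_Sq continuous_on_subset[OF assms]]) simp

lemma integral_cis: "(LINT t:{0..2*pi}|lborel. cis (of_int m * t)) = (if m = 0 then 2 * pi else 0)"
proof (cases "m = 0")
  case False
  let ?F = "\<lambda>z. exp (\<i> * of_int m * z) / (\<i> * of_int m)"
  have cis: "cis (of_int m * t) = exp (\<i> * of_int m * complex_of_real t)" for t
    by (simp add: cis_conv_exp mult_ac)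
  have "(LINT t:{0..2*pi}|lborel. cis (of_int m * t)) = ?F (complex_of_real (2*pi)) - ?F (complex_of_real 0)"
    unfolding set_lebesgue_integral_def
  proof (rule integral_FTC_atLeastAtMost[where F="\<lambda>t. ?F (complex_of_real t)"])
    fix t :: real
    have "(?F has_field_derivative exp (\<i> * of_int m * complex_of_real t)) (at (complex_of_real t))"
      using False by (auto intro!: derivative_eq_intros)
    then show "((\<lambda>t. ?F (complex_of_real t)) has_vector_derivative cis (of_int m * t)) (at t within {0..2*pi})"
      unfolding cis by (rule has_vector_derivative_real_field)
  qed (auto intro!: continuous_intros)
  also have "exp (\<i> * of_int m * complex_of_real (2*pi)) = 1"
    using exp_integer_2pi[of "of_int m"] by (simp add: mult_ac)
  finally show ?thesis using False by simp
next
  case True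
  then show ?thesis by (simp add: set_lebesgue_integral_def scaleR_conv_of_real)
qed

lemma integral_ek: "(LINT x:Sq|lborel. ek k x) = (if k = 0 then 4 * pi\<^sup>2 else 0)"
proof -
  let ?c = "\<lambda>m t. indicator {0..2*pi} t *\<^sub>R cis (of_int m * t)"
  let ?f = "\<lambda>x. indicator Sq x *\<^sub>R ek k x"
  have split: "?f (s,t) = ?c (fst k) s * ?c (snd k) t" for s t
    by (auto simp: Sq_def indicator_def ek_def cis_mult)
  have int: "integrable (lborel \<Otimes>\<^sub>M lborel) ?f"
    using Sq_integrable[OF continuous_on_ek] unfolding set_integrable_def lborel_prod .
  have "(LINT x:Sq|lborel. ek k x) = integral\<^sup>L (lborel \<Otimes>\<^sub>M lborel) ?f"
    unfolding set_lebesgue_integral_def lborel_prod ..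
  also have "\<dots> = (LINT s|lborel. LINT t|lborel. ?f (s,t))"
    by (rule lborel_pair.integral_fst'[OF int, symmetric])
  also have "\<dots> = (LINT s|lborel. ?c (fst k) s) * (LINT t|lborel. ?c (snd k) t)"
    unfolding split integral_mult_right_zero integral_mult_left_zero ..
  also have "\<dots> = (if fst k = 0 then 2 * pi else 0) * (if snd k = 0 then 2 * pi else 0)"
    using integral_cis[of "fst k"] integral_cis[of "snd k"] by (simp add: set_lebesgue_integral_def)
  also have "\<dots> = (if k = 0 then 4 * pi\<^sup>2 else 0)"
    by (auto simp: prod_eq_iff power2_eq_square)
  finally show ?thesis .
qed

lemma set_integral_sum:
  fixes f :: "'i \<Rightarrow> 'a \<Rightarrow> 'b::{banach,second_countable_topology}"
  assumes "\<And>i. i \<in> I \<Longrightarrow> set_integrable M A (f i)"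
  shows "(LINT x:A|M. (\<Sum>i\<in>I. f i x)) = (\<Sum>i\<in>I. (LINT x:A|M. f i x))"
  using assms unfolding set_integrable_def set_lebesgue_integral_def scaleR_sum_right
  by (rule Bochner_Integration.integral_sum)

definition tp :: "(int \<times> int) set \<Rightarrow> (int \<times> int \<Rightarrow> complex) \<Rightarrow> real \<times> real \<Rightarrow> complex" where
  "tp F a x = (\<Sum>k\<in>F. a k * ek k x)"

lemma continuous_on_tp [continuous_intros]: "continuous_on A (tp F a)"
  unfolding tp_def[abs_def] by (intro continuous_intros)

lemma borel_measurable_tp [measurable]: "tp F a \<in> borel_measurable borel"
  by (intro borel_measurable_continuous_onI continuous_on_tp)

lemma integral_tp_ek:
  fixes a :: "int \<times> int \<Rightarrow> complex"
  assumes "finite F"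
  shows "(LINT x:Sq|lborel. tp F a x * ek (- k) x) = (if k \<in> F then 4 * pi\<^sup>2 * a k else 0)"
proof -
  have "(LINT x:Sq|lborel. tp F a x * ek (- k) x) = (LINT x:Sq|lborel. (\<Sum>l\<in>F. a l * ek (l - k) x))"
    by (simp add: tp_def sum_distrib_right mult.assoc ek_mult)
  also have "\<dots> = (\<Sum>l\<in>F. a l * (LINT x:Sq|lborel. ek (l - k) x))"
    by (subst set_integral_sum) (auto intro!: Sq_integrable continuous_intros)
  also have "\<dots> = (\<Sum>l\<in>F. if l = k then 4 * pi\<^sup>2 * a k else 0)"
    by (intro sum.cong) (auto simp: integral_ek)
  finally show ?thesis using assms by simp
qed

text \<open>Orthogonality keeps only the frequencies q = k - p of the third factor. As
  \<open>G\<close> contains all differences of elements of \<open>F\<close>, no term of the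
  convolution sum is lost.\<close>

lemma integral_tp_triple:
  assumes F: "finite F" and G: "finite G" "\<And>p k. p \<in> F \<Longrightarrow> k \<in> F \<Longrightarrow> k - p \<in> G"
  shows "(LINT x:Sq|lborel. tp F a x * cnj (tp F b x) * tp G c x)
    = 4 * pi\<^sup>2 * (\<Sum>p\<in>F. \<Sum>k\<in>F. a p * cnj (b k) * c (k - p))"
proof -
  have "(LINT x:Sq|lborel. tp F a x * cnj (tp F b x) * tp G c x)
     = (LINT x:Sq|lborel. (\<Sum>p\<in>F. \<Sum>k\<in>F. \<Sum>q\<in>G. a p * cnj (b k) * c q * ek (p - k + q) x))"
  proof (rule arg_cong[where f="set_lebesgue_integral lborel Sq"], rule ext)
    fix x
    have e: "a p * ek p x * (cnj (b k) * ek (- k) x) * (c q * ek q x) = a p * cnj (b k) * c q * ek (p - k + q) x" for p k q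
    proof -
      have "ek p x * ek (- k) x * ek q x = ek (p - k + q) x" by (simp add: ek_mult)
      then show ?thesis by (metis (no_types, opaque_lifting) mult.assoc mult.left_commute)
    qed
    have "tp F a x * cnj (tp F b x) * tp G c x
        = (\<Sum>p\<in>F. \<Sum>k\<in>F. (a p * ek p x) * (cnj (b k) * ek (- k) x)) * tp G c x"
      unfolding tp_def[of F] cnj_sum complex_cnj_mult cnj_ek sum_product ..
    also have "\<dots> = (\<Sum>p\<in>F. \<Sum>k\<in>F. (a p * ek p x) * (cnj (b k) * ek (- k) x) * tp G c x)"
      by (simp only: sum_distrib_right)
    also have "\<dots> = (\<Sum>p\<in>F. \<Sum>k\<in>F. \<Sum>q\<in>G. a p * cnj (b k) * c q * ek (p - k + q) x)"
      unfolding tp_def sum_distrib_left e ..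
    finally show "tp F a x * cnj (tp F b x) * tp G c x = (\<Sum>p\<in>F. \<Sum>k\<in>F. \<Sum>q\<in>G. a p * cnj (b k) * c q * ek (p - k + q) x)" .
  qed
  also have "\<dots> = (\<Sum>p\<in>F. \<Sum>k\<in>F. \<Sum>q\<in>G. a p * cnj (b k) * c q * (LINT x:Sq|lborel. ek (p - k + q) x))"
    by (subst set_integral_sum; (intro sum.cong refl)?; (intro Sq_integrable continuous_intros)?)+ simp
  also have "\<dots> = (\<Sum>p\<in>F. \<Sum>k\<in>F. 4 * pi\<^sup>2 * (a p * cnj (b k) * c (k - p)))"
  proof (intro sum.cong refl)
    fix p k assume pk: "p \<in> F" "k \<in> F"
    have "(\<Sum>q\<in>G. a p * cnj (b k) * c q * (LINT x:Sq|lborel. ek (p - k + q) x))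
      = (\<Sum>q\<in>G. if q = k - p then 4 * pi\<^sup>2 * (a p * cnj (b k) * c (k - p)) else 0)"
    proof (intro sum.cong refl)
      fix q
      have "p - k + q = 0 \<longleftrightarrow> q = k - p" by (metis add.commute diff_add_cancel diff_eq_eq eq_iff_diff_eq_0 minus_diff_eq add_eq_0_iff)
      then show "a p * cnj (b k) * c q * (LINT x:Sq|lborel. ek (p - k + q) x) = (if q = k - p then 4 * pi\<^sup>2 * (a p * cnj (b k) * c (k - p)) else 0)"
        by (simp add: integral_ek)
    qed
    then show "(\<Sum>q\<in>G. a p * cnj (b k) * c q * (LINT x:Sq|lborel. ek (p - k + q) x)) = 4 * pi\<^sup>2 * (a p * cnj (b k) * c (k - p))"
      using G pk by simp
  qed
  finally show ?thesis by (simp add: sum_distrib_left)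
qed

lemma parseval_tp:
  assumes "finite G"
  shows "(LINT x:Sq|lborel. (cmod (tp G c x))\<^sup>2) = 4 * pi\<^sup>2 * (\<Sum>q\<in>G. (cmod (c q))\<^sup>2)"
proof -
  have "complex_of_real (LINT x:Sq|lborel. (cmod (tp G c x))\<^sup>2) = (LINT x:Sq|lborel. tp G c x * cnj (tp G c x))"
    by (simp add: set_integral_complex_of_real[symmetric] complex_norm_square del: of_real_power)
  also have "\<dots> = (LINT x:Sq|lborel. (\<Sum>q\<in>G. cnj (c q) * (tp G c x * ek (- q) x)))"
    unfolding tp_def[of G c] cnj_sum complex_cnj_mult cnj_ek sum_distrib_left by (simp add: mult_ac)
  also have "\<dots> = (\<Sum>q\<in>G. cnj (c q) * (LINT x:Sq|lborel. tp G c x * ek (- q) x))"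
    by (subst set_integral_sum) (auto intro!: Sq_integrable continuous_intros)
  also have "\<dots> = (\<Sum>q\<in>G. 4 * pi\<^sup>2 * complex_of_real ((cmod (c q))\<^sup>2))"
    by (intro sum.cong refl) (subst integral_tp_ek[OF assms], simp add: complex_norm_square mult_ac del: of_real_power)
  also have "\<dots> = complex_of_real (4 * pi\<^sup>2 * (\<Sum>q\<in>G. (cmod (c q))\<^sup>2))"
    by (simp add: sum_distrib_left)
  finally show ?thesis using of_real_eq_iff by blast
qed

lemma tp_real:
  assumes "finite F" "\<And>k. k \<in> F \<Longrightarrow> - k \<in> F" "\<And>k. a (- k) = cnj (a k)"
  shows "complex_of_real (Re (tp F a x)) = tp F a x"
proof -
  have "cnj (tp F a x) = (\<Sum>k\<in>F. a (- k) * ek (- k) x)"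
    by (simp add: tp_def cnj_ek assms(3))
  also have "\<dots> = tp F a x"
    unfolding tp_def
    by (rule sum.reindex_bij_witness[where i=uminus and j=uminus]) (use assms in simp_all)
  finally show ?thesis by (simp add: complex_eq_iff)
qed

section \<open>Ladyzhenskaya's inequality and the form b(u,v,u)\<close>

definition phys :: "(int \<times> int) set \<Rightarrow> coef \<Rightarrow> real \<times> real \<Rightarrow> real \<times> real" where
  "phys F u x = (Re (tp F (\<lambda>k. fst (u k)) x), Re (tp F (\<lambda>k. snd (u k)) x))"

text \<open>Taking real parts in \<open>phys\<close> loses nothing: for symmetric \<open>F\<close>
  and a field in H the polynomial is already real. This makes a statement about represented
  functions applicable to truncations of u.\<close>

lemma phys_represents:
  assumes u: "in_H u" and F: "finite F" "\<And>k. k \<in> F \<Longrightarrow> - k \<in> F"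
  shows "represents (phys F u) (mask F u)"
    and "complex_of_real (fst (phys F u x)) = tp F (\<lambda>k. fst (u k)) x"
    and "complex_of_real (snd (phys F u x)) = tp F (\<lambda>k. snd (u k)) x"
proof -
  show f: "complex_of_real (fst (phys F u x)) = tp F (\<lambda>k. fst (u k)) x"
    and s: "complex_of_real (snd (phys F u x)) = tp F (\<lambda>k. snd (u k)) x" for x
    unfolding phys_def fst_conv snd_conv
    by (intro tp_real F, simp_all add: in_H_uminus[OF u])+
  have cont: "continuous_on UNIV (phys F u)"
    unfolding phys_def[abs_def] by (intro continuous_intros)
  have e: "cis (- (of_int (fst k) * fst x + of_int (snd k) * snd x)) = ek (- k) x" for k x
    by (simp add: ek_def algebra_simps)
  show "represents (phys F u) (mask F u)"
    unfolding represents_def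
  proof (intro conjI allI)
    show "phys F u \<in> borel_measurable lborel"
      using cont by (simp add: borel_measurable_continuous_onI)
    show "set_integrable lborel Sq (\<lambda>x. (norm (phys F u x))\<^sup>2)"
      by (intro Sq_integrable continuous_intros cont)
    fix k
    show "fcoef (phys F u) k = mask F u k"
      unfolding fcoef_def f s e integral_tp_ek[OF F(1)] by (simp add: mask_def zero_prod_def)
  qed
qed

text \<open>The pointwise estimate |((u.grad) v).u| \<le> |u|^2 |grad v| with the Frobenius norm of
  the gradient. The entries are complex because the derivatives of v enter as complex trigonometric
  polynomials.\<close>

lemma quadratic_form_bound:
  fixes a b :: real and D11 D12 D21 D22 :: complex
  shows "cmod (a * a * D11 + a * b * D12 + b * a * D21 + b * b * D22)
    \<le> (norm (a, b))\<^sup>2 * sqrt ((cmod D11)\<^sup>2 + (cmod D12)\<^sup>2 + (cmod D21)\<^sup>2 + (cmod D22)\<^sup>2)"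
proof -
  let ?r = "sqrt (a\<^sup>2 + b\<^sup>2)"
  let ?d1 = "sqrt ((cmod D11)\<^sup>2 + (cmod D12)\<^sup>2)" and ?d2 = "sqrt ((cmod D21)\<^sup>2 + (cmod D22)\<^sup>2)"
  have "cmod (a * a * D11 + a * b * D12 + b * a * D21 + b * b * D22)
      = cmod (a * (a * D11 + b * D12) + b * (a * D21 + b * D22))"
    by (simp add: algebra_simps)
  also have "\<dots> \<le> \<bar>a\<bar> * cmod (a * D11 + b * D12) + \<bar>b\<bar> * cmod (a * D21 + b * D22)"
    by (rule norm_triangle_le) (simp add: norm_mult)
  also have "\<dots> \<le> \<bar>a\<bar> * (\<bar>a\<bar> * cmod D11 + \<bar>b\<bar> * cmod D12) + \<bar>b\<bar> * (\<bar>a\<bar> * cmod D21 + \<bar>b\<bar> * cmod D22)"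
    by (intro add_mono mult_left_mono norm_triangle_le) (simp_all add: norm_mult)
  also have "\<dots> \<le> \<bar>a\<bar> * (?r * ?d1) + \<bar>b\<bar> * (?r * ?d2)"
    using cauchy_schwarz_2[of "\<bar>a\<bar>" "cmod D11" "\<bar>b\<bar>" "cmod D12"] cauchy_schwarz_2[of "\<bar>a\<bar>" "cmod D21" "\<bar>b\<bar>" "cmod D22"]
    by (intro add_mono mult_left_mono) simp_all
  also have "\<dots> = ?r * (\<bar>a\<bar> * ?d1 + \<bar>b\<bar> * ?d2)" by (simp add: algebra_simps)
  also have "\<dots> \<le> ?r * (?r * sqrt (?d1\<^sup>2 + ?d2\<^sup>2))"
    using cauchy_schwarz_2[of "\<bar>a\<bar>" ?d1 "\<bar>b\<bar>" ?d2] by (intro mult_left_mono) simp_all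
  also have "\<dots> = (norm (a, b))\<^sup>2 * sqrt (?d1\<^sup>2 + ?d2\<^sup>2)"
    by (simp add: norm_prod_def)
  finally show ?thesis
    by (simp add: add.assoc)
qed

text \<open>The L^4 inequality with both sides squared; the extended nonnegative integral makes it
  meaningful without assuming that the fourth power is integrable.\<close>

definition ladyzhenskaya :: "real \<Rightarrow> bool" where
  "ladyzhenskaya C \<longleftrightarrow> (\<forall>c f. in_V c \<longrightarrow> represents f c \<longrightarrow>
    (\<integral>\<^sup>+x. indicator Sq x * ennreal ((norm (f x))^4) \<partial>lborel) \<le> ennreal ((C * Vnorm c * Hnorm c)\<^sup>2))"

text \<open>When u is cut off to \<open>F\<close> in both of its slots, the sum is the integral of
  ((u.grad) v).u for trigonometric polynomials, and the pointwise bound, Cauchy-Schwarz and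
  Ladyzhenskaya's inequality apply. The right-hand side does not depend on \<open>F\<close>.\<close>

lemma trilinear_finite_bound:
  assumes Lady: "ladyzhenskaya C"
    and C: "C \<ge> 0" and u: "in_V u" and v: "in_V v"
    and F: "finite F" "\<And>k. - k \<in> F \<longleftrightarrow> k \<in> F"
  shows "cmod (\<Sum>x\<in>F\<times>F. tri_term u v u x) * (4 * pi\<^sup>2) \<le> C * Vnorm u * Hnorm u * Vnorm v"
proof -
  \<comment> \<open>The frequencies of v that can meet two modes of u in \<open>F\<close>.\<close>
  define G where "G = (\<lambda>(p,k). k - p) ` (F \<times> F)"
  have G: "finite G" "\<And>p k. p \<in> F \<Longrightarrow> k \<in> F \<Longrightarrow> k - p \<in> G"
    using F(1) by (simp_all add: G_def image_iff) force
  define u1 u2 where "u1 k = fst (u k)" and "u2 k = snd (u k)" for k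
  \<comment> \<open>Coefficients of the partial derivatives of v; \<open>c12\<close>, say, belongs
    to the first partial derivative of the second component.\<close>
  define c11 c12 c21 c22 where "c11 q = \<i> * of_int (fst q) * fst (v q)"
    and "c12 q = \<i> * of_int (fst q) * snd (v q)"
    and "c21 q = \<i> * of_int (snd q) * fst (v q)"
    and "c22 q = \<i> * of_int (snd q) * snd (v q)" for q
  define f where "f = phys F u"
  define g where "g x = complex_of_real (fst (f x)) * fst (f x) * tp G c11 x
      + complex_of_real (fst (f x)) * snd (f x) * tp G c12 x
      + complex_of_real (snd (f x)) * fst (f x) * tp G c21 x
      + complex_of_real (snd (f x)) * snd (f x) * tp G c22 x" for x
  define d2 where "d2 x = (cmod (tp G c11 x))\<^sup>2 + (cmod (tp G c12 x))\<^sup>2 + (cmod (tp G c21 x))\<^sup>2 + (cmod (tp G c22 x))\<^sup>2" for x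
  have H: "in_H u" using u by (rule in_V_imp_in_H)
  have sym: "\<And>k. k \<in> F \<Longrightarrow> - k \<in> F" using F(2) by simp
  note ph = phys_represents[OF H F(1) sym]
  \<comment> \<open>Each real component is recorded plainly and conjugated, since
    \<open>integral_tp_triple\<close> expects a conjugate on its second factor.\<close>
  have f1: "complex_of_real (fst (f x)) = tp F u1 x" "complex_of_real (fst (f x)) = cnj (tp F u1 x)"
    and f2: "complex_of_real (snd (f x)) = tp F u2 x" "complex_of_real (snd (f x)) = cnj (tp F u2 x)" for x
    using ph(2,3)[of x] unfolding f_def u1_def[abs_def] u2_def[abs_def] by (metis complex_cnj_complex_of_real)+
  have contf: "continuous_on UNIV f" unfolding f_def phys_def[abs_def] by (intro continuous_intros)
  have contg: "continuous_on UNIV g" unfolding g_def[abs_def]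
    by (intro continuous_intros continuous_on_fst continuous_on_snd contf)
  have contd: "continuous_on UNIV d2" unfolding d2_def[abs_def] by (intro continuous_intros)
  have [measurable]: "f \<in> borel_measurable borel" "d2 \<in> borel_measurable borel"
    using contf contd by (auto intro: borel_measurable_continuous_onI)
  have d2nn: "d2 x \<ge> 0" for x by (simp add: d2_def)
  have Ig: "(LINT x:Sq|lborel. g x) = 4 * pi\<^sup>2 * (\<Sum>x\<in>F\<times>F. tri_term u v u x)"
  proof -
    have "(LINT x:Sq|lborel. g x) = (LINT x:Sq|lborel. tp F u1 x * cnj (tp F u1 x) * tp G c11 x
      + tp F u1 x * cnj (tp F u2 x) * tp G c12 x
      + tp F u2 x * cnj (tp F u1 x) * tp G c21 x
      + tp F u2 x * cnj (tp F u2 x) * tp G c22 x)"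
      unfolding g_def by (metis (no_types, lifting) f1 f2)
    also have "\<dots> = (LINT x:Sq|lborel. tp F u1 x * cnj (tp F u1 x) * tp G c11 x)
      + (LINT x:Sq|lborel. tp F u1 x * cnj (tp F u2 x) * tp G c12 x)
      + (LINT x:Sq|lborel. tp F u2 x * cnj (tp F u1 x) * tp G c21 x)
      + (LINT x:Sq|lborel. tp F u2 x * cnj (tp F u2 x) * tp G c22 x)"
      by (subst set_integral_add, (intro Sq_integrable continuous_intros)+)+ simp
    also have "\<dots> = 4 * pi\<^sup>2 * (\<Sum>p\<in>F. \<Sum>k\<in>F. u1 p * cnj (u1 k) * c11 (k - p) + u1 p * cnj (u2 k) * c12 (k - p)
       + u2 p * cnj (u1 k) * c21 (k - p) + u2 p * cnj (u2 k) * c22 (k - p))"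
      by (simp only: integral_tp_triple[OF F(1) G] sum.distrib distrib_left)
    also have "(\<Sum>p\<in>F. \<Sum>k\<in>F. u1 p * cnj (u1 k) * c11 (k - p) + u1 p * cnj (u2 k) * c12 (k - p)
       + u2 p * cnj (u1 k) * c21 (k - p) + u2 p * cnj (u2 k) * c22 (k - p)) = (\<Sum>p\<in>F. \<Sum>k\<in>F. tri_term u v u (p,k))"
      by (intro sum.cong refl)
         (simp add: tri_term_def kdot_def cdot_def u1_def u2_def c11_def c12_def c21_def c22_def algebra_simps)
    finally show ?thesis by (simp add: sum.cartesian_product)
  qed
  \<comment> \<open>By Parseval this is the squared V-norm of v restricted to the modes in
    \<open>G\<close>, a partial sum of nonnegative terms.\<close>
  have Id: "(LINT x:Sq|lborel. d2 x) \<le> (Vnorm v)\<^sup>2"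
  proof -
    have "(LINT x:Sq|lborel. d2 x) = (LINT x:Sq|lborel. (cmod (tp G c11 x))\<^sup>2) + (LINT x:Sq|lborel. (cmod (tp G c12 x))\<^sup>2)
       + (LINT x:Sq|lborel. (cmod (tp G c21 x))\<^sup>2) + (LINT x:Sq|lborel. (cmod (tp G c22 x))\<^sup>2)"
      unfolding d2_def by (subst set_integral_add, (intro Sq_integrable continuous_intros)+)+ simp
    also have "\<dots> = 4 * pi\<^sup>2 * (\<Sum>q\<in>G. (cmod (c11 q))\<^sup>2 + (cmod (c12 q))\<^sup>2 + (cmod (c21 q))\<^sup>2 + (cmod (c22 q))\<^sup>2)"
      by (simp only: parseval_tp[OF G(1)] sum.distrib distrib_left)
    also have "(\<Sum>q\<in>G. (cmod (c11 q))\<^sup>2 + (cmod (c12 q))\<^sup>2 + (cmod (c21 q))\<^sup>2 + (cmod (c22 q))\<^sup>2)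
       = (\<Sum>q\<in>G. ksq q * cn2 (v q))"
      by (intro sum.cong refl)
         (simp add: c11_def c12_def c21_def c22_def norm_mult power_mult_distrib ksq_def cn2_def algebra_simps)
    also have "4 * pi\<^sup>2 * \<dots> \<le> (Vnorm v)\<^sup>2"
      unfolding Vnorm_sq using v G(1)
      by (intro mult_left_mono finite_sum_le_infsum) (auto simp: in_V_def)
    finally show ?thesis .
  qed
  define A B where "A = C * Vnorm (mask F u) * Hnorm (mask F u)" and "B = Vnorm v"
  have AB: "A \<ge> 0" "B \<ge> 0" using C by (auto simp: A_def B_def)
  let ?p = "\<lambda>x. indicator Sq x * ennreal ((norm (f x))\<^sup>2)" and ?q = "\<lambda>x. indicator Sq x * ennreal (sqrt (d2 x))"
  have gint: "integrable lborel (\<lambda>x. indicator Sq x *\<^sub>R g x)"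
    using Sq_integrable[OF contg] by (simp add: set_integrable_def)
  have "ennreal (cmod (LINT x:Sq|lborel. g x)) \<le> (\<integral>\<^sup>+x. ennreal (norm (indicator Sq x *\<^sub>R g x)) \<partial>lborel)"
    unfolding set_lebesgue_integral_def by (rule integral_norm_bound_ennreal[OF gint])
  also have "\<dots> \<le> (\<integral>\<^sup>+x. ?p x * ?q x \<partial>lborel)"
  proof (rule nn_integral_mono)
    fix x
    have "cmod (g x) \<le> (norm (f x))\<^sup>2 * sqrt (d2 x)"
      using quadratic_form_bound[of "fst (f x)" "tp G c11 x" "snd (f x)" "tp G c12 x" "tp G c21 x" "tp G c22 x"]
      by (simp add: g_def d2_def)
    then show "ennreal (norm (indicator Sq x *\<^sub>R g x)) \<le> ?p x * ?q x"
      using d2nn[of x] by (auto simp: indicator_def ennreal_mult[symmetric] intro!: ennreal_leI)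
  qed
  finally have "(ennreal (cmod (LINT x:Sq|lborel. g x)))\<^sup>2 \<le> (\<integral>\<^sup>+x. ?p x * ?q x \<partial>lborel)\<^sup>2"
    by (intro power_mono) auto
  \<comment> \<open>Cauchy-Schwarz separates |f|^2 from |grad v|; the square of the first factor is
    the fourth power in Ladyzhenskaya's inequality.\<close>
  also have "\<dots> \<le> (\<integral>\<^sup>+x. (?p x)\<^sup>2 \<partial>lborel) * (\<integral>\<^sup>+x. (?q x)\<^sup>2 \<partial>lborel)"
    by (intro Cauchy_Schwarz_nn_integral) measurable
  also have "(\<integral>\<^sup>+x. (?p x)\<^sup>2 \<partial>lborel) = (\<integral>\<^sup>+x. indicator Sq x * ennreal ((norm (f x))^4) \<partial>lborel)"
    by (intro nn_integral_cong) (auto simp: indicator_def ennreal_power simp flip: power_mult)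
  also have "(\<integral>\<^sup>+x. (?q x)\<^sup>2 \<partial>lborel) = (\<integral>\<^sup>+x. ennreal (indicator Sq x *\<^sub>R d2 x) \<partial>lborel)"
    by (intro nn_integral_cong) (auto simp: indicator_def ennreal_power d2nn)
  also have "\<dots> = ennreal (LINT x:Sq|lborel. d2 x)"
    unfolding set_lebesgue_integral_def using Sq_integrable[OF contd] d2nn
    by (intro nn_integral_eq_integral) (auto simp: set_integrable_def)
  also have "(\<integral>\<^sup>+x. indicator Sq x * ennreal ((norm (f x))^4) \<partial>lborel) * ennreal (LINT x:Sq|lborel. d2 x)
     \<le> ennreal (A\<^sup>2) * ennreal (B\<^sup>2)"
    unfolding A_def B_def
    using Lady in_V_mask[OF u F(2)] ph(1)[folded f_def] unfolding ladyzhenskaya_def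
    by (intro mult_mono ennreal_leI Id) auto
  also have "\<dots> = (ennreal (A * B))\<^sup>2"
    using AB by (simp add: ennreal_mult ennreal_power power_mult_distrib)
  finally have "ennreal ((cmod (LINT x:Sq|lborel. g x))\<^sup>2) \<le> ennreal ((A * B)\<^sup>2)"
    using AB by (simp add: ennreal_power)
  then have "(cmod (LINT x:Sq|lborel. g x))\<^sup>2 \<le> (A * B)\<^sup>2"
    by (simp add: ennreal_le_iff)
  then have "cmod (LINT x:Sq|lborel. g x) \<le> A * B"
    by (rule power2_le_imp_le) (simp add: AB)
  also have "\<dots> \<le> C * Vnorm u * Hnorm u * Vnorm v"
    unfolding A_def B_def using C
    by (intro mult_mono Vnorm_mask_le Hnorm_mask_le u H) auto
  finally show ?thesis
    unfolding Ig by (simp add: norm_mult norm_power mult_ac)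
qed

text \<open>The bound for truncations is uniform, so it survives the limit along products of balls
  of modes. These exhaust the index set and are therefore cofinal among its finite subsets.\<close>

lemma trilinear_ladyzhenskaya:
  assumes Lady: "ladyzhenskaya C"
    and C: "C \<ge> 0" and u: "in_DA u" and v: "in_V v"
  shows "cmod (tri u v u) * (4 * pi\<^sup>2) \<le> C * Vnorm u * Hnorm u * Vnorm v"
proof -
  define F where "F n = {k. ksq k \<le> real n}" for n
  have fin: "finite (F n)" for n unfolding F_def by (rule finite_ksq_le)
  have "filterlim (\<lambda>n. F n \<times> F n) (finite_subsets_at_top UNIV) sequentially"
    unfolding filterlim_finite_subsets_at_top
  proof (intro allI impI)
    fix X :: "((int \<times> int) \<times> (int \<times> int)) set" assume X: "finite X \<and> X \<subseteq> UNIV"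
    \<comment> \<open>The sum of nonnegative terms dominates each \<open>ksq\<close> occurring in
      \<open>X\<close>, so one ball contains all modes involved.\<close>
    define M where "M = (\<Sum>x\<in>X. ksq (fst x) + ksq (snd x))"
    have M: "ksq (fst x) \<le> M" "ksq (snd x) \<le> M" if "x \<in> X" for x
    proof -
      have "ksq (fst x) + ksq (snd x) \<le> M"
        unfolding M_def by (rule member_le_sum) (use X that in auto)
      then show "ksq (fst x) \<le> M" "ksq (snd x) \<le> M"
        using ksq_nonneg[of "fst x"] ksq_nonneg[of "snd x"] by linarith+
    qed
    show "\<forall>\<^sub>F n in sequentially. finite (F n \<times> F n) \<and> X \<subseteq> F n \<times> F n \<and> F n \<times> F n \<subseteq> UNIV"
      using eventually_ge_at_top[of "nat \<lceil>M\<rceil>"]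
    proof eventually_elim
      case (elim n)
      then have "M \<le> real n" by linarith
      then have "X \<subseteq> F n \<times> F n" using M by (force simp: F_def)
      then show ?case using fin by simp
    qed
  qed
  then have "(\<lambda>n. \<Sum>x\<in>F n \<times> F n. tri_term u v u x) \<longlonglongrightarrow> tri u v u"
    using tri_has_sum[OF u v in_DA_imp_in_H[OF u]] unfolding has_sum_def by (rule filterlim_compose[rotated])
  then have "(\<lambda>n. cmod (\<Sum>x\<in>F n \<times> F n. tri_term u v u x) * (4 * pi\<^sup>2)) \<longlonglongrightarrow> cmod (tri u v u) * (4 * pi\<^sup>2)"
    by (intro tendsto_intros)
  then show ?thesis
    by (rule LIMSEQ_le_const2)
       (intro exI allI impI trilinear_finite_bound[OF Lady C in_DA_imp_in_V[OF u] v fin], auto simp: F_def)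
qed

section \<open>Energy balances\<close>

lemma has_prim_cn2:
  assumes y: "has_prim y r"
  shows "has_prim (\<lambda>t. cn2 (y t)) (\<lambda>t. 2 * Re (cdot (r t) (y t)))"
proof -
  have f: "has_prim (\<lambda>t. fst (y t)) (\<lambda>t. fst (r t))" and s: "has_prim (\<lambda>t. snd (y t)) (\<lambda>t. snd (r t))"
    by (rule has_prim_bounded_linear[OF bounded_linear_fst y], rule has_prim_bounded_linear[OF bounded_linear_snd y])
  note p = has_prim_bounded_linear[OF bounded_linear_Re has_prim_add[OF
      has_prim_mult[OF f has_prim_bounded_linear[OF bounded_linear_cnj f]]
      has_prim_mult[OF s has_prim_bounded_linear[OF bounded_linear_cnj s]]]]
  have "cn2 z = Re (fst z * cnj (fst z) + snd z * cnj (snd z))" for z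
    by (simp add: cn2_def cmod_def power2_eq_square)
  moreover have "2 * Re (cdot a b) = Re (fst a * cnj (fst b) + fst b * cnj (fst a) + (snd a * cnj (snd b) + snd b * cnj (snd a)))" for a b
    by (simp add: cdot_def algebra_simps)
  ultimately show ?thesis using p by simp
qed

lemma has_prim_cmult:
  fixes F :: "real \<Rightarrow> real"
  shows "has_prim F f \<Longrightarrow> has_prim (\<lambda>t. c * F t) (\<lambda>t. c * f t)"
  by (rule has_prim_bounded_linear[OF bounded_linear_mult_right])

lemma has_prim_linear: "has_prim (\<lambda>t. c * t) (\<lambda>t. c :: real)"
  by (rule has_prim_C1) (auto intro!: derivative_eq_intros simp flip: has_real_derivative_iff_has_vector_derivative)

section \<open>Inner products and trilinear terms tested with high modes\<close>

lemma H_inner_has_sum: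
  assumes a: "in_H a" and b: "in_H b"
  obtains \<gamma> where "((\<lambda>k. Re (cdot (a k) (b k))) has_sum \<gamma>) UNIV" "\<bar>\<gamma>\<bar> * (4 * pi\<^sup>2) \<le> Hnorm a * Hnorm b"
proof -
  note cs = l2_cauchy_schwarz[OF in_H_l2[OF a] in_H_l2[OF b]]
  have le: "norm (Re (cdot (a k) (b k))) \<le> \<bar>norm (a k) * norm (b k)\<bar>" for k
    using abs_Re_le_cmod[of "cdot (a k) (b k)"] cmod_cdot_le[of "a k" "b k"] by simp
  have s: "(\<lambda>k. norm (Re (cdot (a k) (b k)))) summable_on UNIV"
    by (rule summable_on_comparison_test[OF cs(1)]) (use le in \<open>simp_all only: norm_ge_zero\<close>)
  let ?\<gamma> = "\<Sum>\<^sub>\<infinity>k. Re (cdot (a k) (b k))"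
  have "norm ?\<gamma> \<le> (\<Sum>\<^sub>\<infinity>k. norm (Re (cdot (a k) (b k))))"
    by (rule norm_infsum_bound[OF s])
  also have "\<dots> \<le> (\<Sum>\<^sub>\<infinity>k. \<bar>norm (a k) * norm (b k)\<bar>)"
    by (intro infsum_mono s cs le)
  also note cs(2)
  finally have "\<bar>?\<gamma>\<bar> * (4 * pi\<^sup>2) \<le> Hnorm a * Hnorm b"
    using pi_gt_zero by (simp add: Hnorm_l2n power2_eq_square mult_ac)
  then show ?thesis
    using that[of ?\<gamma>] has_sum_infsum[OF abs_summable_summable[OF s]] by blast
qed

text \<open>With v = p + q and in real parts, b(v,q,q) = 0 reduces b(v,v,q) to b(v,p,q) = b(q,p,q) +
  b(p,p,q), and antisymmetry turns the last term into -b(p,q,p). In both remaining terms the outer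
  arguments agree, as \<open>trilinear_ladyzhenskaya\<close> demands.\<close>

lemma Re_tri_high_bound:
  assumes Lady: "ladyzhenskaya C"
    and C: "C \<ge> 0" and v: "in_DA v"
  shows "\<bar>Re (tri v v (QN N v))\<bar> * (4 * pi\<^sup>2)
    \<le> C * Vnorm (PN N v) * Hnorm (PN N v) * Vnorm (QN N v) + C * Vnorm (QN N v) * Hnorm (QN N v) * Vnorm (PN N v)"
proof -
  let ?p = "PN N v" and ?q = "QN N v"
  have p: "in_DA ?p" and q: "in_DA ?q" using v by (auto intro: in_DA_PN in_DA_QN)
  have V: "in_V v" "in_V ?p" "in_V ?q" and H: "in_H ?q"
    using v p q in_DA_imp_in_V in_DA_imp_in_H by auto
  have 1: "tri v ?q ?q = tri v v ?q - tri v ?p ?q"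
    using tri_diff2[OF v V(1,2) H] by (simp add: QN_def)
  have 2: "tri ?q ?p ?q = tri v ?p ?q - tri ?p ?p ?q"
    using tri_diff1[OF v p V(2) H] by (simp add: QN_def[of N v])
  have 3: "Re (tri ?p ?p ?q) = - Re (tri ?p ?q ?p)"
    using tri_antisym[OF p V(2,3)] by simp
  have "Re (tri v v ?q) = Re (tri ?q ?p ?q) - Re (tri ?p ?q ?p)"
    using 1 2 3 Re_tri_same[OF v V(3)] by simp
  then have "\<bar>Re (tri v v ?q)\<bar> \<le> cmod (tri ?p ?q ?p) + cmod (tri ?q ?p ?q)"
    using abs_Re_le_cmod[of "tri ?q ?p ?q"] abs_Re_le_cmod[of "tri ?p ?q ?p"] by linarith
  then have "\<bar>Re (tri v v ?q)\<bar> * (4 * pi\<^sup>2) \<le> cmod (tri ?p ?q ?p) * (4 * pi\<^sup>2) + cmod (tri ?q ?p ?q) * (4 * pi\<^sup>2)"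
    by (simp add: mult_right_mono flip: distrib_right)
  also have "\<dots> \<le> C * Vnorm ?p * Hnorm ?p * Vnorm ?q + C * Vnorm ?q * Hnorm ?q * Vnorm ?p"
    by (intro add_mono trilinear_ladyzhenskaya Lady C p q V)
  finally show ?thesis .
qed

text \<open>On finitely many modes all norms are comparable. The crude factor
  \<open>card (low N)\<close> is affordable because the bound is applied to the low modes of w,
  which tend to 0.\<close>

lemma l1_PN_le:
  assumes "in_V c"
  shows "(\<lambda>k. kabs k * norm (PN N c k)) summable_on UNIV"
    and "(\<Sum>\<^sub>\<infinity>k. kabs k * norm (PN N c k)) \<le> real (card (low N)) * Vnorm (PN N c)"
    and "(\<Sum>\<^sub>\<infinity>k. norm (PN N c k)) \<le> real (card (low N)) * Vnorm (PN N c)"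
proof -
  let ?p = "PN N c"
  have zero: "?p k = 0" if "k \<notin> low N" for k using that by (simp add: PN_mask mask_def)
  have V: "in_V ?p" using assms by (rule in_V_PN)
  have le: "kabs k * norm (?p k) \<le> Vnorm ?p" for k
  proof -
    have "kabs k * norm (?p k) \<le> l2n (\<lambda>k. kabs k * norm (?p k))"
      using L2_set_le_l2n[OF in_V_l2[OF V], of "{k}"] by (simp add: abs_mult)
    also have "\<dots> \<le> 2 * pi * l2n (\<lambda>k. kabs k * norm (?p k))"
      using pi_gt3 mult_right_mono[of 1 "2 * pi" "l2n (\<lambda>k. kabs k * norm (?p k))"] by simp
    finally show ?thesis by (simp add: Vnorm_l2n)
  qed
  have hs: "((\<lambda>k. f k * norm (?p k)) has_sum (\<Sum>k\<in>low N. f k * norm (?p k))) UNIV" for f :: "int \<times> int \<Rightarrow> real"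
    by (rule has_sum_finite_neutralI[OF finite_low[of N]]) (simp_all add: zero)
  show "(\<lambda>k. kabs k * norm (?p k)) summable_on UNIV"
    by (rule has_sum_imp_summable[OF hs])
  have "(\<Sum>k\<in>low N. kabs k * norm (?p k)) \<le> (\<Sum>k\<in>low N. Vnorm ?p)"
    by (intro sum_mono le)
  then show 1: "(\<Sum>\<^sub>\<infinity>k. kabs k * norm (?p k)) \<le> real (card (low N)) * Vnorm ?p"
    using infsumI[OF hs[of kabs]] by simp
  have "(\<Sum>k\<in>low N. 1 * norm (?p k)) \<le> (\<Sum>k\<in>low N. kabs k * norm (?p k))"
  proof (intro sum_mono mult_right_mono)
    fix k assume "k \<in> low N"
    then show "1 \<le> kabs k" using ksq_ge_1[of k] by (simp add: low_def)
  qed simp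
  then show "(\<Sum>\<^sub>\<infinity>k. norm (?p k)) \<le> real (card (low N)) * Vnorm ?p"
    using infsumI[OF hs[of "\<lambda>_. 1"]] infsumI[OF hs[of kabs]] 1 by simp
qed

text \<open>b(v1,v1,z) - b(v2,v2,z) = b(w,v1,z) + b(v2,w,z). Splitting w = p + z and dropping the
  real part of b(v2,z,z), which is 0, leaves b(z,v1,z), b(p,v1,z) and b(v2,p,z). Only the first does
  not contain the low modes p; the other two are bounded through the l^1 norms of p and of its
  gradient.\<close>

lemma Re_tri_difference_bound:
  assumes Lady: "ladyzhenskaya C"
    and C: "C \<ge> 0" and v1: "in_DA v1" and v2: "in_DA v2"
    and w: "w = (\<lambda>k. v1 k - v2 k)"
    and \<rho>: "\<rho> = real (card (low N)) * Vnorm (PN N w)"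
  shows "\<bar>Re (tri v1 v1 (QN N w)) - Re (tri v2 v2 (QN N w))\<bar> * (4 * pi\<^sup>2)
    \<le> C * Vnorm (QN N w) * Hnorm (QN N w) * Vnorm v1 + \<rho> * (Vnorm v1 * Hnorm (QN N w)) + \<rho> * (Hnorm v2 * Hnorm (QN N w))"
proof -
  let ?p = "PN N w" and ?z = "QN N w"
  have DA: "in_DA w" unfolding w using v1 v2 by (rule in_DA_diff)
  then have p: "in_DA ?p" and z: "in_DA ?z" by (auto intro: in_DA_PN in_DA_QN)
  have V: "in_V v1" "in_V v2" "in_V w" "in_V ?p" "in_V ?z" and H: "in_H ?z"
    using v1 v2 DA p z in_DA_imp_in_V in_DA_imp_in_H by auto
  have 1: "tri w v1 ?z = tri v1 v1 ?z - tri v2 v1 ?z"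
    using tri_diff1[OF v1 v2 V(1) H] by (simp add: w)
  have 2: "tri v2 w ?z = tri v2 v1 ?z - tri v2 v2 ?z"
    using tri_diff2[OF v2 V(1,2) H] by (simp add: w)
  have 3: "tri ?z v1 ?z = tri w v1 ?z - tri ?p v1 ?z"
    using tri_diff1[OF DA p V(1) H] by (simp add: QN_def[of N w])
  have 4: "tri v2 ?z ?z = tri v2 w ?z - tri v2 ?p ?z"
    using tri_diff2[OF v2 V(3,4) H] by (simp add: QN_def[of N w])
  have "Re (tri v1 v1 ?z) - Re (tri v2 v2 ?z) = Re (tri ?z v1 ?z) + Re (tri ?p v1 ?z) + Re (tri v2 ?p ?z)"
    using 1 2 3 4 Re_tri_same[OF v2 V(5)] by simp
  then have "\<bar>Re (tri v1 v1 ?z) - Re (tri v2 v2 ?z)\<bar> \<le> cmod (tri ?z v1 ?z) + cmod (tri ?p v1 ?z) + cmod (tri v2 ?p ?z)"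
    using abs_Re_le_cmod[of "tri ?z v1 ?z"] abs_Re_le_cmod[of "tri ?p v1 ?z"] abs_Re_le_cmod[of "tri v2 ?p ?z"] by linarith
  then have "\<bar>Re (tri v1 v1 ?z) - Re (tri v2 v2 ?z)\<bar> * (4 * pi\<^sup>2)
      \<le> cmod (tri ?z v1 ?z) * (4 * pi\<^sup>2) + cmod (tri ?p v1 ?z) * (4 * pi\<^sup>2) + cmod (tri v2 ?p ?z) * (4 * pi\<^sup>2)"
    by (simp add: mult_right_mono flip: distrib_right)
  also have "\<dots> \<le> C * Vnorm ?z * Hnorm ?z * Vnorm v1 + \<rho> * (Vnorm v1 * Hnorm ?z) + \<rho> * (Hnorm v2 * Hnorm ?z)"
  proof (intro add_mono)
    show "cmod (tri ?z v1 ?z) * (4 * pi\<^sup>2) \<le> C * Vnorm ?z * Hnorm ?z * Vnorm v1"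
      by (intro trilinear_ladyzhenskaya Lady C z V)
    show "cmod (tri ?p v1 ?z) * (4 * pi\<^sup>2) \<le> \<rho> * (Vnorm v1 * Hnorm ?z)"
      using norm_tri_le_l1[OF p V(1) H] mult_right_mono[OF l1_PN_le(3)[OF V(3)], of "Vnorm v1 * Hnorm ?z" N]
      unfolding \<rho> by simp
    show "cmod (tri v2 ?p ?z) * (4 * pi\<^sup>2) \<le> \<rho> * (Hnorm v2 * Hnorm ?z)"
      using norm_tri_le_l1_grad[OF v2 V(4) H l1_PN_le(1)[OF V(3)]]
        mult_right_mono[OF l1_PN_le(2)[OF V(3)], of "Hnorm v2 * Hnorm ?z" N]
      unfolding \<rho> by simp
  qed
  finally show ?thesis .
qed

text \<open>The added term P_N B cancels the nonlinearity on these modes.\<close>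

lemma rhs_low:
  assumes "k \<in> low N"
  shows "rhs \<nu> N g v s k = g s k - cmul (of_real (\<nu> * ksq k)) (v s k)"
  using assms by (simp add: rhs_def PN_mask mask_def Aop_def cmul_def prod_eq_iff)

lemma rhs_high:
  assumes "k \<notin> low N"
  shows "rhs \<nu> N g v s k = g s k - cmul (of_real (\<nu> * ksq k)) (v s k) - Bop (v s) (v s) k"
  using assms by (simp add: rhs_def PN_mask mask_def Aop_def cmul_def prod_eq_iff)

text \<open>Abstract \<open>y\<close> and \<open>\<gamma>\<close> let it serve both a single
  solution with its forcing and the difference with forcing g1 - g2. The V-norm is used because the
  trilinear estimates need the gradient of the low modes.\<close>

lemma low_mode_energy:
  assumes \<nu>: "\<nu> > 0" and y: "\<And>k. has_prim (\<lambda>t. y t k) (\<lambda>t. r t k)"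
    and r: "\<And>t k. t \<ge> 0 \<Longrightarrow> k \<in> low N \<Longrightarrow> r t k = \<gamma> t k - cmul (of_real (\<nu> * ksq k)) (y t k)"
    and \<gamma>: "\<And>t. t \<ge> 0 \<Longrightarrow> in_H (\<gamma> t)"
  obtains h where "has_prim (\<lambda>t. (Vnorm (PN N (y t)))\<^sup>2) h"
    "\<And>t. t \<ge> 0 \<Longrightarrow> h t \<le> - \<nu> * (Vnorm (PN N (y t)))\<^sup>2 + (Hnorm (\<gamma> t))\<^sup>2 / \<nu>"
proof -
  have V: "(Vnorm (PN N c))\<^sup>2 = (\<Sum>k\<in>low N. 4 * pi\<^sup>2 * ksq k * cn2 (c k))" for c
  proof -
    have "((\<lambda>k. ksq k * cn2 (PN N c k)) has_sum (\<Sum>k\<in>low N. ksq k * cn2 (c k))) UNIV"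
      by (rule has_sum_finite_neutralI[OF finite_low[of N]]) (simp_all add: PN_mask cn2_mask)
    then show ?thesis unfolding Vnorm_sq by (simp add: infsumI sum_distrib_left mult.assoc)
  qed
  define h where "h t = (\<Sum>k\<in>low N. 4 * pi\<^sup>2 * ksq k * (2 * Re (cdot (r t k) (y t k))))" for t
  have "has_prim (\<lambda>t. (Vnorm (PN N (y t)))\<^sup>2) h"
    unfolding V h_def[abs_def] by (intro has_prim_sum has_prim_cmult has_prim_cn2 y)
  moreover have "h t \<le> - \<nu> * (Vnorm (PN N (y t)))\<^sup>2 + (Hnorm (\<gamma> t))\<^sup>2 / \<nu>" if t: "t \<ge> 0" for t
  proof -
    have "h t \<le> (\<Sum>k\<in>low N. - \<nu> * (4 * pi\<^sup>2 * ksq k * cn2 (y t k)) + 4 * pi\<^sup>2 / \<nu> * cn2 (\<gamma> t k))"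
      unfolding h_def
    proof (rule sum_mono)
      fix k assume k: "k \<in> low N"
      define s a b where "s = ksq k" and "a = norm (y t k)" and "b = norm (\<gamma> t k)"
      have s: "s \<ge> 1" using ksq_ge_1[of k] k by (simp add: s_def low_def)
      have a: "a \<ge> 0" "b \<ge> 0" by (auto simp: a_def b_def)
      have "Re (cdot (\<gamma> t k) (y t k)) \<le> a * b"
        using complex_Re_le_cmod[of "cdot (\<gamma> t k) (y t k)"] cmod_cdot_le[of "\<gamma> t k" "y t k"]
        by (simp add: a_def b_def mult.commute)
      then have "Re (cdot (r t k) (y t k)) \<le> a * b - \<nu> * s * a\<^sup>2"
        using r[OF t k] by (simp add: cdot_self cn2_eq_norm s_def a_def)
      then have "s * (2 * Re (cdot (r t k) (y t k))) \<le> s * (2 * (a * b - \<nu> * s * a\<^sup>2))"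
        using s by (intro mult_left_mono) auto
      \<comment> \<open>Half of the dissipation 2 \<nu> s^2 a^2 absorbs the forcing by Young's
        inequality; the other half is at least \<nu> s a^2 because s \<ge> 1.\<close>
      also have "\<dots> \<le> - \<nu> * (s * a\<^sup>2) + b\<^sup>2 / \<nu>"
      proof -
        have "0 \<le> (\<nu> * s * a - b)\<^sup>2 / \<nu>" using \<nu> by simp
        also have "\<dots> = \<nu> * s\<^sup>2 * a\<^sup>2 - 2 * s * a * b + b\<^sup>2 / \<nu>"
          using \<nu> by (simp add: power2_eq_square field_simps)
        finally have 1: "2 * s * a * b \<le> \<nu> * s\<^sup>2 * a\<^sup>2 + b\<^sup>2 / \<nu>" by simp
        have "s \<le> s\<^sup>2" using s by (simp add: power2_eq_square)
        then have "\<nu> * (s * a\<^sup>2) \<le> \<nu> * (s\<^sup>2 * a\<^sup>2)"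
          using \<nu> by (intro mult_left_mono mult_right_mono) auto
        then show ?thesis using 1 by (simp add: algebra_simps power2_eq_square)
      qed
      finally have "4 * pi\<^sup>2 * (s * (2 * Re (cdot (r t k) (y t k)))) \<le> 4 * pi\<^sup>2 * (- \<nu> * (s * a\<^sup>2) + b\<^sup>2 / \<nu>)"
        by (intro mult_left_mono) auto
      then show "4 * pi\<^sup>2 * ksq k * (2 * Re (cdot (r t k) (y t k)))
         \<le> - \<nu> * (4 * pi\<^sup>2 * ksq k * cn2 (y t k)) + 4 * pi\<^sup>2 / \<nu> * cn2 (\<gamma> t k)"
        by (simp add: s_def a_def b_def cn2_eq_norm algebra_simps)
    qed
    also have "\<dots> = - \<nu> * (Vnorm (PN N (y t)))\<^sup>2 + 4 * pi\<^sup>2 * (\<Sum>k\<in>low N. cn2 (\<gamma> t k)) / \<nu>"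
      unfolding V sum.distrib by (simp add: sum_distrib_left sum_divide_distrib sum_negf)
    also have "4 * pi\<^sup>2 * (\<Sum>k\<in>low N. cn2 (\<gamma> t k)) \<le> (Hnorm (\<gamma> t))\<^sup>2"
      unfolding Hnorm_sq using \<gamma>[OF t]
      by (intro mult_left_mono finite_sum_le_infsum) (auto simp: in_H_def finite_low)
    then have "- \<nu> * (Vnorm (PN N (y t)))\<^sup>2 + 4 * pi\<^sup>2 * (\<Sum>k\<in>low N. cn2 (\<gamma> t k)) / \<nu>
       \<le> - \<nu> * (Vnorm (PN N (y t)))\<^sup>2 + (Hnorm (\<gamma> t))\<^sup>2 / \<nu>"
      using \<nu> by (simp add: divide_right_mono)
    finally show ?thesis .
  qed
  ultimately show ?thesis using that by blast
qed

text \<open>Infinitely many modewise energy identities are added up by termwise integration, with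
  \<open>D\<close> as majorant. The factor 8 pi^2 is 4 pi^2 from Parseval times 2 from
  differentiating a square.\<close>

lemma high_mode_energy:
  assumes y: "\<And>k. has_prim (\<lambda>t. y t k) (\<lambda>t. r t k)" and H: "\<And>t. t \<ge> 0 \<Longrightarrow> in_H (y t)"
    and D: "\<And>t. t \<ge> 0 \<Longrightarrow> set_integrable lborel {0..t} D"
    and dom: "AE t in lborel. t \<ge> 0 \<longrightarrow> (\<forall>F. finite F \<longrightarrow> (\<Sum>k\<in>F. norm (r t k) * norm (y t k)) \<le> D t)"
  obtains h where "has_prim (\<lambda>t. (Hnorm (QN N (y t)))\<^sup>2) h"
    "AE t in lborel. t \<ge> 0 \<longrightarrow> ((\<lambda>k. 8 * pi\<^sup>2 * Re (cdot (r t k) (QN N (y t) k))) has_sum h t) UNIV"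
proof -
  have sum: "((\<lambda>k. 4 * pi\<^sup>2 * cn2 (y t k)) has_sum (Hnorm (QN N (y t)))\<^sup>2) (- low N)" if "t \<ge> 0" for t
  proof -
    have "((\<lambda>k. cn2 (QN N (y t) k)) has_sum (\<Sum>\<^sub>\<infinity>k. cn2 (QN N (y t) k))) UNIV"
      using in_H_QN[OF H[OF that], of N] by (intro has_sum_infsum) (simp add: in_H_def)
    then have "((\<lambda>k. cn2 (y t k)) has_sum (\<Sum>\<^sub>\<infinity>k. cn2 (QN N (y t) k))) (- low N)"
      by (rule has_sum_cong_neutral[THEN iffD1, rotated -1]) (auto simp: QN_mask cn2_mask)
    then show ?thesis unfolding Hnorm_sq by (rule has_sum_cmult_right)
  qed
  obtain h where h: "has_prim (\<lambda>t. (Hnorm (QN N (y t)))\<^sup>2) h"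
    "AE t in lborel. t \<ge> 0 \<longrightarrow> ((\<lambda>k. 4 * pi\<^sup>2 * (2 * Re (cdot (r t k) (y t k)))) has_sum h t) (- low N)"
  proof (rule has_prim_infsum[of "- low N" "\<lambda>k t. 4 * pi\<^sup>2 * cn2 (y t k)" "\<lambda>k t. 4 * pi\<^sup>2 * (2 * Re (cdot (r t k) (y t k)))"
        "\<lambda>t. (Hnorm (QN N (y t)))\<^sup>2" "\<lambda>t. 8 * pi\<^sup>2 * D t"])
    show "has_prim (\<lambda>t. 4 * pi\<^sup>2 * cn2 (y t k)) (\<lambda>t. 4 * pi\<^sup>2 * (2 * Re (cdot (r t k) (y t k))))" for k
      by (intro has_prim_cmult has_prim_cn2 y)
    show "set_integrable lborel {0..t} (\<lambda>t. 8 * pi\<^sup>2 * D t)" if "t \<ge> 0" for t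
      using D[OF that] by simp
    show "AE t in lborel. t \<ge> 0 \<longrightarrow> (\<forall>I. finite I \<longrightarrow> I \<subseteq> - low N \<longrightarrow>
        (\<Sum>k\<in>I. \<bar>4 * pi\<^sup>2 * (2 * Re (cdot (r t k) (y t k)))\<bar>) \<le> 8 * pi\<^sup>2 * D t)"
      using dom
    proof (eventually_elim, intro impI allI)
      fix t :: real and I :: "(int \<times> int) set"
      assume *: "t \<ge> 0 \<longrightarrow> (\<forall>F. finite F \<longrightarrow> (\<Sum>k\<in>F. norm (r t k) * norm (y t k)) \<le> D t)" and "t \<ge> 0" "finite I"
      have "(\<Sum>k\<in>I. \<bar>4 * pi\<^sup>2 * (2 * Re (cdot (r t k) (y t k)))\<bar>) \<le> (\<Sum>k\<in>I. 8 * pi\<^sup>2 * (norm (r t k) * norm (y t k)))"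
      proof (rule sum_mono)
        fix k
        have "\<bar>Re (cdot (r t k) (y t k))\<bar> \<le> norm (r t k) * norm (y t k)"
          using abs_Re_le_cmod cmod_cdot_le order_trans by blast
        then show "\<bar>4 * pi\<^sup>2 * (2 * Re (cdot (r t k) (y t k)))\<bar> \<le> 8 * pi\<^sup>2 * (norm (r t k) * norm (y t k))"
          by (simp add: abs_mult)
      qed
      also have "\<dots> \<le> 8 * pi\<^sup>2 * D t"
        unfolding sum_distrib_left[symmetric] using * \<open>t \<ge> 0\<close> \<open>finite I\<close> by (intro mult_left_mono) auto
      finally show "(\<Sum>k\<in>I. \<bar>4 * pi\<^sup>2 * (2 * Re (cdot (r t k) (y t k)))\<bar>) \<le> 8 * pi\<^sup>2 * D t" .
    qed
  qed (use sum in blast)+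
  have "AE t in lborel. t \<ge> 0 \<longrightarrow> ((\<lambda>k. 8 * pi\<^sup>2 * Re (cdot (r t k) (QN N (y t) k))) has_sum h t) UNIV"
    using h(2)
  proof eventually_elim
    case (elim t)
    have "((\<lambda>k. 8 * pi\<^sup>2 * Re (cdot (r t k) (QN N (y t) k))) has_sum h t) UNIV
       \<longleftrightarrow> ((\<lambda>k. 4 * pi\<^sup>2 * (2 * Re (cdot (r t k) (y t k)))) has_sum h t) (- low N)"
      by (rule has_sum_cong_neutral) (auto simp: QN_mask mask_def)
    then show ?case using elim by simp
  qed
  then show ?thesis using that h(1) by blast
qed

text \<open>Since \<open>K\<close> serves all starting times, the Gronwall bound can be restarted
  once \<open>b\<close> has become small; the value at the restart decays exponentially, and the
  remainder is proportional to the bound on \<open>b\<close>.\<close>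

lemma gronwall_tendsto_0:
  fixes Y h a b :: "real \<Rightarrow> real"
  assumes Y: "has_prim Y h" and Ynn: "\<And>t. Y t \<ge> 0"
    and a: "continuous_on {0..} a" and A: "has_prim A a" and \<alpha>: "\<alpha> > 0" and s0: "s0 \<ge> 0"
    and h: "AE t in lborel. s0 \<le> t \<longrightarrow> h t \<le> - a t * Y t + b t"
    and b: "(b \<longlongrightarrow> 0) at_top"
    and avg: "\<And>r t. s0 \<le> r \<Longrightarrow> r \<le> t \<Longrightarrow> A t - A r \<ge> \<alpha> * (t - r) - K"
  shows "(Y \<longlongrightarrow> 0) at_top"
proof (rule order_tendstoI)
  fix e :: real assume "e < 0"
  then show "\<forall>\<^sub>F t in at_top. e < Y t"
    using Ynn by (intro always_eventually allI) (meson order_less_le_trans)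
next
  fix e :: real assume e: "0 < e"
  \<comment> \<open>Chosen so that the residual \<beta> exp K / \<alpha> of the Gronwall bound
    equals e / 2.\<close>
  define \<beta> where "\<beta> = e * \<alpha> * exp (- K) / 2"
  have \<beta>: "\<beta> > 0" using e \<alpha> by (simp add: \<beta>_def)
  then have "\<forall>\<^sub>F t in at_top. b t < \<beta>" using b by (rule order_tendstoD(2)[rotated])
  then obtain s1 where s1: "\<And>t. t \<ge> s1 \<Longrightarrow> b t < \<beta>" by (auto simp: eventually_at_top_linorder)
  define s where "s = max s0 s1"
  have s: "s \<ge> 0" "s \<ge> s0" "s \<ge> s1" using s0 by (auto simp: s_def)
  have bound: "Y t \<le> exp (K - \<alpha> * (t - s)) * Y s + \<beta> * exp K / \<alpha>" if "t \<ge> s" for t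
  proof (rule gronwall_average[OF Y a A s(1) that \<alpha> _ Ynn])
    show "AE r in lborel. s \<le> r \<longrightarrow> r \<le> t \<longrightarrow> h r \<le> - a r * Y r + \<beta>"
      using h
    proof (eventually_elim, intro impI)
      fix r assume *: "s0 \<le> r \<longrightarrow> h r \<le> - a r * Y r + b r" and r: "s \<le> r" "r \<le> t"
      then have "h r \<le> - a r * Y r + b r" using s by simp
      moreover have "b r < \<beta>" using s1[of r] s r by linarith
      ultimately show "h r \<le> - a r * Y r + \<beta>" by linarith
    qed
  qed (use \<beta> s avg in auto)
  have be: "\<beta> * exp K / \<alpha> = e / 2"
    using \<alpha> by (simp add: \<beta>_def exp_minus field_simps)
  have lim: "((\<lambda>t. exp (K - \<alpha> * (t - s)) * Y s) \<longlongrightarrow> 0) at_top"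
  proof -
    have "filterlim (\<lambda>t. \<alpha> * t) at_top at_top"
      using \<alpha> by (intro filterlim_tendsto_pos_mult_at_top[OF tendsto_const]) (auto intro: filterlim_ident)
    then have "filterlim (\<lambda>t. - (K + \<alpha> * s) + \<alpha> * t) at_top at_top"
      by (intro filterlim_tendsto_add_at_top[OF tendsto_const])
    then have "filterlim (\<lambda>t. - (- (K + \<alpha> * s) + \<alpha> * t)) at_bot at_top"
      by (rule filterlim_uminus_at_top[THEN iffD1])
    then have "filterlim (\<lambda>t. K - \<alpha> * (t - s)) at_bot at_top"
      by (simp add: algebra_simps)
    then have "((\<lambda>t. exp (K - \<alpha> * (t - s))) \<longlongrightarrow> 0) at_top"
      by (rule filterlim_compose[OF exp_at_bot])
    then show ?thesis by (rule tendsto_mult_left_zero)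
  qed
  then have "\<forall>\<^sub>F t in at_top. exp (K - \<alpha> * (t - s)) * Y s < e / 2"
    using e by (intro order_tendstoD(2)) auto
  then show "\<forall>\<^sub>F t in at_top. Y t < e"
    using eventually_ge_at_top[of s]
  proof eventually_elim
    case (elim t)
    then show ?case using bound[of t] be by linarith
  qed
qed

section \<open>Regularity of strong solutions and integrable majorants\<close>

lemma is_solution_has_prim:
  assumes "is_solution \<nu> N g v0 v"
  shows "has_prim (\<lambda>t. v t k) (\<lambda>s. rhs \<nu> N g v s k)"
  unfolding has_prim_def
proof (intro allI impI)
  fix t :: real assume "t \<ge> 0"
  have "v 0 = v0" using assms unfolding is_solution_def by blast
  moreover have "\<forall>k. \<forall>t\<ge>0. set_integrable lborel {0..t} (\<lambda>s. rhs \<nu> N g v s k)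
      \<and> v t k = v0 k + (LINT s:{0..t}|lborel. rhs \<nu> N g v s k)"
    using assms unfolding is_solution_def by (elim conjE)
  ultimately show "set_integrable lborel {0..t} (\<lambda>s. rhs \<nu> N g v s k)
      \<and> v t k = v 0 k + (LINT s:{0..t}|lborel. rhs \<nu> N g v s k)"
    using \<open>t \<ge> 0\<close> by blast
qed

lemma is_solution_in_V: "is_solution \<nu> N g v0 v \<Longrightarrow> t \<ge> 0 \<Longrightarrow> in_V (v t)"
  unfolding is_solution_def by blast

lemma is_solution_continuous_Vnorm:
  assumes "is_solution \<nu> N g v0 v"
  shows "continuous_on {0..} (\<lambda>t. Vnorm (v t))"
  unfolding continuous_on_iff
proof (intro ballI allI impI)
  fix t e :: real assume t: "t \<in> {0..}" and e: "e > 0"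
  have "\<forall>t\<ge>0. \<forall>\<epsilon>>0. \<exists>\<delta>>0. \<forall>s\<ge>0. \<bar>s - t\<bar> < \<delta> \<longrightarrow> Vnorm (\<lambda>k. v s k - v t k) < \<epsilon>"
    using assms unfolding is_solution_def by (elim conjE)
  then obtain d where d: "d > 0" "\<And>s. s \<ge> 0 \<Longrightarrow> \<bar>s - t\<bar> < d \<Longrightarrow> Vnorm (\<lambda>k. v s k - v t k) < e"
    using t e by (meson atLeast_iff)
  show "\<exists>d>0. \<forall>s\<in>{0..}. dist s t < d \<longrightarrow> dist (Vnorm (v s)) (Vnorm (v t)) < e"
  proof (intro exI[of _ d] conjI ballI impI d(1))
    fix s assume s: "s \<in> {0..}" "dist s t < d"
    have "\<bar>Vnorm (v s) - Vnorm (v t)\<bar> \<le> Vnorm (\<lambda>k. v s k - v t k)"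
      using s t by (intro Vnorm_triangle is_solution_in_V[OF assms]) auto
    also have "\<dots> < e" using s d(2)[of s] by (simp add: dist_real_def)
    finally show "dist (Vnorm (v s)) (Vnorm (v t)) < e" by (simp add: dist_real_def)
  qed
qed

lemma is_solution_AE_in_DA:
  assumes "is_solution \<nu> N g v0 v"
  shows "AE t in lborel. t \<ge> 0 \<longrightarrow> in_DA (v t)"
proof -
  have T: "\<forall>T\<ge>0. (AE t in lborel. t \<in> {0..T} \<longrightarrow> in_DA (v t)) \<and> set_integrable lborel {0..T} (\<lambda>t. (Anorm (v t))\<^sup>2)"
    using assms unfolding is_solution_def by (elim conjE)
  have "AE t in lborel. \<forall>n::nat. t \<in> {0..real n} \<longrightarrow> in_DA (v t)"
    unfolding AE_all_countable using T by (metis of_nat_0_le_iff)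
  then show ?thesis
  proof eventually_elim
    case (elim t)
    show ?case
    proof
      assume "t \<ge> 0"
      moreover obtain n :: nat where "t \<le> real n" using real_arch_simple by blast
      ultimately show "in_DA (v t)" using elim by auto
    qed
  qed
qed

lemma is_solution_Anorm_integrable:
  assumes "is_solution \<nu> N g v0 v" "T \<ge> 0"
  shows "set_integrable lborel {0..T} (\<lambda>t. (Anorm (v t))\<^sup>2)"
proof -
  have "\<forall>T\<ge>0. (AE t in lborel. t \<in> {0..T} \<longrightarrow> in_DA (v t)) \<and> set_integrable lborel {0..T} (\<lambda>t. (Anorm (v t))\<^sup>2)"
    using assms(1) unfolding is_solution_def by (elim conjE)
  then show ?thesis using assms(2) by blast
qed

lemma set_integrable_continuous_mult:
  fixes f \<kappa> :: "real \<Rightarrow> real"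
  assumes \<kappa>: "continuous_on {a..b} \<kappa>" and f: "set_integrable lborel {a..b} f"
  shows "set_integrable lborel {a..b} (\<lambda>t. \<kappa> t * f t)"
proof -
  have "compact (\<kappa> ` {a..b})" using \<kappa> by (rule compact_continuous_image) simp
  then have "bounded (\<kappa> ` {a..b})" by (rule compact_imp_bounded)
  then obtain M where "\<forall>x\<in>\<kappa> ` {a..b}. \<bar>x\<bar> \<le> M"
    unfolding bounded_real ..
  then have M: "\<bar>\<kappa> t\<bar> \<le> M" if "t \<in> {a..b}" for t
    using that by simp
  have [measurable]: "(\<lambda>t. indicator {a..b} t *\<^sub>R \<kappa> t) \<in> borel_measurable borel"
    using \<kappa> by (intro borel_measurable_continuous_on_indicator) auto
  have [measurable]: "(\<lambda>t. indicator {a..b} t *\<^sub>R f t) \<in> borel_measurable borel"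
    using f by (auto simp: set_integrable_def dest: borel_measurable_integrable)
  show ?thesis
  proof (rule set_integrable_bound)
    show "set_integrable lborel {a..b} (\<lambda>t. M * f t)" using f by simp
    have "(\<lambda>t. indicator {a..b} t *\<^sub>R (\<kappa> t * f t)) = (\<lambda>t. (indicator {a..b} t *\<^sub>R \<kappa> t) * (indicator {a..b} t *\<^sub>R f t))"
      by (auto simp: indicator_def)
    then show "set_borel_measurable lborel {a..b} (\<lambda>t. \<kappa> t * f t)"
      unfolding set_borel_measurable_def by (simp only:) measurable
    show "AE t in lborel. t \<in> {a..b} \<longrightarrow> norm (\<kappa> t * f t) \<le> norm (M * f t)"
    proof (intro AE_I2 impI)
      fix t assume "t \<in> {a..b}"
      then have "\<bar>\<kappa> t\<bar> \<le> \<bar>M\<bar>" using M by fastforce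
      then show "norm (\<kappa> t * f t) \<le> norm (M * f t)" by (simp add: abs_mult mult_right_mono)
    qed
  qed
qed

text \<open>Supplies the majorant for termwise integration. Only integrability in time is at stake,
  so the constants are generous; what matters is that \<open>Anorm\<close> enters linearly.\<close>

lemma rhs_sum_le:
  assumes \<nu>: "\<nu> \<ge> 0" and v: "in_DA (v s)" and g: "in_H (g s)" and y: "in_H y" and F: "finite F"
  shows "(\<Sum>k\<in>F. norm (rhs \<nu> N g v s k) * norm (y k))
    \<le> (\<nu> * Anorm (v s) + Hnorm (g s) + 4 * (cA * Anorm (v s) * Vnorm (v s))) * Hnorm y"
proof -
  have V: "in_V (v s)" using v by (rule in_DA_imp_in_V)
  have le: "norm (rhs \<nu> N g v s k) \<le> \<nu> * (ksq k * norm (v s k)) + norm (g s k) + norm (Bop (v s) (v s) k)" for k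
  proof -
    have "norm (rhs \<nu> N g v s k) \<le> norm (g s k) + norm (cmul (of_real (\<nu> * ksq k)) (v s k)) + norm (Bop (v s) (v s) k)"
    proof (cases "k \<in> low N")
      case True
      show ?thesis unfolding rhs_low[OF True]
        using norm_triangle_ineq4[of "g s k" "cmul (of_real (\<nu> * ksq k)) (v s k)"] norm_ge_zero[of "Bop (v s) (v s) k"] by linarith
    next
      case False
      show ?thesis unfolding rhs_high[OF False]
        using norm_triangle_ineq4[of "g s k" "cmul (of_real (\<nu> * ksq k)) (v s k)"]
          norm_triangle_ineq4[of "g s k - cmul (of_real (\<nu> * ksq k)) (v s k)" "Bop (v s) (v s) k"] by linarith
    qed
    then show ?thesis using \<nu> by (simp add: norm_cmul norm_mult mult.assoc)
  qed
  have fin: "(\<Sum>k\<in>F. a k * b k) * (4 * pi\<^sup>2) \<le> (2 * pi * l2n a) * (2 * pi * l2n b)"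
    if "(\<lambda>k. (a k)\<^sup>2) summable_on UNIV" "(\<lambda>k. (b k)\<^sup>2) summable_on UNIV" for a b :: "int \<times> int \<Rightarrow> real"
  proof -
    have "(\<Sum>k\<in>F. a k * b k) \<le> (\<Sum>k\<in>F. \<bar>a k * b k\<bar>)" by (intro sum_mono) simp
    also have "\<dots> \<le> (\<Sum>\<^sub>\<infinity>k. \<bar>a k * b k\<bar>)"
      by (intro finite_sum_le_infsum l2_cauchy_schwarz that F) auto
    also have "\<dots> \<le> l2n a * l2n b" by (rule l2_cauchy_schwarz(2)[OF that])
    finally show ?thesis using pi_gt_zero by (simp add: power2_eq_square mult_ac)
  qed
  have "(\<Sum>k\<in>F. norm (rhs \<nu> N g v s k) * norm (y k))
     \<le> (\<Sum>k\<in>F. (\<nu> * (ksq k * norm (v s k)) + norm (g s k) + norm (Bop (v s) (v s) k)) * norm (y k))"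
    by (intro sum_mono mult_right_mono le) simp
  also have "\<dots> = \<nu> * (\<Sum>k\<in>F. (ksq k * norm (v s k)) * norm (y k)) + (\<Sum>k\<in>F. norm (g s k) * norm (y k))
      + (\<Sum>k\<in>F. norm (Bop (v s) (v s) k) * norm (y k))"
    by (simp add: sum_distrib_left sum.distrib distrib_right mult.assoc)
  finally have *: "(\<Sum>k\<in>F. norm (rhs \<nu> N g v s k) * norm (y k)) \<le> \<dots>" .
  have 1: "\<nu> * (\<Sum>k\<in>F. (ksq k * norm (v s k)) * norm (y k)) * (4 * pi\<^sup>2) \<le> \<nu> * Anorm (v s) * Hnorm y"
    using mult_left_mono[OF fin[OF in_DA_l2[OF v] in_H_l2[OF y]] \<nu>] by (simp add: Anorm_l2n Hnorm_l2n mult.assoc)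
  have 2: "(\<Sum>k\<in>F. norm (g s k) * norm (y k)) * (4 * pi\<^sup>2) \<le> Hnorm (g s) * Hnorm y"
    using fin[OF in_H_l2[OF g] in_H_l2[OF y]] by (simp add: Hnorm_l2n)
  note 3 = Bop_sum_le[OF v V y F]
  \<comment> \<open>The bounds 1, 2 and 3 carry the Parseval factor 4 pi^2 on the left; as it
    exceeds 1, inserting it only enlarges a nonnegative sum.\<close>
  have "(\<Sum>k\<in>F. norm (rhs \<nu> N g v s k) * norm (y k)) \<le> (\<Sum>k\<in>F. norm (rhs \<nu> N g v s k) * norm (y k)) * (4 * pi\<^sup>2)"
  proof -
    have "1 \<le> pi\<^sup>2" using pi_gt3 by (intro one_le_power) simp
    then have "1 \<le> 4 * pi\<^sup>2" by linarith
    then show ?thesis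
      using mult_left_mono[of 1 "4 * pi\<^sup>2" "\<Sum>k\<in>F. norm (rhs \<nu> N g v s k) * norm (y k)"]
      by (simp add: sum_nonneg)
  qed
  also have "\<dots> \<le> \<nu> * Anorm (v s) * Hnorm y + Hnorm (g s) * Hnorm y + 2 * (cA * Anorm (v s) * (Vnorm (v s) * Hnorm y))"
  proof -
    have "(\<Sum>k\<in>F. norm (rhs \<nu> N g v s k) * norm (y k)) * (4 * pi\<^sup>2)
      \<le> (\<nu> * (\<Sum>k\<in>F. (ksq k * norm (v s k)) * norm (y k)) + (\<Sum>k\<in>F. norm (g s k) * norm (y k))
        + (\<Sum>k\<in>F. norm (Bop (v s) (v s) k) * norm (y k))) * (4 * pi\<^sup>2)"
      by (intro mult_right_mono *) simp
    then show ?thesis using 1 2 3 unfolding distrib_right by linarith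
  qed
  also have "\<dots> \<le> (\<nu> * Anorm (v s) + Hnorm (g s) + 4 * (cA * Anorm (v s) * Vnorm (v s))) * Hnorm y"
  proof -
    have "0 \<le> cA * Anorm (v s) * (Vnorm (v s) * Hnorm y)" by (simp add: cA_def)
    then show ?thesis by (simp add: algebra_simps)
  qed
  finally show ?thesis .
qed

text \<open>The test field \<open>y\<close> need not be \<open>v\<close>: for the difference, each
  right-hand side is tested with w. The majorant is a continuous function times 1 + |A v|^2, which
  is locally integrable; a continuous bound \<open>\<kappa>\<close> in place of the norm of
  \<open>y\<close> itself makes its measurability immediate.\<close>

lemma is_solution_dominated:
  assumes \<nu>: "\<nu> \<ge> 0" and sol: "is_solution \<nu> N g v0 v" and g: "Linf_H g"
    and y: "\<And>t. t \<ge> 0 \<Longrightarrow> in_H (y t)" and \<kappa>: "continuous_on {0..} \<kappa>" "\<And>t. t \<ge> 0 \<Longrightarrow> Hnorm (y t) \<le> \<kappa> t"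
  obtains D where "\<And>t. t \<ge> 0 \<Longrightarrow> set_integrable lborel {0..t} D"
    "AE t in lborel. t \<ge> 0 \<longrightarrow> (\<forall>F. finite F \<longrightarrow> (\<Sum>k\<in>F. norm (rhs \<nu> N g v t k) * norm (y t k)) \<le> D t)"
proof -
  obtain M where M: "\<And>t. t \<ge> 0 \<Longrightarrow> Hnorm (g t) \<le> M" and gH: "\<And>t. t \<ge> 0 \<Longrightarrow> in_H (g t)"
    using g unfolding Linf_H_def by blast
  have M0: "M \<ge> 0" using M[of 0] Hnorm_nonneg[of "g 0"] by linarith
  define K where "K t = (\<nu> + M + 4 * cA * Vnorm (v t)) * \<kappa> t" for t
  define D where "D t = K t * (1 + (Anorm (v t))\<^sup>2)" for t
  have K: "continuous_on {0..} K"
    unfolding K_def[abs_def] by (intro continuous_intros is_solution_continuous_Vnorm[OF sol] \<kappa>(1))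
  show ?thesis
  proof (rule that[of D])
    fix t :: real assume t: "t \<ge> 0"
    have "set_integrable lborel {0..t} (\<lambda>t. 1 + (Anorm (v t))\<^sup>2)"
      by (rule set_integral_add(1)[OF borel_integrable_atLeastAtMost'[OF continuous_on_const] is_solution_Anorm_integrable[OF sol t]])
    from set_integrable_continuous_mult[OF continuous_on_subset[OF K] this]
    show "set_integrable lborel {0..t} D"
      unfolding D_def[abs_def] by auto
  next
    show "AE t in lborel. t \<ge> 0 \<longrightarrow> (\<forall>F. finite F \<longrightarrow> (\<Sum>k\<in>F. norm (rhs \<nu> N g v t k) * norm (y t k)) \<le> D t)"
      using is_solution_AE_in_DA[OF sol]
    proof (eventually_elim, intro impI allI)
      fix t :: real and F :: "(int \<times> int) set"
      assume *: "t \<ge> 0 \<longrightarrow> in_DA (v t)" and t: "t \<ge> 0" and F: "finite F"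
      define a where "a = Anorm (v t)"
      have a0: "a \<ge> 0" by (simp add: a_def)
      have "2 * 1 * a \<le> 1\<^sup>2 + a\<^sup>2" by (rule sum_squares_bound)
      then have a: "a \<le> 1 + a\<^sup>2" "1 \<le> 1 + a\<^sup>2" using a0 by simp_all
      have cA: "cA \<ge> 0" by (simp add: cA_def)
      have "(\<Sum>k\<in>F. norm (rhs \<nu> N g v t k) * norm (y t k)) \<le> (\<nu> * a + Hnorm (g t) + 4 * (cA * a * Vnorm (v t))) * Hnorm (y t)"
        unfolding a_def using * t by (intro rhs_sum_le \<nu> gH y F) auto
      also have "\<dots> \<le> ((\<nu> + M + 4 * cA * Vnorm (v t)) * (1 + a\<^sup>2)) * \<kappa> t"
      proof (rule mult_mono)
        have "\<nu> * a \<le> \<nu> * (1 + a\<^sup>2)" using \<nu> a by (intro mult_left_mono)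
        moreover have "Hnorm (g t) \<le> M * (1 + a\<^sup>2)"
          using M[OF t] mult_left_mono[OF a(2) M0] by simp
        moreover have "4 * cA * Vnorm (v t) * a \<le> 4 * cA * Vnorm (v t) * (1 + a\<^sup>2)"
          using a cA by (intro mult_left_mono) auto
        ultimately show "\<nu> * a + Hnorm (g t) + 4 * (cA * a * Vnorm (v t)) \<le> (\<nu> + M + 4 * cA * Vnorm (v t)) * (1 + a\<^sup>2)"
          by (simp add: algebra_simps)
        show "0 \<le> (\<nu> + M + 4 * cA * Vnorm (v t)) * (1 + a\<^sup>2)"
          using \<nu> M0 cA by (intro mult_nonneg_nonneg add_nonneg_nonneg) auto
      qed (use \<kappa>(2)[OF t] in auto)
      finally show "(\<Sum>k\<in>F. norm (rhs \<nu> N g v t k) * norm (y t k)) \<le> D t"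
        by (simp add: D_def K_def a_def mult_ac)
    qed
  qed
qed

text \<open>At one fixed time, the sum for the energy derivative splits into forcing, dissipation
  and nonlinearity, and uniqueness of sums identifies it. The term \<open>b\<close> is abstract so
  as to cover B(v,v) and a difference of two such terms; 8 pi^2 \<beta> is twice its inner product
  with the high modes.\<close>

lemma high_mode_balance:
  assumes r: "\<And>k. k \<notin> low N \<Longrightarrow> r k = \<gamma> k - cmul (of_real (\<nu> * ksq k)) (y k) - b k"
    and y: "in_V y" and \<gamma>: "in_H \<gamma>" and b: "((\<lambda>k. Re (cdot (b k) (QN N y k))) has_sum \<beta>) UNIV"
    and h: "((\<lambda>k. 8 * pi\<^sup>2 * Re (cdot (r k) (QN N y k))) has_sum h) UNIV"
  shows "h \<le> - 2 * \<nu> * (Vnorm (QN N y))\<^sup>2 + 2 * Hnorm \<gamma> * Hnorm (QN N y) - 8 * pi\<^sup>2 * \<beta>"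
proof -
  let ?q = "QN N y"
  have q: "in_V ?q" using y by (rule in_V_QN)
  obtain c where c: "((\<lambda>k. Re (cdot (\<gamma> k) (?q k))) has_sum c) UNIV" "\<bar>c\<bar> * (4 * pi\<^sup>2) \<le> Hnorm \<gamma> * Hnorm ?q"
    using H_inner_has_sum[OF \<gamma> in_V_imp_in_H[OF q]] by blast
  have s: "((\<lambda>k. ksq k * cn2 (?q k)) has_sum (\<Sum>\<^sub>\<infinity>k. ksq k * cn2 (?q k))) UNIV"
    using q by (intro has_sum_infsum) (simp add: in_V_def)
  have "((\<lambda>k. 8 * pi\<^sup>2 * (Re (cdot (\<gamma> k) (?q k)) + (- \<nu>) * (ksq k * cn2 (?q k)) + (- 1) * Re (cdot (b k) (?q k))))
     has_sum 8 * pi\<^sup>2 * (c + (- \<nu>) * (\<Sum>\<^sub>\<infinity>k. ksq k * cn2 (?q k)) + (- 1) * \<beta>)) UNIV"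
    by (intro has_sum_cmult_right has_sum_add c s b)
  moreover have "Re (cdot (\<gamma> k) (?q k)) + (- \<nu>) * (ksq k * cn2 (?q k)) + (- 1) * Re (cdot (b k) (?q k)) = Re (cdot (r k) (?q k))" for k
  proof (cases "k \<in> low N")
    case True
    then show ?thesis by (simp add: QN_mask mask_def cn2_def)
  next
    case False
    then have "?q k = y k" by (simp add: QN_mask mask_def)
    then show ?thesis by (simp add: r[OF False] cdot_self)
  qed
  ultimately have "((\<lambda>k. 8 * pi\<^sup>2 * Re (cdot (r k) (?q k)))
     has_sum 8 * pi\<^sup>2 * (c + (- \<nu>) * (\<Sum>\<^sub>\<infinity>k. ksq k * cn2 (?q k)) + (- 1) * \<beta>)) UNIV"
    by (simp only:)
  then have "h = 8 * pi\<^sup>2 * (c + (- \<nu>) * (\<Sum>\<^sub>\<infinity>k. ksq k * cn2 (?q k)) + (- 1) * \<beta>)"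
    using h has_sum_unique by blast
  also have "\<dots> = 2 * (c * (4 * pi\<^sup>2)) - 2 * \<nu> * (Vnorm ?q)\<^sup>2 - 8 * pi\<^sup>2 * \<beta>"
    by (simp add: Vnorm_sq algebra_simps)
  also have "c * (4 * pi\<^sup>2) \<le> \<bar>c\<bar> * (4 * pi\<^sup>2)"
    by (intro mult_right_mono) auto
  also note c(2)
  finally show ?thesis by simp
qed

section \<open>Synchronization\<close>

text \<open>Gronwall gives the squared bound (\<nu> M)^2 plus an exponentially small transient. The
  gap between (\<nu> M)^2 and (\<nu> G)^2 absorbs the transient from some time on.\<close>

lemma is_solution_low_bound:
  assumes \<nu>: "\<nu> > 0" and sol: "is_solution \<nu> N g v0 v" and g: "Linf_H g"
    and M: "\<And>t. t \<ge> 0 \<Longrightarrow> Hnorm (g t) \<le> \<nu>\<^sup>2 * M" and G: "M < G" "0 \<le> M"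
  obtains t0 where "t0 \<ge> 0" "\<And>t. t \<ge> t0 \<Longrightarrow> Vnorm (PN N (v t)) \<le> \<nu> * G"
proof -
  let ?X = "\<lambda>t. (Vnorm (PN N (v t)))\<^sup>2"
  have gH: "\<And>t. t \<ge> 0 \<Longrightarrow> in_H (g t)" using g unfolding Linf_H_def by blast
  obtain h where h: "has_prim ?X h" "\<And>t. t \<ge> 0 \<Longrightarrow> h t \<le> - \<nu> * ?X t + (Hnorm (g t))\<^sup>2 / \<nu>"
    using low_mode_energy[OF \<nu> is_solution_has_prim[OF sol] rhs_low gH] by blast
  have bound: "?X t \<le> exp (0 - \<nu> * (t - 0)) * ?X 0 + (\<nu>\<^sup>2 * M)\<^sup>2 / \<nu> * exp 0 / \<nu>" if "t \<ge> 0" for t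
  proof (rule gronwall_average[OF h(1) continuous_on_const has_prim_linear order_refl that \<nu>])
    show "AE r in lborel. 0 \<le> r \<longrightarrow> r \<le> t \<longrightarrow> h r \<le> - \<nu> * ?X r + (\<nu>\<^sup>2 * M)\<^sup>2 / \<nu>"
    proof (intro AE_I2 impI)
      fix r :: real assume "0 \<le> r"
      have "(Hnorm (g r))\<^sup>2 / \<nu> \<le> (\<nu>\<^sup>2 * M)\<^sup>2 / \<nu>"
        using \<nu> M[OF \<open>0 \<le> r\<close>] by (intro divide_right_mono power_mono) auto
      then show "h r \<le> - \<nu> * ?X r + (\<nu>\<^sup>2 * M)\<^sup>2 / \<nu>" using h(2)[OF \<open>0 \<le> r\<close>] by linarith
    qed
  qed (use \<nu> in \<open>auto simp: algebra_simps\<close>)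
  have "((\<lambda>t. exp (- \<nu> * t)) \<longlongrightarrow> 0) at_top"
  proof -
    have "filterlim (\<lambda>t. \<nu> * t) at_top at_top"
      using \<nu> by (intro filterlim_tendsto_pos_mult_at_top[OF tendsto_const]) (auto intro: filterlim_ident)
    then have "filterlim (\<lambda>t. - \<nu> * t) at_bot at_top"
      by (simp add: filterlim_uminus_at_top)
    then show ?thesis by (rule filterlim_compose[OF exp_at_bot])
  qed
  then have "((\<lambda>t. exp (- \<nu> * t) * ?X 0) \<longlongrightarrow> 0) at_top" by (rule tendsto_mult_left_zero)
  moreover have "0 < \<nu>\<^sup>2 * (G\<^sup>2 - M\<^sup>2)"
    using \<nu> G power_strict_mono[of M G 2] by simp
  ultimately have "\<forall>\<^sub>F t in at_top. exp (- \<nu> * t) * ?X 0 < \<nu>\<^sup>2 * (G\<^sup>2 - M\<^sup>2)"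
    by (rule order_tendstoD(2))
  then obtain t1 where t1: "\<And>t. t \<ge> t1 \<Longrightarrow> exp (- \<nu> * t) * ?X 0 < \<nu>\<^sup>2 * (G\<^sup>2 - M\<^sup>2)"
    by (auto simp: eventually_at_top_linorder)
  show ?thesis
  proof (rule that[of "max 0 t1"])
    fix t assume t: "t \<ge> max 0 t1"
    have "(\<nu>\<^sup>2 * M)\<^sup>2 / \<nu> * exp 0 / \<nu> = \<nu>\<^sup>2 * M\<^sup>2"
      using \<nu> by (simp add: power2_eq_square)
    then have "?X t \<le> (\<nu> * G)\<^sup>2"
      using bound[of t] t1[of t] t by (simp add: power_mult_distrib algebra_simps)
    then show "Vnorm (PN N (v t)) \<le> \<nu> * G"
      by (rule power2_le_imp_le) (use \<nu> G in simp)
  qed simp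
qed

text \<open>Here x and Hq are the V- and H-norms of the high modes, Vp and Hp those of the low
  modes, and L is the Poincare constant of the high modes. The budget: of the dissipation 2 \<nu>
  x^2, the interaction quadratic in the high modes takes 1/5 \<nu> x^2, the terms linear in x take
  4/5 \<nu> x^2 by completing a square, and \<nu> x^2 remains.\<close>

lemma energy_arith:
  fixes x \<nu> G C L Hq Vp Hp S Hg h :: real
  assumes \<nu>: "\<nu> > 0" and C: "C \<ge> 0" and G: "G > 0" and L: "L \<ge> 1"
    and cond: "100 * (C * G)\<^sup>2 * (1 + (C * G)\<^sup>2) \<le> L\<^sup>2"
    and Hq: "0 \<le> Hq" "L * Hq \<le> x" and Vp: "0 \<le> Vp" "Vp \<le> \<nu> * G" and Hp: "0 \<le> Hp" "Hp \<le> Vp"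
    and Hg: "0 \<le> Hg" "Hg \<le> \<nu>\<^sup>2 * G"
    and S: "\<bar>S\<bar> \<le> C * Vp * Hp * x + C * x * Hq * Vp"
    and h: "h \<le> - 2 * \<nu> * x\<^sup>2 + 2 * Hg * Hq - 2 * S"
  shows "h \<le> - \<nu> * x\<^sup>2 + 5 / 2 * \<nu>^3 * (G\<^sup>2 * (1 + (C * G)\<^sup>2))"
proof -
  have Hqx: "Hq \<le> x" using mult_right_mono[OF L Hq(1)] Hq(2) by simp
  have x: "x \<ge> 0" using Hqx Hq(1) by linarith
  have CG: "0 \<le> C * G" using C G by simp
  have "(10 * (C * G))\<^sup>2 \<le> L\<^sup>2"
  proof -
    have "(10 * (C * G))\<^sup>2 * 1 \<le> 100 * (C * G)\<^sup>2 * (1 + (C * G)\<^sup>2)"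
      by (simp add: power_mult_distrib algebra_simps)
    then show ?thesis using cond by linarith
  qed
  then have CGL: "10 * (C * G) \<le> L" by (rule power2_le_imp_le) (use L in simp)
  have 1: "C * Vp * Hp * x \<le> \<nu>\<^sup>2 * (C * G\<^sup>2) * x"
  proof -
    have "Vp * Hp \<le> (\<nu> * G) * (\<nu> * G)" using Vp Hp by (intro mult_mono) auto
    then have "C * (Vp * Hp) * x \<le> C * ((\<nu> * G) * (\<nu> * G)) * x"
      using C x by (intro mult_right_mono mult_left_mono) auto
    then show ?thesis by (simp add: power2_eq_square mult_ac)
  qed
  have 2: "C * x * Hq * Vp \<le> \<nu> * x\<^sup>2 / 10"
  proof -
    have "10 * (C * Hq * Vp) \<le> \<nu> * x"
    proof -
      have "10 * (C * Hq * Vp) \<le> 10 * (C * Hq * (\<nu> * G))"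
        using C Hq Vp by (intro mult_left_mono) auto
      also have "\<dots> = \<nu> * (10 * (C * G) * Hq)" by (simp add: mult_ac)
      also have "\<dots> \<le> \<nu> * (L * Hq)" using \<nu> Hq CGL by (intro mult_left_mono mult_right_mono) auto
      also have "\<dots> \<le> \<nu> * x" using \<nu> Hq by (intro mult_left_mono) auto
      finally show ?thesis .
    qed
    then have "10 * (C * Hq * Vp) * x \<le> \<nu> * x * x" using x by (rule mult_right_mono)
    then show ?thesis by (simp add: power2_eq_square mult_ac)
  qed
  have 3: "Hg * Hq \<le> \<nu>\<^sup>2 * G * x" using Hg Hq Hqx by (intro mult_mono) auto
  \<comment> \<open>Collects the coefficients of the terms linear in x: G from the forcing, C G^2
    from the interaction of low modes with each other.\<close>
  define m where "m = G + C * G\<^sup>2"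
  have "h \<le> - 2 * (\<nu> * x\<^sup>2) + 2 * (Hg * Hq) - 2 * S"
    using h by (simp add: mult.assoc)
  then have "h \<le> 2 * (\<nu>\<^sup>2 * G * x) + 2 * (\<nu>\<^sup>2 * (C * G\<^sup>2) * x) - 9/5 * (\<nu> * x\<^sup>2)"
    using 1 2 3 S by linarith
  also have "\<dots> = - (9/5) * (\<nu> * x\<^sup>2) + 2 * (\<nu>\<^sup>2 * m * x)"
    by (simp add: m_def algebra_simps)
  also have "\<dots> \<le> - (\<nu> * x\<^sup>2) + 5/4 * \<nu>^3 * m\<^sup>2"
  proof -
    \<comment> \<open>The weight 4/5 is what may be spent to keep \<nu> x^2 out of 9/5 \<nu>
      x^2.\<close>
    have "0 \<le> 4/5 * \<nu> * (x - 5/4 * \<nu> * m)\<^sup>2" using \<nu> by simp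
    also have "\<dots> = 4/5 * (\<nu> * x\<^sup>2) - 2 * (\<nu>\<^sup>2 * m * x) + 5/4 * \<nu>^3 * m\<^sup>2"
      by (simp add: power2_eq_square power3_eq_cube algebra_simps)
    finally show ?thesis by linarith
  qed
  also have "5/4 * \<nu>^3 * m\<^sup>2 \<le> 5/4 * \<nu>^3 * (2 * (G\<^sup>2 * (1 + (C * G)\<^sup>2)))"
  proof (intro mult_left_mono)
    have "2 * G * (C * G\<^sup>2) \<le> G\<^sup>2 + (C * G\<^sup>2)\<^sup>2" by (rule sum_squares_bound)
    then show "m\<^sup>2 \<le> 2 * (G\<^sup>2 * (1 + (C * G)\<^sup>2))"
      by (simp add: m_def power2_sum power_mult_distrib algebra_simps power2_eq_square)
  qed (use \<nu> in simp)
  also have "5/4 * \<nu>^3 * (2 * (G\<^sup>2 * (1 + (C * G)\<^sup>2))) = 5 / 2 * \<nu>^3 * (G\<^sup>2 * (1 + (C * G)\<^sup>2))"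
    by simp
  finally show ?thesis by simp
qed

text \<open>The inequality for \<open>h\<close> is used twice. Combined with the Poincare inequality
  it bounds the high-mode energy uniformly after t0; integrated from s to t it then bounds the
  dissipation by that energy plus a linear term, so \<open>K\<close> does not depend on s. The
  constant 7/2 is 5/2 from the high modes plus 1 from the low modes, whose squared V-norm is at most
  (\<nu> G)^2.\<close>

lemma is_solution_average_bound:
  assumes Lady: "ladyzhenskaya C"
    and C: "C \<ge> 0" and \<nu>: "\<nu> > 0" and N: "N > 0" and sol: "is_solution \<nu> N g v0 v" and g: "Linf_H g"
    and gM: "\<forall>t\<ge>0. Hnorm (g t) \<le> \<nu>\<^sup>2 * M" and G: "M < G" "0 \<le> M"
    and cond: "100 * (C * G)\<^sup>2 * (1 + (C * G)\<^sup>2) \<le> (max 1 N)\<^sup>2"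
  obtains W K t0 where "has_prim W (\<lambda>t. (Vnorm (v t))\<^sup>2)" "t0 \<ge> 0" "K \<ge> 0"
    "\<And>s t. t0 \<le> s \<Longrightarrow> s \<le> t \<Longrightarrow> W t - W s \<le> K + 7 / 2 * \<nu>\<^sup>2 * (G\<^sup>2 * (1 + (C * G)\<^sup>2)) * (t - s)"
proof -
  have M: "\<And>t. t \<ge> 0 \<Longrightarrow> Hnorm (g t) \<le> \<nu>\<^sup>2 * M" using gM by blast
  define M0 where "M0 = 5 / 2 * \<nu>^3 * (G\<^sup>2 * (1 + (C * G)\<^sup>2))"
  have M0: "M0 \<ge> 0" using \<nu> by (simp add: M0_def)
  let ?Y = "\<lambda>t. (Hnorm (QN N (v t)))\<^sup>2"
  have gH: "\<And>t. t \<ge> 0 \<Longrightarrow> in_H (g t)" using g unfolding Linf_H_def by blast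
  have V: "\<And>t. t \<ge> 0 \<Longrightarrow> in_V (v t)" using is_solution_in_V[OF sol] .
  have cV: "continuous_on {0..} (\<lambda>t. Vnorm (v t))" using is_solution_continuous_Vnorm[OF sol] .
  have \<nu>0: "\<nu> \<ge> 0" using \<nu> by simp
  obtain D where D: "\<And>t. t \<ge> 0 \<Longrightarrow> set_integrable lborel {0..t} D"
    "AE t in lborel. t \<ge> 0 \<longrightarrow> (\<forall>F. finite F \<longrightarrow> (\<Sum>k\<in>F. norm (rhs \<nu> N g v t k) * norm (v t k)) \<le> D t)"
    using is_solution_dominated[OF \<nu>0 sol g in_V_imp_in_H[OF V] cV Hnorm_le_Vnorm[OF V]] by blast
  obtain h where h: "has_prim ?Y h"
    "AE t in lborel. t \<ge> 0 \<longrightarrow> ((\<lambda>k. 8 * pi\<^sup>2 * Re (cdot (rhs \<nu> N g v t k) (QN N (v t) k))) has_sum h t) UNIV"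
    using high_mode_energy[OF is_solution_has_prim[OF sol] in_V_imp_in_H[OF V] D] by blast
  obtain t0 where t0: "t0 \<ge> 0" "\<And>t. t \<ge> t0 \<Longrightarrow> Vnorm (PN N (v t)) \<le> \<nu> * G"
    using is_solution_low_bound[OF \<nu> sol g M G] by blast
  have hle: "AE t in lborel. t0 \<le> t \<longrightarrow> h t \<le> - \<nu> * (Vnorm (QN N (v t)))\<^sup>2 + M0"
    using h(2) is_solution_AE_in_DA[OF sol]
  proof (eventually_elim, intro impI)
    fix t assume *: "t \<ge> 0 \<longrightarrow> ((\<lambda>k. 8 * pi\<^sup>2 * Re (cdot (rhs \<nu> N g v t k) (QN N (v t) k))) has_sum h t) UNIV"
      "t \<ge> 0 \<longrightarrow> in_DA (v t)" and "t0 \<le> t"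
    then have t: "t \<ge> 0" using t0 by simp
    have DA: "in_DA (v t)" using * t by simp
    have q: "in_V (QN N (v t))" and p: "in_V (PN N (v t))" using V[OF t] by (auto intro: in_V_QN in_V_PN)
    let ?T = "Re (tri (v t) (v t) (QN N (v t)))"
    have "((\<lambda>k. Re (cdot (Bop (v t) (v t) k) (QN N (v t) k))) has_sum ?T) UNIV"
      by (intro has_sum_Re Bop_has_sum DA V t in_V_imp_in_H q)
    then have "h t \<le> - 2 * \<nu> * (Vnorm (QN N (v t)))\<^sup>2 + 2 * Hnorm (g t) * Hnorm (QN N (v t)) - 8 * pi\<^sup>2 * ?T"
      using * t by (intro high_mode_balance[where r="rhs \<nu> N g v t" and b="Bop (v t) (v t)"] V gH rhs_high) auto
    then have "h t \<le> - 2 * \<nu> * (Vnorm (QN N (v t)))\<^sup>2 + 2 * Hnorm (g t) * Hnorm (QN N (v t)) - 2 * (?T * (4 * pi\<^sup>2))"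
      by (simp add: mult_ac)
    then show "h t \<le> - \<nu> * (Vnorm (QN N (v t)))\<^sup>2 + M0"
      unfolding M0_def
    proof (rule energy_arith[OF \<nu> C, where L="max 1 N" and Hp="Hnorm (PN N (v t))" and Vp="Vnorm (PN N (v t))", rotated -1])
      show "\<bar>?T * (4 * pi\<^sup>2)\<bar> \<le> C * Vnorm (PN N (v t)) * Hnorm (PN N (v t)) * Vnorm (QN N (v t))
          + C * Vnorm (QN N (v t)) * Hnorm (QN N (v t)) * Vnorm (PN N (v t))"
        using Re_tri_high_bound[OF Lady C DA, of N] by (simp add: abs_mult)
      show "max 1 N * Hnorm (QN N (v t)) \<le> Vnorm (QN N (v t))"
        by (rule Hnorm_QN_le[OF V[OF t] N])
      show "Hnorm (PN N (v t)) \<le> Vnorm (PN N (v t))" by (rule Hnorm_le_Vnorm[OF p])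
      show "Vnorm (PN N (v t)) \<le> \<nu> * G" by (rule t0(2)[OF \<open>t0 \<le> t\<close>])
      have "\<nu>\<^sup>2 * M \<le> \<nu>\<^sup>2 * G" using G by (intro mult_left_mono) auto
      then show "Hnorm (g t) \<le> \<nu>\<^sup>2 * G" using M[OF t] by linarith
    qed (use G cond in auto)
  qed
  have HV: "?Y t \<le> (Vnorm (QN N (v t)))\<^sup>2" if "t \<ge> 0" for t
    by (intro power_mono Hnorm_le_Vnorm in_V_QN V that) simp
  \<comment> \<open>Gronwall with the constant coefficient \<nu>, so the averaged lower bound holds
    with \<alpha> = \<nu> and K = 0.\<close>
  have Ybound: "?Y t \<le> ?Y t0 + M0 / \<nu>" if t: "t \<ge> t0" for t
  proof -
    have "?Y t \<le> exp (0 - \<nu> * (t - t0)) * ?Y t0 + M0 * exp 0 / \<nu>"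
    proof (rule gronwall_average[OF h(1) continuous_on_const has_prim_linear t0(1) t \<nu> M0])
      show "AE r in lborel. t0 \<le> r \<longrightarrow> r \<le> t \<longrightarrow> h r \<le> - \<nu> * ?Y r + M0"
        using hle
      proof (eventually_elim, intro impI)
        fix r assume "t0 \<le> r \<longrightarrow> h r \<le> - \<nu> * (Vnorm (QN N (v r)))\<^sup>2 + M0" "t0 \<le> r"
        moreover have "\<nu> * ?Y r \<le> \<nu> * (Vnorm (QN N (v r)))\<^sup>2"
          using HV[of r] t0 \<open>t0 \<le> r\<close> \<nu> by (intro mult_left_mono) auto
        ultimately show "h r \<le> - \<nu> * ?Y r + M0" by simp
      qed
    qed (auto simp: algebra_simps)
    moreover have "exp (0 - \<nu> * (t - t0)) * ?Y t0 \<le> 1 * ?Y t0"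
      using \<nu> t by (intro mult_right_mono) auto
    ultimately show ?thesis by simp
  qed
  have cV2: "continuous_on {0..} (\<lambda>t. (Vnorm (v t))\<^sup>2)" by (intro continuous_intros cV)
  obtain W where "\<And>t. t \<ge> 0 \<Longrightarrow> (W has_vector_derivative (Vnorm (v t))\<^sup>2) (at t within {0..})"
    using continuous_has_antiderivative[OF cV2] by blast
  then have W: "has_prim W (\<lambda>t. (Vnorm (v t))\<^sup>2)" by (rule has_prim_C1[OF _ cV2])
  define K where "K = (?Y t0 + M0 / \<nu>) / \<nu>"
  show ?thesis
  proof (rule that[OF W t0(1), of K])
    show "K \<ge> 0" using \<nu> M0 by (simp add: K_def)
    fix s t assume st: "t0 \<le> s" "s \<le> t"
    \<comment> \<open>Comparison with a primitive of - \<nu> |v|_V^2 + const makes the increment of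
      \<open>W\<close> appear directly; adding the low modes completes |Q_N v|_V^2 to
      |v|_V^2.\<close>
    have "?Y t - ?Y s \<le> ((- \<nu>) * W t + (\<nu>^3 * G\<^sup>2 + M0) * t) - ((- \<nu>) * W s + (\<nu>^3 * G\<^sup>2 + M0) * s)"
    proof (rule has_prim_mono[OF h(1) has_prim_add[OF has_prim_cmult[OF W] has_prim_linear]])
      show "AE r in lborel. s \<le> r \<longrightarrow> r \<le> t \<longrightarrow> h r \<le> - \<nu> * (Vnorm (v r))\<^sup>2 + (\<nu>^3 * G\<^sup>2 + M0)"
        using hle
      proof (eventually_elim, intro impI)
        fix r assume *: "t0 \<le> r \<longrightarrow> h r \<le> - \<nu> * (Vnorm (QN N (v r)))\<^sup>2 + M0" and "s \<le> r"
        then have r: "t0 \<le> r" "r \<ge> 0" using st t0 by auto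
        have "(Vnorm (PN N (v r)))\<^sup>2 \<le> (\<nu> * G)\<^sup>2" by (intro power_mono t0(2) r) simp
        then have "\<nu> * (Vnorm (PN N (v r)))\<^sup>2 \<le> \<nu> * (\<nu> * G)\<^sup>2" using \<nu> by (intro mult_left_mono) auto
        then have "\<nu> * (Vnorm (v r))\<^sup>2 - \<nu> * (Vnorm (QN N (v r)))\<^sup>2 \<le> \<nu>^3 * G\<^sup>2"
          using Vnorm_PN_QN[OF V[OF r(2)], of N] by (simp add: algebra_simps power2_eq_square power3_eq_cube)
        then show "h r \<le> - \<nu> * (Vnorm (v r))\<^sup>2 + (\<nu>^3 * G\<^sup>2 + M0)" using * r by simp
      qed
    qed (use st t0 in auto)
    also have "\<dots> = (\<nu>^3 * G\<^sup>2 + M0) * (t - s) - \<nu> * (W t - W s)"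
      by (simp add: algebra_simps)
    finally have "\<nu> * (W t - W s) \<le> ?Y s + (\<nu>^3 * G\<^sup>2 + M0) * (t - s)"
      using zero_le_power2[of "Hnorm (QN N (v t))"] by linarith
    also have "\<dots> \<le> (?Y t0 + M0 / \<nu>) + (7 / 2 * \<nu>^3 * (G\<^sup>2 * (1 + (C * G)\<^sup>2))) * (t - s)"
    proof (intro add_mono Ybound st mult_right_mono)
      have "\<nu>^3 * G\<^sup>2 * 1 \<le> \<nu>^3 * G\<^sup>2 * (1 + (C * G)\<^sup>2)" using \<nu> by (intro mult_left_mono) auto
      then show "\<nu>^3 * G\<^sup>2 + M0 \<le> 7 / 2 * \<nu>^3 * (G\<^sup>2 * (1 + (C * G)\<^sup>2))"
        unfolding M0_def by (simp add: algebra_simps)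
    qed (use st in simp)
    also have "\<dots> = \<nu> * (K + 7 / 2 * \<nu>\<^sup>2 * (G\<^sup>2 * (1 + (C * G)\<^sup>2)) * (t - s))"
    proof -
      have "\<nu> * K = ?Y t0 + M0 / \<nu>" using \<nu> by (simp add: K_def)
      then show ?thesis by (simp add: distrib_left power3_eq_cube power2_eq_square mult_ac)
    qed
    finally show "W t - W s \<le> K + 7 / 2 * \<nu>\<^sup>2 * (G\<^sup>2 * (1 + (C * G)\<^sup>2)) * (t - s)"
      using \<nu> by (rule mult_left_le_imp_le)
  qed
qed

text \<open>\<open>Vz\<close> and \<open>Hz\<close> are the norms of the high modes of the
  difference. Young's inequality trades half of the dissipation for the term with C^2 / \<nu>, and
  the other half becomes \<nu> L^2 Hz^2. The remaining terms carry the small factors \<delta> and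
  \<rho>, which appear as additive perturbations and, bounded by \<eta>, as corrections to the
  coefficient.\<close>

lemma sync_arith:
  fixes Vz Hz V1 H2 V2 \<nu> C L \<delta> \<rho> \<eta> S h :: real
  assumes \<nu>: "\<nu> > 0" and C: "C \<ge> 0" and L: "L \<ge> 1"
    and Hz: "0 \<le> Hz" "L * Hz \<le> Vz" and V: "0 \<le> V1" "0 \<le> H2" "H2 \<le> V2"
    and \<delta>: "0 \<le> \<delta>" "\<delta> \<le> \<eta>" and \<rho>: "0 \<le> \<rho>" "\<rho> \<le> \<eta>"
    and S: "\<bar>S\<bar> \<le> C * Vz * Hz * V1 + \<rho> * (V1 * Hz) + \<rho> * (H2 * Hz)"
    and h: "h \<le> - 2 * \<nu> * Vz\<^sup>2 + 2 * \<delta> * Hz - 2 * S"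
  shows "h \<le> - (\<nu> * L\<^sup>2 - \<eta> - (C\<^sup>2 / \<nu> + \<eta>) * V1\<^sup>2 - \<eta> * V2\<^sup>2) * Hz\<^sup>2 + (\<delta> + 2 * \<rho>)"
proof -
  have 1: "2 * (C * Vz * Hz * V1) \<le> \<nu> * Vz\<^sup>2 + C\<^sup>2 / \<nu> * V1\<^sup>2 * Hz\<^sup>2"
  proof -
    have "0 \<le> (\<nu> * Vz - C * V1 * Hz)\<^sup>2 / \<nu>" using \<nu> by simp
    also have "\<dots> = \<nu> * Vz\<^sup>2 + C\<^sup>2 / \<nu> * V1\<^sup>2 * Hz\<^sup>2 - 2 * (C * Vz * Hz * V1)"
      using \<nu> by (simp add: power2_eq_square field_simps)
    finally show ?thesis by linarith
  qed
  \<comment> \<open>2 X Hz \<le> 1 + X^2 Hz^2 splits a term with prefactor c into an additive part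
    c, which will tend to 0, and a quadratic part whose prefactor is enlarged to the constant
    \<eta>.\<close>
  have gen: "2 * c * (X * Hz) \<le> c + \<eta> * (X\<^sup>2 * Hz\<^sup>2)" if "0 \<le> c" "c \<le> \<eta>" for c X
  proof -
    have "2 * 1 * (X * Hz) \<le> 1\<^sup>2 + (X * Hz)\<^sup>2" by (rule sum_squares_bound)
    then have "c * (2 * 1 * (X * Hz)) \<le> c * (1 + (X * Hz)\<^sup>2)" using that by (intro mult_left_mono) auto
    also have "\<dots> \<le> c + \<eta> * (X * Hz)\<^sup>2" using mult_right_mono[OF that(2), of "(X * Hz)\<^sup>2"] by (simp add: distrib_left)
    finally show ?thesis by (simp add: power_mult_distrib mult_ac)
  qed
  have 2: "2 * \<delta> * Hz \<le> \<delta> + \<eta> * Hz\<^sup>2" using gen[OF \<delta>, of 1] by simp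
  have 3: "2 * \<rho> * (V1 * Hz) \<le> \<rho> + \<eta> * (V1\<^sup>2 * Hz\<^sup>2)" by (rule gen[OF \<rho>])
  have 4: "2 * \<rho> * (H2 * Hz) \<le> \<rho> + \<eta> * (V2\<^sup>2 * Hz\<^sup>2)"
  proof -
    have "2 * \<rho> * (H2 * Hz) \<le> 2 * \<rho> * (V2 * Hz)"
      using \<rho> Hz V by (intro mult_left_mono mult_right_mono) auto
    then show ?thesis using gen[OF \<rho>, of V2] by linarith
  qed
  have 5: "\<nu> * (L\<^sup>2 * Hz\<^sup>2) \<le> \<nu> * Vz\<^sup>2"
  proof -
    have "(L * Hz)\<^sup>2 \<le> Vz\<^sup>2" using Hz L by (intro power_mono) auto
    then show ?thesis using \<nu> by (simp add: power_mult_distrib)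
  qed
  have "h \<le> - 2 * (\<nu> * Vz\<^sup>2) + 2 * \<delta> * Hz + 2 * (C * Vz * Hz * V1) + 2 * \<rho> * (V1 * Hz) + 2 * \<rho> * (H2 * Hz)"
    using h S abs_ge_minus_self[of S] by (simp add: mult.assoc)
  also have "\<dots> \<le> - \<nu> * (L\<^sup>2 * Hz\<^sup>2) + C\<^sup>2 / \<nu> * V1\<^sup>2 * Hz\<^sup>2 + \<eta> * Hz\<^sup>2 + \<eta> * (V1\<^sup>2 * Hz\<^sup>2) + \<eta> * (V2\<^sup>2 * Hz\<^sup>2) + (\<delta> + 2 * \<rho>)"
    using 1 2 3 4 5 by linarith
  also have "\<dots> = - (\<nu> * L\<^sup>2 - \<eta> - (C\<^sup>2 / \<nu> + \<eta>) * V1\<^sup>2 - \<eta> * V2\<^sup>2) * Hz\<^sup>2 + (\<delta> + 2 * \<rho>)"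
    by (simp add: algebra_simps)
  finally show ?thesis .
qed

lemma gfrak_bound:
  assumes "\<nu> > 0" "Linf_H g1" "Linf_H g2" "t \<ge> 0"
  shows "Hnorm (g1 t) \<le> \<nu>\<^sup>2 * gfrak \<nu> g1 g2" "Hnorm (g2 t) \<le> \<nu>\<^sup>2 * gfrak \<nu> g1 g2"
proof -
  have le: "Hnorm (g t) \<le> (SUP t\<in>{0..}. Hnorm (g t))" if g: "Linf_H g" for g
  proof (rule cSUP_upper)
    show "bdd_above ((\<lambda>t. Hnorm (g t)) ` {0..})"
    proof -
      obtain B where "\<forall>t\<ge>0. Hnorm (g t) \<le> B" using g unfolding Linf_H_def by blast
      then show ?thesis by (intro bdd_aboveI2[of _ _ B]) auto
    qed
  qed (use assms in simp)
  have eq: "\<nu>\<^sup>2 * gfrak \<nu> g1 g2 = max (SUP t\<in>{0..}. Hnorm (g1 t)) (SUP t\<in>{0..}. Hnorm (g2 t))"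
    using assms(1) by (simp add: gfrak_def)
  show "Hnorm (g1 t) \<le> \<nu>\<^sup>2 * gfrak \<nu> g1 g2" "Hnorm (g2 t) \<le> \<nu>\<^sup>2 * gfrak \<nu> g1 g2"
    unfolding eq using le[OF assms(2)] le[OF assms(3)] by (auto simp: le_max_iff_disj)
qed

text \<open>With K = (C M)^2 both cases lead to 200 K (1 + K) \<le> (max 1 N)^2. For N \<ge> 1 the
  logarithm is nonnegative and the second condition gives 2048 K (24 K + 1) \<le> N^2; for N < 1 the
  first gives 288 K \<le> 1. Passing from 200 to 100 buys the strict inequality that lets M be
  raised to G.\<close>

lemma grashof_condition:
  fixes N C S M :: real
  assumes N: "N > 0" and C: "C > 0" and M: "M \<ge> 0"
    and N1: "N \<ge> 12 * sqrt 2 * C * M"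
    and N2: "N \<ge> 32 * sqrt 2 * C * sqrt (24 * (C\<^sup>2 + S\<^sup>2 * ln N) * M\<^sup>2 + 1) * M"
  obtains G where "M < G" "100 * (C * G)\<^sup>2 * (1 + (C * G)\<^sup>2) \<le> (max 1 N)\<^sup>2"
proof -
  define K where "K = (C * M)\<^sup>2"
  have K: "K \<ge> 0" by (simp add: K_def)
  have "200 * K * (1 + K) \<le> (max 1 N)\<^sup>2"
  proof (cases "N \<ge> 1")
    case True
    have ln: "ln N \<ge> 0" using True by simp
    have CM: "0 \<le> 32 * sqrt 2 * C * M" using C M by simp
    have "24 * K + 1 \<le> 24 * (C\<^sup>2 + S\<^sup>2 * ln N) * M\<^sup>2 + 1"
      using ln by (simp add: K_def power_mult_distrib distrib_right)
    then have "(32 * sqrt 2 * C * M) * sqrt (24 * K + 1) \<le> (32 * sqrt 2 * C * M) * sqrt (24 * (C\<^sup>2 + S\<^sup>2 * ln N) * M\<^sup>2 + 1)"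
      using CM by (intro mult_left_mono) auto
    also have "\<dots> \<le> N" using N2 by (simp add: mult_ac)
    finally have "((32 * sqrt 2 * C * M) * sqrt (24 * K + 1))\<^sup>2 \<le> N\<^sup>2"
      using CM K by (intro power_mono) auto
    also have "((32 * sqrt 2 * C * M) * sqrt (24 * K + 1))\<^sup>2 = 2048 * K * (24 * K + 1)"
      using K by (simp add: power_mult_distrib K_def)
    finally have "2048 * K * (24 * K + 1) \<le> N\<^sup>2" .
    moreover have "200 * K * (1 + K) \<le> 2048 * K * (24 * K + 1)"
      using K by (simp add: algebra_simps)
    ultimately show ?thesis using True by (simp add: max_def)
  next
    case False
    have "(12 * sqrt 2 * C * M)\<^sup>2 \<le> 1\<^sup>2"
      using N1 False C M by (intro power_mono) auto
    then have K1: "288 * K \<le> 1" by (simp add: power_mult_distrib K_def)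
    have "200 * K * (1 + K) \<le> 200 * K * (1 + 1 / 288)"
      using K K1 by (intro mult_left_mono) auto
    also have "\<dots> \<le> 1" using K1 by simp
    finally show ?thesis using False by (simp add: max_def)
  qed
  moreover have "1 \<le> (max 1 N)\<^sup>2" by simp
  moreover have "200 * K * (1 + K) = 2 * (100 * K * (1 + K))" by simp
  ultimately have "100 * K * (1 + K) < (max 1 N)\<^sup>2" by linarith
  then have lt: "100 * (C * M)\<^sup>2 * (1 + (C * M)\<^sup>2) < (max 1 N)\<^sup>2"
    unfolding K_def .
  \<comment> \<open>Continuity at M: the strict inequality persists slightly to the right of
    M.\<close>
  have "((\<lambda>x. 100 * (C * x)\<^sup>2 * (1 + (C * x)\<^sup>2)) \<longlongrightarrow> 100 * (C * M)\<^sup>2 * (1 + (C * M)\<^sup>2)) (at_right M)"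
    by (intro tendsto_intros)
  from order_tendstoD(2)[OF this lt]
  have "\<forall>\<^sub>F x in at_right M. M < x \<and> 100 * (C * x)\<^sup>2 * (1 + (C * x)\<^sup>2) < (max 1 N)\<^sup>2"
    using eventually_at_right_less[of M] by eventually_elim simp
  then obtain G where "M < G" "100 * (C * G)\<^sup>2 * (1 + (C * G)\<^sup>2) < (max 1 N)\<^sup>2"
    using eventually_happens'[OF trivial_limit_at_right_real] by blast
  then show ?thesis using that by simp
qed

theorem theorem3p10:
  fixes \<nu> N C_L C_S :: real and g1 g2 v1 v2 :: "real \<Rightarrow> coef" and v01 v02 :: coef
  assumes nu_pos: "\<nu> > 0" and N_pos: "N > 0"
    and CL_pos: "C_L > 0" and CS_pos: "C_S > 0"
    and Ladyzhenskaya: "\<forall>c f. in_V c \<longrightarrow> represents f c \<longrightarrow>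
        (\<integral>\<^sup>+x. indicator Sq x * ennreal ((norm (f x))^4) \<partial>lborel)
          \<le> ennreal ((C_L * Vnorm c * Hnorm c)^2)"
    and Sobolev_log: "\<forall>M\<ge>2. \<forall>c. in_V c \<longrightarrow> Linf_PN M c \<le> C_S * sqrt (ln M) * Vnorm (PN M c)"
    and g1: "Linf_H g1" and g2: "Linf_H g2"
    and N1: "N \<ge> max (9 * sqrt 3 / C_L) (12 * sqrt 2 * C_L) * gfrak \<nu> g1 g2"
    and N2: "N \<ge> 32 * sqrt 2 * C_L * sqrt (24 * (C_L^2 + C_S^2 * ln N) * (gfrak \<nu> g1 g2)^2 + 1) * gfrak \<nu> g1 g2"
    and v01: "in_V v01" and v02: "in_V v02"
    and sol1: "is_solution \<nu> N g1 v01 v1" and sol2: "is_solution \<nu> N g2 v02 v2"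
    and g_conv: "((\<lambda>t. Hnorm (\<lambda>k. g1 t k - g2 t k)) \<longlongrightarrow> 0) at_top"
  shows "((\<lambda>t. Hnorm (\<lambda>k. v1 t k - v2 t k)) \<longlongrightarrow> 0) at_top"
proof -
  have Lady: "ladyzhenskaya C_L"
    using Ladyzhenskaya unfolding ladyzhenskaya_def .
  have C: "C_L \<ge> 0" and \<nu>0: "\<nu> \<ge> 0" using CL_pos nu_pos by auto
  define M where "M = gfrak \<nu> g1 g2"
  have gb: "\<forall>t\<ge>0. Hnorm (g1 t) \<le> \<nu>\<^sup>2 * M" "\<forall>t\<ge>0. Hnorm (g2 t) \<le> \<nu>\<^sup>2 * M"
    unfolding M_def using gfrak_bound[OF nu_pos g1 g2] by blast+
  then have "0 \<le> \<nu>\<^sup>2 * M" using order_trans[OF Hnorm_nonneg] by blast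
  then have M0: "0 \<le> M" using nu_pos by (simp add: zero_le_mult_iff)
  have "12 * sqrt 2 * C_L * M \<le> max (9 * sqrt 3 / C_L) (12 * sqrt 2 * C_L) * M"
    using M0 by (intro mult_right_mono) auto
  then have "12 * sqrt 2 * C_L * M \<le> N" using N1 unfolding M_def by linarith
  then obtain G where G: "M < G" and cond: "100 * (C_L * G)\<^sup>2 * (1 + (C_L * G)\<^sup>2) \<le> (max 1 N)\<^sup>2"
    using grashof_condition[OF N_pos CL_pos M0 _ N2[folded M_def]] by blast
  define L where "L = max 1 N"
  have L: "L \<ge> 1" by (simp add: L_def)
  define B where "B = 7 / 2 * \<nu>\<^sup>2 * (G\<^sup>2 * (1 + (C_L * G)\<^sup>2))"
  have B: "B \<ge> 0" by (simp add: B_def)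
  obtain W1 K1 t1 where W1: "has_prim W1 (\<lambda>t. (Vnorm (v1 t))\<^sup>2)" "t1 \<ge> 0" "K1 \<ge> 0"
    "\<And>s t. t1 \<le> s \<Longrightarrow> s \<le> t \<Longrightarrow> W1 t - W1 s \<le> K1 + B * (t - s)"
    by (rule is_solution_average_bound[OF Lady C nu_pos N_pos sol1 g1 gb(1) G M0 cond, folded B_def]) (rule that)
  obtain W2 K2 t2 where W2: "has_prim W2 (\<lambda>t. (Vnorm (v2 t))\<^sup>2)" "t2 \<ge> 0" "K2 \<ge> 0"
    "\<And>s t. t2 \<le> s \<Longrightarrow> s \<le> t \<Longrightarrow> W2 t - W2 s \<le> K2 + B * (t - s)"
    by (rule is_solution_average_bound[OF Lady C nu_pos N_pos sol2 g2 gb(2) G M0 cond, folded B_def]) (rule that)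

  define w where "w t = (\<lambda>k. v1 t k - v2 t k)" for t
  define \<gamma> where "\<gamma> t = (\<lambda>k. g1 t k - g2 t k)" for t
  define r where "r t = (\<lambda>k. rhs \<nu> N g1 v1 t k - rhs \<nu> N g2 v2 t k)" for t
  have V1: "in_V (v1 t)" and V2: "in_V (v2 t)" if "t \<ge> 0" for t
    using is_solution_in_V[OF sol1 that] is_solution_in_V[OF sol2 that] by auto
  have wV: "in_V (w t)" if "t \<ge> 0" for t
    unfolding w_def by (intro in_V_diff V1 V2 that)
  have gH: "in_H (g1 t)" "in_H (g2 t)" if "t \<ge> 0" for t
    using g1 g2 that unfolding Linf_H_def by auto
  have \<gamma>H: "in_H (\<gamma> t)" if "t \<ge> 0" for t
    unfolding \<gamma>_def by (intro in_H_diff gH that)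
  have prim: "has_prim (\<lambda>t. w t k) (\<lambda>t. r t k)" for k
    unfolding w_def r_def by (intro has_prim_diff is_solution_has_prim[OF sol1] is_solution_has_prim[OF sol2])
  have cV1: "continuous_on {0..} (\<lambda>t. Vnorm (v1 t))" and cV2: "continuous_on {0..} (\<lambda>t. Vnorm (v2 t))"
    using is_solution_continuous_Vnorm[OF sol1] is_solution_continuous_Vnorm[OF sol2] .
  have cmul_diff: "cmul c (x - y) = cmul c x - cmul c y" for c x y
    by (simp add: cmul_def algebra_simps)

  \<comment> \<open>The low modes of the difference solve the linear equation with forcing g1 - g2,
    so Gronwall applies with the constant coefficient \<nu> and no loss \<open>K\<close>.\<close>
  have lowlim: "((\<lambda>t. (Vnorm (PN N (w t)))\<^sup>2) \<longlongrightarrow> 0) at_top"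
  proof -
    obtain h where h: "has_prim (\<lambda>t. (Vnorm (PN N (w t)))\<^sup>2) h"
      "\<And>t. t \<ge> 0 \<Longrightarrow> h t \<le> - \<nu> * (Vnorm (PN N (w t)))\<^sup>2 + (Hnorm (\<gamma> t))\<^sup>2 / \<nu>"
    proof (rule low_mode_energy[OF nu_pos prim, where N=N and \<gamma>=\<gamma>])
      show "r t k = \<gamma> t k - cmul (of_real (\<nu> * ksq k)) (w t k)" if "k \<in> low N" for t k
        unfolding r_def \<gamma>_def w_def rhs_low[OF that] cmul_diff by simp
    qed (erule \<gamma>H, rule that)
    show ?thesis
    proof (rule gronwall_tendsto_0[OF h(1) _ continuous_on_const has_prim_linear nu_pos order_refl])
      show "AE t in lborel. 0 \<le> t \<longrightarrow> h t \<le> - \<nu> * (Vnorm (PN N (w t)))\<^sup>2 + (Hnorm (\<gamma> t))\<^sup>2 / \<nu>"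
        using h(2) by simp
      have "((\<lambda>t. (Hnorm (\<gamma> t))\<^sup>2 / \<nu>) \<longlongrightarrow> 0\<^sup>2 / \<nu>) at_top"
        using nu_pos g_conv unfolding \<gamma>_def by (intro tendsto_intros) auto
      then show "((\<lambda>t. (Hnorm (\<gamma> t))\<^sup>2 / \<nu>) \<longlongrightarrow> 0) at_top" by simp
      show "\<nu> * (t - s) - 0 \<le> \<nu> * t - \<nu> * s" for s t by (simp add: algebra_simps)
    qed simp
  qed
  have lowlim': "((\<lambda>t. Vnorm (PN N (w t))) \<longlongrightarrow> 0) at_top"
    using tendsto_real_sqrt[OF lowlim] by simp

  \<comment> \<open>Bounds the l^1 norms of the low modes of w and of their gradient, hence both
    trilinear terms that contain them.\<close>
  define \<rho> where "\<rho> t = real (card (low N)) * Vnorm (PN N (w t))" for t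
  have \<rho>lim: "(\<rho> \<longlongrightarrow> 0) at_top"
    unfolding \<rho>_def[abs_def] by (rule tendsto_mult_right_zero[OF lowlim'])
  have \<gamma>lim: "((\<lambda>t. Hnorm (\<gamma> t)) \<longlongrightarrow> 0) at_top" using g_conv by (simp add: \<gamma>_def)
  \<comment> \<open>Makes \<eta> (1 + 2 B) half of \<nu> L^2: this is the total cost of \<eta>
    itself and of \<eta> times the averages of the two squared V-norms.\<close>
  define \<eta> where "\<eta> = \<nu> * L\<^sup>2 / (2 * (1 + 2 * B))"
  have \<eta>: "\<eta> > 0" using nu_pos L B by (simp add: \<eta>_def)
  have "\<forall>\<^sub>F t in at_top. Hnorm (\<gamma> t) < \<eta> \<and> \<rho> t < \<eta>"
    using order_tendstoD(2)[OF \<gamma>lim \<eta>] order_tendstoD(2)[OF \<rho>lim \<eta>] by eventually_elim simp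
  then obtain t3 where t3: "\<And>t. t \<ge> t3 \<Longrightarrow> Hnorm (\<gamma> t) < \<eta> \<and> \<rho> t < \<eta>"
    by (auto simp: eventually_at_top_linorder)
  define s0 where "s0 = max (max t1 t2) t3"
  have s0: "s0 \<ge> 0" "s0 \<ge> t1" "s0 \<ge> t2" "s0 \<ge> t3" using W1(2) by (auto simp: s0_def)

  define a where "a t = \<nu> * L\<^sup>2 - \<eta> - (C_L\<^sup>2 / \<nu> + \<eta>) * (Vnorm (v1 t))\<^sup>2 - \<eta> * (Vnorm (v2 t))\<^sup>2" for t
  \<comment> \<open>A primitive of \<open>a\<close> written in terms of \<open>W1\<close> and
    \<open>W2\<close>, so that the averaged bounds on the solutions bound its increments.\<close>
  define A where "A t = (\<nu> * L\<^sup>2 - \<eta>) * t - (C_L\<^sup>2 / \<nu> + \<eta>) * W1 t - \<eta> * W2 t" for t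
  have ca: "continuous_on {0..} a"
    unfolding a_def[abs_def] by (intro continuous_intros cV1 cV2)
  have A: "has_prim A a"
    unfolding A_def[abs_def] a_def[abs_def]
    by (intro has_prim_diff has_prim_cmult has_prim_linear W1 W2)
  define K where "K = (C_L\<^sup>2 / \<nu> + \<eta>) * K1 + \<eta> * K2"
  \<comment> \<open>Of \<nu> L^2, one half goes to the terms with \<eta> and at most 7/200 to
    b(z,v1,z); more than a quarter is left.\<close>
  define \<alpha> where "\<alpha> = \<nu> * L\<^sup>2 / 4"
  have \<alpha>: "\<alpha> > 0" using nu_pos L by (simp add: \<alpha>_def)
  have avg: "A t - A s \<ge> \<alpha> * (t - s) - K" if st: "s0 \<le> s" "s \<le> t" for s t
  proof -
    have c: "C_L\<^sup>2 / \<nu> + \<eta> \<ge> 0" using nu_pos \<eta> by simp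
    have "(\<nu> * L\<^sup>2 - \<eta> - (C_L\<^sup>2 / \<nu> + \<eta>) * B - \<eta> * B) * (t - s) - K
       = (\<nu> * L\<^sup>2 - \<eta>) * (t - s) - (C_L\<^sup>2 / \<nu> + \<eta>) * (K1 + B * (t - s)) - \<eta> * (K2 + B * (t - s))"
      by (simp add: K_def algebra_simps add_divide_distrib diff_divide_distrib)
    also have "\<dots> \<le> (\<nu> * L\<^sup>2 - \<eta>) * (t - s) - (C_L\<^sup>2 / \<nu> + \<eta>) * (W1 t - W1 s) - \<eta> * (W2 t - W2 s)"
      by (intro diff_mono mult_left_mono order_refl W1(4) W2(4)) (use c \<eta> st s0 in auto)
    also have "\<dots> = A t - A s"
      by (simp add: A_def algebra_simps diff_divide_distrib)
    finally have ge: "(\<nu> * L\<^sup>2 - \<eta> - (C_L\<^sup>2 / \<nu> + \<eta>) * B - \<eta> * B) * (t - s) - K \<le> A t - A s" .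
    have "\<alpha> \<le> \<nu> * L\<^sup>2 - \<eta> - (C_L\<^sup>2 / \<nu> + \<eta>) * B - \<eta> * B"
    proof -
      have "\<eta> * (1 + 2 * B) = \<nu> * L\<^sup>2 / 2" using B by (simp add: \<eta>_def field_simps)
      moreover have "C_L\<^sup>2 / \<nu> * B = 7 / 200 * \<nu> * (100 * (C_L * G)\<^sup>2 * (1 + (C_L * G)\<^sup>2))"
        using nu_pos by (simp add: B_def power2_eq_square field_simps)
      moreover have "7 / 200 * \<nu> * (100 * (C_L * G)\<^sup>2 * (1 + (C_L * G)\<^sup>2)) \<le> 7 / 200 * \<nu> * L\<^sup>2"
        using cond nu_pos unfolding L_def by (intro mult_left_mono) auto
      moreover have "\<eta> + (C_L\<^sup>2 / \<nu> + \<eta>) * B + \<eta> * B = \<eta> * (1 + 2 * B) + C_L\<^sup>2 / \<nu> * B"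
        by (simp add: algebra_simps)
      moreover have "0 \<le> \<nu> * L\<^sup>2" using nu_pos by simp
      ultimately show ?thesis unfolding \<alpha>_def by linarith
    qed
    then have "\<alpha> * (t - s) \<le> (\<nu> * L\<^sup>2 - \<eta> - (C_L\<^sup>2 / \<nu> + \<eta>) * B - \<eta> * B) * (t - s)"
      using st by (intro mult_right_mono) auto
    then show ?thesis using ge by linarith
  qed

  define \<kappa> where "\<kappa> t = Vnorm (v1 t) + Vnorm (v2 t)" for t
  have c\<kappa>: "continuous_on {0..} \<kappa>" unfolding \<kappa>_def[abs_def] by (intro continuous_intros cV1 cV2)
  have w\<kappa>: "Hnorm (w t) \<le> \<kappa> t" if "t \<ge> 0" for t
  proof -
    have "Hnorm (w t) \<le> 2 * pi * l2n (\<lambda>k. norm (v1 t k) + norm (v2 t k))"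
      unfolding Hnorm_l2n w_def
      by (intro mult_left_mono l2n_mono(1) l2n_triangle(1) in_H_l2 in_V_imp_in_H V1 V2 that)
         (auto intro: norm_triangle_ineq4)
    also have "\<dots> \<le> 2 * pi * (l2n (\<lambda>k. norm (v1 t k)) + l2n (\<lambda>k. norm (v2 t k)))"
      by (intro mult_left_mono l2n_triangle(2) in_H_l2 in_V_imp_in_H V1 V2 that) auto
    also have "\<dots> = Hnorm (v1 t) + Hnorm (v2 t)" by (simp add: Hnorm_l2n distrib_left)
    also have "\<dots> \<le> \<kappa> t" unfolding \<kappa>_def by (intro add_mono Hnorm_le_Vnorm V1 V2 that)
    finally show ?thesis .
  qed
  \<comment> \<open>The two right-hand sides are dominated separately, both tested with w, and the
    sum of the majorants serves their difference.\<close>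
  obtain D1 where D1: "\<And>t. t \<ge> 0 \<Longrightarrow> set_integrable lborel {0..t} D1"
    "AE t in lborel. t \<ge> 0 \<longrightarrow> (\<forall>F. finite F \<longrightarrow> (\<Sum>k\<in>F. norm (rhs \<nu> N g1 v1 t k) * norm (w t k)) \<le> D1 t)"
    using is_solution_dominated[OF \<nu>0 sol1 g1 in_V_imp_in_H[OF wV] c\<kappa> w\<kappa>] by blast
  obtain D2 where D2: "\<And>t. t \<ge> 0 \<Longrightarrow> set_integrable lborel {0..t} D2"
    "AE t in lborel. t \<ge> 0 \<longrightarrow> (\<forall>F. finite F \<longrightarrow> (\<Sum>k\<in>F. norm (rhs \<nu> N g2 v2 t k) * norm (w t k)) \<le> D2 t)"
    using is_solution_dominated[OF \<nu>0 sol2 g2 in_V_imp_in_H[OF wV] c\<kappa> w\<kappa>] by blast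
  have Dint: "set_integrable lborel {0..t} (\<lambda>t. D1 t + D2 t)" if "t \<ge> 0" for t
    by (rule set_integral_add(1)[OF D1(1)[OF that] D2(1)[OF that]])
  have Ddom: "AE t in lborel. t \<ge> 0 \<longrightarrow> (\<forall>F. finite F \<longrightarrow> (\<Sum>k\<in>F. norm (r t k) * norm (w t k)) \<le> D1 t + D2 t)"
    using D1(2) D2(2)
  proof (eventually_elim, intro impI allI)
    fix t :: real and F :: "(int \<times> int) set"
    assume *: "t \<ge> 0 \<longrightarrow> (\<forall>F. finite F \<longrightarrow> (\<Sum>k\<in>F. norm (rhs \<nu> N g1 v1 t k) * norm (w t k)) \<le> D1 t)"
      "t \<ge> 0 \<longrightarrow> (\<forall>F. finite F \<longrightarrow> (\<Sum>k\<in>F. norm (rhs \<nu> N g2 v2 t k) * norm (w t k)) \<le> D2 t)"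
      and t: "t \<ge> 0" and F: "finite F"
    have "(\<Sum>k\<in>F. norm (r t k) * norm (w t k)) \<le> (\<Sum>k\<in>F. (norm (rhs \<nu> N g1 v1 t k) + norm (rhs \<nu> N g2 v2 t k)) * norm (w t k))"
      unfolding r_def by (intro sum_mono mult_right_mono norm_triangle_ineq4) simp
    also have "\<dots> = (\<Sum>k\<in>F. norm (rhs \<nu> N g1 v1 t k) * norm (w t k)) + (\<Sum>k\<in>F. norm (rhs \<nu> N g2 v2 t k) * norm (w t k))"
      by (simp add: distrib_right sum.distrib)
    also have "\<dots> \<le> D1 t + D2 t" using * t F by (intro add_mono) blast+
    finally show "(\<Sum>k\<in>F. norm (r t k) * norm (w t k)) \<le> D1 t + D2 t" .
  qed
  obtain h where h: "has_prim (\<lambda>t. (Hnorm (QN N (w t)))\<^sup>2) h"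
    "AE t in lborel. t \<ge> 0 \<longrightarrow> ((\<lambda>k. 8 * pi\<^sup>2 * Re (cdot (r t k) (QN N (w t) k))) has_sum h t) UNIV"
    using high_mode_energy[OF prim in_V_imp_in_H[OF wV] Dint Ddom] by blast
  have hle: "AE t in lborel. s0 \<le> t \<longrightarrow> h t \<le> - a t * (Hnorm (QN N (w t)))\<^sup>2 + (Hnorm (\<gamma> t) + 2 * \<rho> t)"
    using h(2) is_solution_AE_in_DA[OF sol1] is_solution_AE_in_DA[OF sol2]
  proof (eventually_elim, intro impI)
    fix t assume *: "t \<ge> 0 \<longrightarrow> ((\<lambda>k. 8 * pi\<^sup>2 * Re (cdot (r t k) (QN N (w t) k))) has_sum h t) UNIV"
      "t \<ge> 0 \<longrightarrow> in_DA (v1 t)" "t \<ge> 0 \<longrightarrow> in_DA (v2 t)" and st: "s0 \<le> t"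
    then have t: "t \<ge> 0" using s0 by simp
    have DA: "in_DA (v1 t)" "in_DA (v2 t)" using * t by auto
    let ?z = "QN N (w t)"
    let ?T = "Re (tri (v1 t) (v1 t) ?z) - Re (tri (v2 t) (v2 t) ?z)"
    have zH: "in_H ?z" by (intro in_V_imp_in_H in_V_QN wV t)
    have "((\<lambda>k. Re (cdot (Bop (v1 t) (v1 t) k) (?z k)) + - Re (cdot (Bop (v2 t) (v2 t) k) (?z k)))
        has_sum Re (tri (v1 t) (v1 t) ?z) + - Re (tri (v2 t) (v2 t) ?z)) UNIV"
      by (intro has_sum_add has_sum_uminus[THEN iffD2])
         (simp_all add: has_sum_Re Bop_has_sum DA V1 V2 t zH)
    then have b: "((\<lambda>k. Re (cdot (Bop (v1 t) (v1 t) k - Bop (v2 t) (v2 t) k) (?z k))) has_sum ?T) UNIV"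
      by simp
    have "h t \<le> - 2 * \<nu> * (Vnorm ?z)\<^sup>2 + 2 * Hnorm (\<gamma> t) * Hnorm ?z - 8 * pi\<^sup>2 * ?T"
    proof (rule high_mode_balance[OF _ wV[OF t] \<gamma>H[OF t] b])
      show "r t k = \<gamma> t k - cmul (of_real (\<nu> * ksq k)) (w t k) - (Bop (v1 t) (v1 t) k - Bop (v2 t) (v2 t) k)"
        if "k \<notin> low N" for k
        unfolding r_def \<gamma>_def w_def rhs_high[OF that] cmul_diff by simp
    qed (use * t in blast)
    then have "h t \<le> - 2 * \<nu> * (Vnorm ?z)\<^sup>2 + 2 * Hnorm (\<gamma> t) * Hnorm ?z - 2 * (?T * (4 * pi\<^sup>2))"
      by (simp add: mult_ac)
    then show "h t \<le> - a t * (Hnorm ?z)\<^sup>2 + (Hnorm (\<gamma> t) + 2 * \<rho> t)"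
      unfolding a_def
    proof (rule sync_arith[OF nu_pos C L, where \<rho>="\<rho> t" and ?V1.0="Vnorm (v1 t)" and ?V2.0="Vnorm (v2 t)" and ?H2.0="Hnorm (v2 t)", rotated -1])
      show "L * Hnorm ?z \<le> Vnorm ?z" unfolding L_def by (rule Hnorm_QN_le[OF wV[OF t] N_pos])
      show "Hnorm (v2 t) \<le> Vnorm (v2 t)" by (rule Hnorm_le_Vnorm[OF V2[OF t]])
      show "\<bar>?T * (4 * pi\<^sup>2)\<bar> \<le> C_L * Vnorm ?z * Hnorm ?z * Vnorm (v1 t) + \<rho> t * (Vnorm (v1 t) * Hnorm ?z) + \<rho> t * (Hnorm (v2 t) * Hnorm ?z)"
        using Re_tri_difference_bound[OF Lady C DA w_def \<rho>_def] by (simp add: abs_mult)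
      show "Hnorm (\<gamma> t) \<le> \<eta>" "\<rho> t \<le> \<eta>" using t3[of t] st s0 by auto
    qed (simp_all add: \<rho>_def)
  qed
  have "((\<lambda>t. Hnorm (\<gamma> t) + 2 * \<rho> t) \<longlongrightarrow> 0 + 2 * 0) at_top"
    by (intro tendsto_intros \<gamma>lim \<rho>lim)
  then have blim: "((\<lambda>t. Hnorm (\<gamma> t) + 2 * \<rho> t) \<longlongrightarrow> 0) at_top" by simp
  have highlim: "((\<lambda>t. (Hnorm (QN N (w t)))\<^sup>2) \<longlongrightarrow> 0) at_top"
    by (rule gronwall_tendsto_0[OF h(1) zero_le_power2 ca A \<alpha> s0(1) hle blim avg])
  \<comment> \<open>The low modes are measured in V and the high modes in H; this suffices, because
    the V-norm of the low modes bounds their H-norm.\<close>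
  have "((\<lambda>t. sqrt ((Vnorm (PN N (w t)))\<^sup>2 + (Hnorm (QN N (w t)))\<^sup>2)) \<longlongrightarrow> sqrt (0 + 0)) at_top"
    by (intro tendsto_intros lowlim highlim)
  then have lim: "((\<lambda>t. sqrt ((Vnorm (PN N (w t)))\<^sup>2 + (Hnorm (QN N (w t)))\<^sup>2)) \<longlongrightarrow> 0) at_top" by simp
  have "((\<lambda>t. Hnorm (w t)) \<longlongrightarrow> 0) at_top"
  proof (rule tendsto_sandwich[OF _ _ tendsto_const lim])
    show "\<forall>\<^sub>F t in at_top. 0 \<le> Hnorm (w t)" by simp
    show "\<forall>\<^sub>F t in at_top. Hnorm (w t) \<le> sqrt ((Vnorm (PN N (w t)))\<^sup>2 + (Hnorm (QN N (w t)))\<^sup>2)"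
      using eventually_ge_at_top[of 0]
    proof eventually_elim
      case (elim t)
      have "(Hnorm (w t))\<^sup>2 \<le> (Vnorm (PN N (w t)))\<^sup>2 + (Hnorm (QN N (w t)))\<^sup>2"
        unfolding Hnorm_PN_QN[OF in_V_imp_in_H[OF wV[OF elim]], of N]
        by (intro add_right_mono power_mono Hnorm_le_Vnorm in_V_PN wV elim) simp
      then show ?case by (rule real_le_rsqrt)
    qed
  qed
  then show ?thesis by (simp add: w_def)
qed

end
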